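(* Let $q\geq 3$, $1<s<q$ and positive integers $r_1,\dots,r_s$ with $\sum_{i=1}^s r_i=q$, and let $z>2$. Consider the generalized fuzzy Potts model $\mu^N_{\beta,q,z,(r_1,\dots,r_s)}$ at inverse temperature $\beta>0$. For an integer $r\geq 2$ let $\beta_c(r,z)$ be the critical inverse temperature of the $r$-state generalized Potts model with the same exponent $z$. Then: (i) If $2<z\leq 4$ and $r_i\leq 2$ for all $i\in\{1,\dots,s\}$, then the limiting conditional probabilities exist and are continuous functions of the empirical distribution of the conditioning for all $\beta\geq0$. Now assume $z>4$ or that $r_i\geq 3$ for some $i$. Put $r_*:=\min\{r\geq 3: r=r_i\text{ for some } i\}$ and $r_\#:=\min\{r\geq 2: r=r_i\text{ for some } i\}$. Then: (ii) If $z>4$, then the limiting conditional probabilities exist and are continuous for all $\beta<\beta_c(r_\#,z)$, and they are discontinuous for all $\beta\geq\beta_c(r_\#,z)$; in particular they do not exist at points of discontinuity. (iii) If $2<z\leq 4$, then the limiting conditional probabilities exist and are continuous for all $\beta<\beta_c(r_*,z)$, and they are discontinuous for all $\beta\geq\beta_c(r_*,z)$; in particular they do not exist at points of discontinuity.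
   Context: Generalized Potts measure: for an integer $q\geq2$, real $z\geq2$, $\beta\geq0$, $N\in\mathbb{N}$, $\pi^N_{\beta,q,z}(\xi)=\frac1Z\exp\big(\frac{N\beta}{z}\sum_{i=1}^q(L_N^\xi(i))^z\big)$ on $\{1,\dots,q\}^N$, where $L_N^\xi=\frac1N\sum_{j}\delta_{\xi_j}$. Its critical inverse temperature $\beta_c(q,z)>0$ is the threshold such that the weak limit of the law of $L_N$ is $\delta_{(1/q,\dots,1/q)}$ for $\beta<\beta_c(q,z)$ and a symmetric mixture of $q$ non-uniform point masses for $\beta>\beta_c(q,z)$. Fuzzy Potts model: given $1<s<q$ and positive integers $r_1,\dots,r_s$ with $\sum r_i=q$, let $T:\{1,\dots,q\}\to\{1,\dots,s\}$ map $k$ to the unique $l$ with $\sum_{j<l}r_j<k\leq\sum_{j\leq l}r_j$, applied sitewise to configurations. If $X\sim\pi^N_{\beta,q,z}$, the law of $Y=T(X)$ on $\{1,\dots,s\}^N$ is the finite-volume fuzzy Potts measure $\mu^N_{\beta,q,z,(r_1,\dots,r_s)}$. By permutation invariance, for each site $i$ and $\eta\in\{1,\dots,s\}^{\{1,\dots,N\}\setminus\{i\}}$, $\mu^N(Y_i=k\mid Y_{\{1,\dots,N\}\setminus\{i\}}=\eta)=Q^N(k\mid\bar\eta)$ depends only on the empirical distribution $\bar\eta\in\mathcal{P}(\{1,\dots,s\})$, $\bar\eta_l=\#\{j\neq i:\eta_j=l\}/(N-1)$. The limiting conditional probability at $\nu\in\mathcal{P}(\{1,\dots,s\})$ exists if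 $Q^\infty(k\mid\nu):=\lim_{N}Q^N(k\mid\nu_N)$ exists for all $k$ and all sequences $\nu_N\to\nu$ of admissible empirical distributions (independently of the sequence); continuity refers to continuity of $\nu\mapsto Q^\infty(\cdot\mid\nu)$. The model is called Gibbs if the limiting conditional probabilities exist and are continuous, and non-Gibbs otherwise. *)

theory Defs
  imports "HOL-Analysis.Analysis"
begin

definition configs :: "nat \<Rightarrow> nat set \<Rightarrow> nat list set" where
  "configs n A = {xs. length xs = n \<and> set xs \<subseteq> A}"

definition emp :: "nat list \<Rightarrow> nat \<Rightarrow> real" where
  "emp xs i = real (count_list xs i) / real (length xs)"

text \<open>The probability prob_simplex P({1,...,m}), embedded in nat => real (product topology).\<close>
definition prob_simplex :: "nat \<Rightarrow> (nat \<Rightarrow> real) set" where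
  "prob_simplex m = {\<nu>. (\<forall>i. 0 \<le> \<nu> i) \<and> (\<forall>i. i \<notin> {1..m} \<longrightarrow> \<nu> i = 0) \<and> sum \<nu> {1..m} = 1}"

definition potts_weight :: "nat \<Rightarrow> real \<Rightarrow> real \<Rightarrow> nat list \<Rightarrow> real" where
  "potts_weight q z \<beta> xs =
     exp (real (length xs) * \<beta> / z * (\<Sum>i\<in>{1..q}. emp xs i powr z))"

definition potts_Z :: "nat \<Rightarrow> real \<Rightarrow> real \<Rightarrow> nat \<Rightarrow> real" where
  "potts_Z q z \<beta> N = (\<Sum>xs\<in>configs N {1..q}. potts_weight q z \<beta> xs)"

definition potts_prob :: "nat \<Rightarrow> real \<Rightarrow> real \<Rightarrow> nat list \<Rightarrow> real" where
  "potts_prob q z \<beta> xs = potts_weight q z \<beta> xs / potts_Z q z \<beta> (length xs)"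

definition potts_unif_limit :: "nat \<Rightarrow> real \<Rightarrow> real \<Rightarrow> bool" where
  "potts_unif_limit q z \<beta> \<longleftrightarrow>
     (\<forall>f :: (nat \<Rightarrow> real) \<Rightarrow> real. continuous_on (prob_simplex q) f \<longrightarrow>
        (\<lambda>N. \<Sum>xs\<in>configs N {1..q}. potts_prob q z \<beta> xs * f (emp xs))
          \<longlonglongrightarrow> f (\<lambda>i. if i \<in> {1..q} then 1 / real q else 0))"

definition potts_crit :: "nat \<Rightarrow> real \<Rightarrow> real" where
  "potts_crit q z = Sup {\<beta>. 0 \<le> \<beta> \<and> potts_unif_limit q z \<beta>}"

definition fuzzy_map :: "nat \<Rightarrow> (nat \<Rightarrow> nat) \<Rightarrow> nat \<Rightarrow> nat" where
  "fuzzy_map s r k = (THE l. l \<in> {1..s} \<and> sum r {1..<l} < k \<and> k \<le> sum r {1..l})"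

definition fuzzy_prob ::
  "nat \<Rightarrow> nat \<Rightarrow> (nat \<Rightarrow> nat) \<Rightarrow> real \<Rightarrow> real \<Rightarrow> nat list \<Rightarrow> real" where
  "fuzzy_prob q s r z \<beta> ys =
     (\<Sum>xs\<in>{xs\<in>configs (length ys) {1..q}. map (fuzzy_map s r) xs = ys}. potts_prob q z \<beta> xs)"

text \<open>Single-site conditional probability of Y_i = k given the other N-1 sites equal eta
  (the site i is taken to be the last one; by permutation invariance the choice is irrelevant).\<close>
definition fuzzy_cond ::
  "nat \<Rightarrow> nat \<Rightarrow> (nat \<Rightarrow> nat) \<Rightarrow> real \<Rightarrow> real \<Rightarrow> nat \<Rightarrow> nat list \<Rightarrow> real" where
  "fuzzy_cond q s r z \<beta> k \<eta> =
     fuzzy_prob q s r z \<beta> (\<eta> @ [k]) / (\<Sum>l\<in>{1..s}. fuzzy_prob q s r z \<beta> (\<eta> @ [l]))"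

definition admissible :: "nat \<Rightarrow> nat \<Rightarrow> (nat \<Rightarrow> real) \<Rightarrow> bool" where
  "admissible s N \<nu> \<longleftrightarrow> (\<exists>\<eta>\<in>configs (N - 1) {1..s}. emp \<eta> = \<nu>)"

definition QN ::
  "nat \<Rightarrow> nat \<Rightarrow> (nat \<Rightarrow> nat) \<Rightarrow> real \<Rightarrow> real \<Rightarrow> nat \<Rightarrow> nat \<Rightarrow> (nat \<Rightarrow> real) \<Rightarrow> real" where
  "QN q s r z \<beta> N k \<nu> =
     fuzzy_cond q s r z \<beta> k (SOME \<eta>. \<eta> \<in> configs (N - 1) {1..s} \<and> emp \<eta> = \<nu>)"

definition lcp_limit_at ::
  "nat \<Rightarrow> nat \<Rightarrow> (nat \<Rightarrow> nat) \<Rightarrow> real \<Rightarrow> real \<Rightarrow> (nat \<Rightarrow> real) \<Rightarrow> (nat \<Rightarrow> real) \<Rightarrow> bool" where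
  "lcp_limit_at q s r z \<beta> \<nu> Q \<longleftrightarrow>
     (\<forall>k\<in>{1..s}. \<forall>\<nu>s :: nat \<Rightarrow> nat \<Rightarrow> real.
        (\<forall>N. admissible s N (\<nu>s N)) \<and> \<nu>s \<longlonglongrightarrow> \<nu> \<longrightarrow>
        (\<lambda>N. QN q s r z \<beta> N k (\<nu>s N)) \<longlonglongrightarrow> Q k)"

definition lcp_exists ::
  "nat \<Rightarrow> nat \<Rightarrow> (nat \<Rightarrow> nat) \<Rightarrow> real \<Rightarrow> real \<Rightarrow> (nat \<Rightarrow> real) \<Rightarrow> bool" where
  "lcp_exists q s r z \<beta> \<nu> \<longleftrightarrow> (\<exists>Q. lcp_limit_at q s r z \<beta> \<nu> Q)"

definition Qinf ::
  "nat \<Rightarrow> nat \<Rightarrow> (nat \<Rightarrow> nat) \<Rightarrow> real \<Rightarrow> real \<Rightarrow> (nat \<Rightarrow> real) \<Rightarrow> nat \<Rightarrow> real" where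
  "Qinf q s r z \<beta> \<nu> k = (SOME Q. lcp_limit_at q s r z \<beta> \<nu> Q) k"

definition fuzzy_gibbs :: "nat \<Rightarrow> nat \<Rightarrow> (nat \<Rightarrow> nat) \<Rightarrow> real \<Rightarrow> real \<Rightarrow> bool" where
  "fuzzy_gibbs q s r z \<beta> \<longleftrightarrow>
     (\<forall>\<nu>\<in>prob_simplex s. lcp_exists q s r z \<beta> \<nu>) \<and>
     (\<forall>k\<in>{1..s}. continuous_on (prob_simplex s) (\<lambda>\<nu>. Qinf q s r z \<beta> \<nu> k))"

end

theory Submission
  imports Defs
begin

text \<open>
  Grouping spins by fuzzy class factorises the weight of a fuzzy configuration into partition
  functions of Potts models with \<open>r l\<close> states, so a single-site conditional probability is
  \<open>R k / (\<Sum>l. R l)\<close> with \<open>R l = A (n + 1) / A n\<close> for the partition function \<open>A\<close> of class \<open>l\<close> on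
  \<open>n\<close> sites. The sequence \<open>A\<close> is log-convex, hence \<open>R\<close> is nondecreasing in \<open>n\<close> and converges as
  \<open>n / N \<longlonglongrightarrow> v\<close> wherever the convex limiting pressure \<open>v * max_free_energy (\<beta> * v powr (z - 1))\<close> is
  differentiable. In the disordered regime the pressure is explicit; for two states and \<open>z \<le> 4\<close> the
  maximiser of the free energy is unique up to symmetry, so that the pressure is always smooth.
  Otherwise the transition is of first order: a non-uniform maximiser coexists with the uniform one
  at the critical temperature, the pressure has a kink at \<open>\<beta> * v powr (z - 1) = crit\<close>, and \<open>R l\<close>
  jumps upwards while, by monotonicity, the other ratios do not increase. If \<open>v = 1\<close> only
  \<open>n < N\<close> is available; there the ordered and the disordered phase have comparable weights at
  \<open>n = N - 1\<close>, which requires estimates without polynomial losses.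
\<close>

section \<open>Weighted sums over configurations\<close>

text \<open>Since the energy is homogeneous of degree \<open>z\<close>, a class holding the fraction
  \<open>v\<close> of all sites behaves like a Potts model at inverse temperature
  \<open>\<beta> * v powr (z - 1)\<close>. Letting \<open>v\<close> run through
  \<open>[0, 1]\<close> sweeps all values up to \<open>\<beta>\<close>, so a class meets its own
  transition for some admissible \<open>v\<close> exactly when \<open>\<beta>\<close> reaches its
  critical value. Averaging blocks of coordinates shows that this value does not decrease with the
  number of states, which is why the smallest relevant class decides. The statement defines the
  critical value by weak limits of the Potts measure, the argument by maximisers of the free energy;
  the two suprema agree by an exponential Markov inequality in one direction and Jensen's inequality
  in the other. Continuity needs no separate argument: convergence along all admissible sequences,
  at every point, already forces a continuous limit, so only existence has to be decided. The
  delicate value is \<open>\<beta>\<close> equal to the critical one: the critical fraction is then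
  \<open>v = 1\<close>, and the far side of the kink would need more sites than the system
  has.\<close>

definition wsum :: "nat set \<Rightarrow> (nat \<Rightarrow> nat \<Rightarrow> real) \<Rightarrow> nat \<Rightarrow> real" where
  "wsum I w n = (\<Sum>xs\<in>configs n I. \<Prod>i\<in>I. w i (count_list xs i))"

text \<open>Differentiation of the \<open>x\<close>-th factor: \<open>wsum I w n\<close> is
  \<open>n!\<close> times the coefficient of \<open>t^n\<close> in the product of the exponential
  generating functions of the sequences \<open>w i\<close>, and removing the first letter of a word
  differentiates that product.\<close>

definition shift :: "(nat \<Rightarrow> nat \<Rightarrow> real) \<Rightarrow> nat \<Rightarrow> nat \<Rightarrow> nat \<Rightarrow> real" where
  "shift w x = w(x := \<lambda>m. w x (Suc m))"

lemma configs_0 [simp]: "configs 0 I = {[]}"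
  by (auto simp: configs_def)

lemma configs_Suc: "configs (Suc n) I = (\<lambda>(x, xs). x # xs) ` (I \<times> configs n I)"
  by (auto simp: configs_def length_Suc_conv image_iff)

lemma finite_configs [simp]: "finite I \<Longrightarrow> finite (configs n I)"
  by (induction n) (auto simp: configs_Suc)

lemma configs_nonempty: "I \<noteq> {} \<Longrightarrow> configs n I \<noteq> {}"
  by (induction n) (auto simp: configs_Suc)

lemma sum_configs_Suc:
  "(\<Sum>xs\<in>configs (Suc n) I. f xs) = (\<Sum>x\<in>I. \<Sum>xs\<in>configs n I. f (x # xs))"
proof -
  have "inj_on (\<lambda>(x, xs). x # xs) (I \<times> configs n I)" by (auto simp: inj_on_def)
  then show ?thesis
    by (simp add: configs_Suc sum.reindex sum.cartesian_product case_prod_unfold)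
qed

lemma shift_count: "w i (count_list (x # xs) i) = shift w x i (count_list xs i)"
  by (simp add: shift_def)

lemma wsum_0: "wsum I w 0 = (\<Prod>i\<in>I. w i 0)"
  by (simp add: wsum_def)

lemma wsum_Suc: "wsum I w (Suc n) = (\<Sum>x\<in>I. wsum I (shift w x) n)"
  by (simp add: wsum_def sum_configs_Suc shift_count del: count_list.simps)

lemma wsum_cong: "(\<And>i. i \<in> I \<Longrightarrow> w i = w' i) \<Longrightarrow> wsum I w n = wsum I w' n"
  by (simp add: wsum_def)

lemma wsum_pos:
  assumes "finite I" "I \<noteq> {}" "\<And>i m. 0 < w i m"
  shows "0 < wsum I w n"
  unfolding wsum_def using assms by (intro sum_pos prod_pos configs_nonempty) auto

lemma prod_shift_0:
  assumes "finite I" "x \<in> I" "\<And>i m. 0 < w i m"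
  shows "(\<Prod>i\<in>I. shift w x i 0) = (\<Prod>i\<in>I. w i 0) * (w x 1 / w x 0)"
proof -
  have "(\<Prod>i\<in>I. shift w x i 0) = w x 1 * (\<Prod>i\<in>I - {x}. w i 0)"
    using assms(1,2) by (simp add: prod.remove shift_def)
  moreover have "(\<Prod>i\<in>I. w i 0) = w x 0 * (\<Prod>i\<in>I - {x}. w i 0)"
    using assms(1,2) by (simp add: prod.remove)
  ultimately show ?thesis using assms(3)[of x 0] by (simp add: field_simps)
qed

lemma sum_squared_le_sum_mult_sum:
  fixes a b c :: "'a \<Rightarrow> real"
  assumes "\<And>i. i \<in> I \<Longrightarrow> 0 \<le> a i" "\<And>i. i \<in> I \<Longrightarrow> 0 \<le> c i" "\<And>i. i \<in> I \<Longrightarrow> 0 \<le> b i"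
    "\<And>i. i \<in> I \<Longrightarrow> (b i)\<^sup>2 \<le> a i * c i"
  shows "(\<Sum>i\<in>I. b i)\<^sup>2 \<le> (\<Sum>i\<in>I. a i) * (\<Sum>i\<in>I. c i)"
proof -
  have "(\<Sum>i\<in>I. b i) \<le> (\<Sum>i\<in>I. sqrt (a i) * sqrt (c i))"
    using assms by (intro sum_mono) (metis real_le_rsqrt real_sqrt_mult)
  then have "(\<Sum>i\<in>I. b i)\<^sup>2 \<le> (\<Sum>i\<in>I. sqrt (a i) * sqrt (c i))\<^sup>2"
    using assms by (intro power_mono sum_nonneg) auto
  also have "\<dots> \<le> (\<Sum>i\<in>I. (sqrt (a i))\<^sup>2) * (\<Sum>i\<in>I. (sqrt (c i))\<^sup>2)"
    by (rule Cauchy_Schwarz_ineq_sum)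
  finally show ?thesis using assms by simp
qed

text \<open>Log-convexity of binomial convolutions (Davenport and Polya): differentiating the generating
  function turns \<open>wsum\<close> into a sum of log-convex sequences, whose sum is log-convex by Cauchy-Schwarz.\<close>
lemma wsum_log_convex:
  assumes I: "finite I" and pos: "\<And>i m. 0 < w i m"
    and lc: "\<And>i m. (w i (Suc m))\<^sup>2 \<le> w i m * w i (Suc (Suc m))"
  shows "(wsum I w (Suc n))\<^sup>2 \<le> wsum I w n * wsum I w (Suc (Suc n))"
  using pos lc
proof (induction n arbitrary: w)
  case 0
  define P where "P = (\<Prod>i\<in>I. w i 0)"
  define \<rho> where "\<rho> x = w x 1 / w x 0" for x
  have P: "0 < P" unfolding P_def by (intro prod_pos) (use 0 in auto)
  have sp: "0 < shift w x i m" for x i m using 0(1) by (simp add: shift_def)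
  have w1: "wsum I w (Suc 0) = P * (\<Sum>x\<in>I. \<rho> x)"
    by (simp add: wsum_Suc wsum_0 prod_shift_0[OF I _ 0(1)] P_def \<rho>_def sum_distrib_left)
  \<comment> \<open>Off the diagonal this is an equality, since two shifts at different states act
    on different factors. On the diagonal it is log-convexity of \<open>w x\<close> at 0.\<close>
  have "P * (\<rho> x * \<rho> y) \<le> wsum I (shift (shift w x) y) 0" if "x \<in> I" "y \<in> I" for x y
  proof -
    have "wsum I (shift (shift w x) y) 0 = P * \<rho> x * (shift w x y 1 / shift w x y 0)"
      unfolding wsum_0
      by (subst prod_shift_0[OF I that(2) sp], subst prod_shift_0[OF I that(1) 0(1)]) (simp add: P_def \<rho>_def)
    moreover have "\<rho> y \<le> shift w x y 1 / shift w x y 0"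
    proof (cases "y = x")
      case True
      have "w x 1 * w x 1 \<le> w x 2 * w x 0"
        using 0(2)[of x 0] by (simp add: power2_eq_square numeral_2_eq_2 mult_ac)
      then have "w x 1 / w x 0 \<le> w x 2 / w x 1"
        using 0(1)[of x 0] 0(1)[of x 1] by (simp add: divide_le_eq le_divide_eq)
      then show ?thesis using True by (simp add: \<rho>_def shift_def numeral_2_eq_2)
    qed (simp add: \<rho>_def shift_def)
    moreover have "0 \<le> P * \<rho> x" using P 0(1) by (simp add: \<rho>_def less_imp_le)
    ultimately show ?thesis by (metis mult_left_mono mult.assoc)
  qed
  then have "(\<Sum>x\<in>I. \<Sum>y\<in>I. P * (\<rho> x * \<rho> y)) \<le> wsum I w (Suc (Suc 0))"
    unfolding wsum_Suc by (intro sum_mono) auto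
  moreover have "(\<Sum>x\<in>I. \<Sum>y\<in>I. P * (\<rho> x * \<rho> y)) = P * (\<Sum>x\<in>I. \<rho> x)\<^sup>2"
    unfolding power2_eq_square sum_product by (simp add: sum_distrib_left)
  ultimately have "P * (P * (\<Sum>x\<in>I. \<rho> x)\<^sup>2) \<le> P * wsum I w (Suc (Suc 0))" using P by simp
  then show ?case by (simp add: w1 wsum_0 P_def[symmetric] power2_eq_square mult_ac)
next
  case (Suc n)
  have IH: "(wsum I (shift w x) (Suc n))\<^sup>2 \<le> wsum I (shift w x) n * wsum I (shift w x) (Suc (Suc n))" for x
    by (rule Suc.IH) (use Suc.prems in \<open>auto simp: shift_def\<close>)
  have nn: "0 \<le> wsum I (shift w x) m" for x m
    unfolding wsum_def by (intro sum_nonneg prod_nonneg) (auto simp: shift_def intro: less_imp_le Suc.prems)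
  show ?case
    unfolding wsum_Suc[of I w]
    by (rule sum_squared_le_sum_mult_sum) (use IH nn in auto)
qed

text \<open>For weights exponential in the counts the weight of a word is a product over its
  letters. This is the only case in which \<open>wsum\<close> is explicit; all estimates of
  partition functions compare with it.\<close>

lemma wsum_exp:
  assumes "finite I"
  shows "wsum I (\<lambda>i m. exp (k i + \<theta> i * real m)) n = exp (\<Sum>i\<in>I. k i) * (\<Sum>i\<in>I. exp (\<theta> i)) ^ n"
proof (induction n arbitrary: k)
  case 0
  then show ?case by (simp add: wsum_0 exp_sum assms)
next
  case (Suc n)
  have "wsum I (shift (\<lambda>i m. exp (k i + \<theta> i * real m)) x) n
      = exp (\<Sum>i\<in>I. k i) * exp (\<theta> x) * (\<Sum>i\<in>I. exp (\<theta> i)) ^ n" if "x \<in> I" for x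
  proof -
    have "shift (\<lambda>i m. exp (k i + \<theta> i * real m)) x = (\<lambda>i m. exp ((k(x := k x + \<theta> x)) i + \<theta> i * real m))"
      by (auto simp: shift_def fun_eq_iff algebra_simps)
    moreover have "(\<Sum>i\<in>I. (k(x := k x + \<theta> x)) i) = (\<Sum>i\<in>I. k i) + \<theta> x"
      using assms that by (simp add: sum.remove)
    ultimately show ?thesis using Suc.IH[of "k(x := k x + \<theta> x)"] by (simp only: exp_add)
  qed
  then show ?case by (simp add: wsum_Suc sum_distrib_left sum_distrib_right mult_ac)
qed

section \<open>Relabelling of states and fibres of a state map\<close>

lemma bij_betw_map_configs:
  assumes "bij_betw f I J"
  shows "bij_betw (map f) (configs n I) (configs n J)"
proof -
  have inj: "inj_on (map f) (configs n I)"
  proof (rule inj_onI)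
    fix xs ys assume "xs \<in> configs n I" "ys \<in> configs n I" "map f xs = map f ys"
    moreover from this have "inj_on f (set xs \<union> set ys)"
      using assms by (auto simp: configs_def bij_betw_def intro: inj_on_subset)
    ultimately show "xs = ys" by (metis map_inj_on)
  qed
  have "configs n J \<subseteq> map f ` configs n I"
  proof
    fix ys assume ys: "ys \<in> configs n J"
    define xs where "xs = map (inv_into I f) ys"
    have "map f xs = ys"
      unfolding xs_def map_map
      by (rule map_idI) (use ys assms in \<open>auto simp: configs_def bij_betw_def f_inv_into_f subset_iff\<close>)
    moreover have "xs \<in> configs n I" using ys assms
      by (auto simp: xs_def configs_def bij_betw_def intro!: inv_into_into)
    ultimately show "ys \<in> map f ` configs n I" by (metis imageI)
  qed
  moreover have "map f ` configs n I \<subseteq> configs n J"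
    using assms by (fastforce simp: configs_def bij_betw_def)
  ultimately show ?thesis using inj by (auto simp: bij_betw_def)
qed

lemma count_list_map_inj_on:
  "inj_on f I \<Longrightarrow> set xs \<subseteq> I \<Longrightarrow> i \<in> I \<Longrightarrow> count_list (map f xs) (f i) = count_list xs i"
  by (induction xs) (auto simp: inj_on_def)

text \<open>With a common weight for all states only their number matters, so each fuzzy class may
  be numbered from 1.\<close>

lemma wsum_transport:
  assumes "bij_betw f I J"
  shows "wsum I (\<lambda>_. a) n = wsum J (\<lambda>_. a) n"
proof -
  have "wsum J (\<lambda>_. a) n = (\<Sum>xs\<in>configs n I. \<Prod>j\<in>J. a (count_list (map f xs) j))"
    unfolding wsum_def using sum.reindex_bij_betw[OF bij_betw_map_configs[OF assms], of "\<lambda>ys. \<Prod>j\<in>J. a (count_list ys j)"]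
    by simp
  also have "\<dots> = wsum I (\<lambda>_. a) n"
    unfolding wsum_def
  proof (intro sum.cong refl)
    fix xs assume "xs \<in> configs n I"
    then have "set xs \<subseteq> I" by (simp add: configs_def)
    then have "(\<Prod>i\<in>I. a (count_list (map f xs) (f i))) = (\<Prod>i\<in>I. a (count_list xs i))"
      using assms by (intro prod.cong) (auto simp: bij_betw_def count_list_map_inj_on)
    then show "(\<Prod>j\<in>J. a (count_list (map f xs) j)) = (\<Prod>i\<in>I. a (count_list xs i))"
      using prod.reindex_bij_betw[OF assms, of "\<lambda>j. a (count_list (map f xs) j)"] by simp
  qed
  finally show ?thesis by simp
qed

text \<open>The first letter \<open>x\<close> of a preimage lies in the fibre of the first letter
  \<open>k\<close> of \<open>ys\<close> and shifts the weight of the single state \<open>x\<close>.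
  Hence only the factor at \<open>k\<close> changes, and summing over the fibre of \<open>k\<close>
  is the recursion of \<open>wsum\<close>. The shift is why the weights are generalised in the
  induction.\<close>

lemma fiber_sum:
  assumes C: "finite C" and L: "finite L" "T ` C \<subseteq> L" and ys: "set ys \<subseteq> L"
  shows "(\<Sum>xs\<in>{xs\<in>configs (length ys) C. map T xs = ys}. \<Prod>i\<in>C. w i (count_list xs i))
       = (\<Prod>l\<in>L. wsum {i\<in>C. T i = l} w (count_list ys l))"
  using ys
proof (induction ys arbitrary: w)
  case Nil
  have "{xs\<in>configs (length []) C. map T xs = []} = {[]}" by auto
  then show ?case by (simp add: wsum_0 prod.group[OF C L])
next
  case (Cons k ys)
  define X where "X = {xs\<in>configs (length ys) C. map T xs = ys}"
  define K where "K = {i\<in>C. T i = k}"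
  have fin: "finite X" "finite K" using C by (auto simp: X_def K_def)
  have k: "k \<in> L" using Cons.prems by simp
  have eq: "{xs\<in>configs (length (k # ys)) C. map T xs = k # ys} = (\<lambda>(x, xs). x # xs) ` (K \<times> X)"
    by (auto simp: configs_Suc X_def K_def image_iff)
  have inj: "inj_on (\<lambda>(x, xs). x # xs) (K \<times> X)" by (auto simp: inj_on_def)
  have "(\<Sum>xs\<in>{xs\<in>configs (length (k # ys)) C. map T xs = k # ys}. \<Prod>i\<in>C. w i (count_list xs i))
      = (\<Sum>x\<in>K. \<Sum>xs\<in>X. \<Prod>i\<in>C. shift w x i (count_list xs i))"
    unfolding eq
    by (subst sum.reindex[OF inj]) (simp add: sum.cartesian_product case_prod_unfold shift_count del: count_list.simps)
  also have "\<dots> = (\<Sum>x\<in>K. \<Prod>l\<in>L. wsum {i\<in>C. T i = l} (shift w x) (count_list ys l))"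
    using Cons.IH Cons.prems by (simp add: X_def)
  also have "\<dots> = (\<Sum>x\<in>K. wsum K (shift w x) (count_list ys k) *
                 (\<Prod>l\<in>L - {k}. wsum {i\<in>C. T i = l} w (count_list (k # ys) l)))"
  proof (intro sum.cong refl)
    fix x assume x: "x \<in> K"
    have "(\<Prod>l\<in>L - {k}. wsum {i\<in>C. T i = l} (shift w x) (count_list ys l))
        = (\<Prod>l\<in>L - {k}. wsum {i\<in>C. T i = l} w (count_list (k # ys) l))"
      using x by (intro prod.cong refl) (auto simp: shift_def K_def intro!: wsum_cong)
    then show "(\<Prod>l\<in>L. wsum {i\<in>C. T i = l} (shift w x) (count_list ys l)) = wsum K (shift w x) (count_list ys k) *
                 (\<Prod>l\<in>L - {k}. wsum {i\<in>C. T i = l} w (count_list (k # ys) l))"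
      using prod.remove[OF L(1) k, of "\<lambda>l. wsum {i\<in>C. T i = l} (shift w x) (count_list ys l)"]
      by (simp add: K_def)
  qed
  also have "\<dots> = wsum K w (count_list (k # ys) k) *
                 (\<Prod>l\<in>L - {k}. wsum {i\<in>C. T i = l} w (count_list (k # ys) l))"
    by (simp add: wsum_Suc sum_distrib_right)
  also have "\<dots> = (\<Prod>l\<in>L. wsum {i\<in>C. T i = l} w (count_list (k # ys) l))"
    using prod.remove[OF L(1) k, of "\<lambda>l. wsum {i\<in>C. T i = l} w (count_list (k # ys) l)"] by (simp add: K_def)
  finally show ?case .
qed

section \<open>Free energy on the simplex\<close>

lemma powr_tangent_strict:
  fixes a y z :: real
  assumes z: "1 < z" and a: "0 \<le> a" and y: "0 \<le> y" and ne: "y \<noteq> a"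
  shows "a powr z + z * a powr (z - 1) * (y - a) < y powr z"
\<comment> \<open>The mean value argument differentiates the power at positive points only; at an
  endpoint 0 both sides are explicit.\<close>
proof (cases "a = 0 \<or> y = 0")
  case True
  then show ?thesis
  proof
    assume "y = 0"
    then have "0 < a" using a ne by simp
    then have "a powr z = a powr (z - 1) * a" by (simp add: powr_diff)
    then have "a powr z + z * a powr (z - 1) * (y - a) = (1 - z) * (a powr (z - 1) * a)"
      using \<open>y = 0\<close> by (simp add: algebra_simps)
    also have "\<dots> < 0" using z \<open>0 < a\<close> by (simp add: mult_less_0_iff)
    finally show ?thesis using \<open>y = 0\<close> by simp
  qed (use z y ne in simp)
next
  case False
  then have pos: "0 < a" "0 < y" using a y by auto
  have der: "((\<lambda>t. t powr z) has_real_derivative z * t powr (z - 1)) (at t)" if "0 < t" for t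
    using that by (auto intro!: derivative_eq_intros simp: powr_diff)
  show ?thesis
  proof (cases "a < y")
    case True
    obtain t where t: "a < t" "t < y" "y powr z - a powr z = (y - a) * (z * t powr (z - 1))"
      using MVT2[OF True, of "\<lambda>t. t powr z" "\<lambda>t. z * t powr (z - 1)"] der pos by force
    have "a powr (z - 1) < t powr (z - 1)" using t pos z by (intro powr_less_mono2) auto
    then have "(y - a) * (z * a powr (z - 1)) < (y - a) * (z * t powr (z - 1))" using True z by simp
    then show ?thesis using t(3) by (simp add: algebra_simps)
  next
    case False
    then have ya: "y < a" using ne by simp
    obtain t where t: "y < t" "t < a" "a powr z - y powr z = (a - y) * (z * t powr (z - 1))"
      using MVT2[OF ya, of "\<lambda>t. t powr z" "\<lambda>t. z * t powr (z - 1)"] der pos by force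
    have "t powr (z - 1) < a powr (z - 1)" using t pos z by (intro powr_less_mono2) auto
    then have "(a - y) * (z * t powr (z - 1)) < (a - y) * (z * a powr (z - 1))" using ya z by simp
    then show ?thesis using t(3) by (simp add: algebra_simps)
  qed
qed

lemma powr_tangent:
  fixes a y z :: real
  assumes "1 < z" "0 \<le> a" "0 \<le> y"
  shows "a powr z + z * a powr (z - 1) * (y - a) \<le> y powr z"
  using powr_tangent_strict[OF assms] by (cases "y = a") auto

text \<open>Compactness turns strict convexity into a gap uniform in \<open>y\<close>. It yields the
  energy gap away from the uniform distribution and the exponential suppression of configurations
  away from a tilting point.\<close>

lemma powr_tangent_gap:
  fixes a z \<delta> :: real
  assumes z: "1 < z" and a: "0 \<le> a" and \<delta>: "0 < \<delta>"
  shows "\<exists>\<kappa>>0. \<forall>y\<in>{0..1}. \<delta> \<le> \<bar>y - a\<bar> \<longrightarrow> a powr z + z * a powr (z - 1) * (y - a) + \<kappa> \<le> y powr z"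
proof -
  define K where "K = {0..1::real} \<inter> {y. \<delta> \<le> \<bar>y - a\<bar>}"
  define f where "f y = y powr z - (a powr z + z * a powr (z - 1) * (y - a))" for y
  have "closed {y. \<delta> \<le> \<bar>y - a\<bar>}" by (intro closed_Collect_le continuous_intros)
  then have K: "compact K" unfolding K_def by (intro compact_Int_closed compact_Icc)
  have f: "continuous_on K f" unfolding f_def using z
    by (intro continuous_on_diff continuous_on_powr' continuous_on_add continuous_on_mult continuous_on_const continuous_on_id)
       (auto simp: K_def)
  show ?thesis
  proof (cases "K = {}")
    case True
    then show ?thesis by (intro exI[of _ 1]) (auto simp: K_def)
  next
    case False
    obtain y0 where y0: "y0 \<in> K" "\<And>y. y \<in> K \<Longrightarrow> f y0 \<le> f y"
      using continuous_attains_inf[OF K False f] by auto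
    have "0 < f y0" using powr_tangent_strict[OF z a, of y0] y0(1) \<delta> by (auto simp: f_def K_def)
    moreover have "a powr z + z * a powr (z - 1) * (y - a) + f y0 \<le> y powr z"
      if "y \<in> {0..1}" "\<delta> \<le> \<bar>y - a\<bar>" for y
      using y0(2)[of y] that by (simp add: K_def f_def)
    ultimately show ?thesis by blast
  qed
qed

section \<open>Energy, entropy and the maximal free energy\<close>

definition energy :: "real \<Rightarrow> nat \<Rightarrow> (nat \<Rightarrow> real) \<Rightarrow> real" where
  "energy z r x = (\<Sum>i\<in>{1..r}. x i powr z) / z"

definition entropy :: "nat \<Rightarrow> (nat \<Rightarrow> real) \<Rightarrow> real" where
  "entropy r x = - (\<Sum>i\<in>{1..r}. x i * ln (x i))"

definition free_energy :: "real \<Rightarrow> nat \<Rightarrow> real \<Rightarrow> (nat \<Rightarrow> real) \<Rightarrow> real" where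
  "free_energy z r b x = b * energy z r x + entropy r x"

definition unif :: "nat \<Rightarrow> nat \<Rightarrow> real" where
  "unif r i = (if i \<in> {1..r} then 1 / real r else 0)"

definition max_free_energy :: "real \<Rightarrow> nat \<Rightarrow> real \<Rightarrow> real" where
  "max_free_energy z r b = Sup (free_energy z r b ` prob_simplex r)"

lemma prob_simplexD:
  assumes "x \<in> prob_simplex r"
  shows "0 \<le> x i" "x i \<le> 1" "i \<notin> {1..r} \<Longrightarrow> x i = 0" "sum x {1..r} = 1"
proof -
  show a: "0 \<le> x i" "i \<notin> {1..r} \<Longrightarrow> x i = 0" "sum x {1..r} = 1" for i
    using assms by (auto simp: prob_simplex_def)
  show "x i \<le> 1"
  proof (cases "i \<in> {1..r}")
    case True
    then have "x i \<le> sum x {1..r}" using a(1) by (intro member_le_sum) auto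
    then show ?thesis using a(3) by simp
  qed (use a(2)[of i] in simp)
qed

text \<open>Points are functions on all naturals with the product topology: Tychonoff gives
  compactness of the cube, and the simplex is cut out by closed conditions on coordinates and on a
  finite sum.\<close>

lemma compact_prob_simplex: "compact (prob_simplex m)"
proof -
  have "compactin (product_topology (\<lambda>i. euclidean) UNIV) (PiE UNIV (\<lambda>i::nat. {0..1::real}))"
    unfolding compactin_PiE by (simp add: compact_Icc)
  then have c: "compact (PiE UNIV (\<lambda>i::nat. {0..1::real}))"
    by (simp add: euclidean_product_topology)
  have cl: "closed {\<nu> :: nat \<Rightarrow> real. \<nu> i = 0}" for i
    by (intro closed_Collect_eq continuous_on_product_coordinates continuous_on_const)
  have "closed {\<nu> :: nat \<Rightarrow> real. sum \<nu> {1..m} = 1}"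
    by (intro closed_Collect_eq continuous_on_sum continuous_on_product_coordinates continuous_on_const)
  moreover have "closed (\<Inter>i\<in>-{1..m}. {\<nu> :: nat \<Rightarrow> real. \<nu> i = 0})"
    using cl by (intro closed_INT) auto
  ultimately have "compact (PiE UNIV (\<lambda>i::nat. {0..1::real}) \<inter> ((\<Inter>i\<in>-{1..m}. {\<nu>. \<nu> i = 0}) \<inter> {\<nu>. sum \<nu> {1..m} = 1}))"
    by (intro compact_Int_closed c closed_Int)
  also have "PiE UNIV (\<lambda>i::nat. {0..1::real}) \<inter> ((\<Inter>i\<in>-{1..m}. {\<nu>. \<nu> i = 0}) \<inter> {\<nu>. sum \<nu> {1..m} = 1}) = prob_simplex m"
  proof (intro equalityI subsetI)
    fix x assume x: "x \<in> prob_simplex m"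
    show "x \<in> PiE UNIV (\<lambda>i::nat. {0..1::real}) \<inter> ((\<Inter>i\<in>-{1..m}. {\<nu>. \<nu> i = 0}) \<inter> {\<nu>. sum \<nu> {1..m} = 1})"
      using prob_simplexD[OF x] by (simp add: PiE_UNIV_domain)
  qed (auto simp: prob_simplex_def)
  finally show ?thesis .
qed

lemma unif_in_simplex: "1 \<le> r \<Longrightarrow> unif r \<in> prob_simplex r"
  by (auto simp: prob_simplex_def unif_def)

lemma energy_unif: "1 \<le> r \<Longrightarrow> energy z r (unif r) = real r powr (1 - z) / z"
  by (simp add: energy_def unif_def powr_divide powr_diff)

lemma entropy_unif: "1 \<le> r \<Longrightarrow> entropy r (unif r) = ln (real r)"
  by (simp add: entropy_def unif_def ln_div)

lemma energy_nonneg: "0 < z \<Longrightarrow> 0 \<le> energy z r x"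
  by (simp add: energy_def sum_nonneg)

lemma energy_le:
  assumes "1 < z" "x \<in> prob_simplex r"
  shows "energy z r x \<le> 1 / z"
proof -
  have "x i powr z \<le> x i" for i
    using prob_simplexD[OF assms(2)] assms(1) powr_mono'[of 1 z "x i"]
    by (cases "x i = 0") (auto simp: less_le)
  then have "(\<Sum>i\<in>{1..r}. x i powr z) \<le> sum x {1..r}" by (intro sum_mono)
  then show ?thesis using assms prob_simplexD(4)[OF assms(2)] by (simp add: energy_def divide_right_mono)
qed

text \<open>The linear terms cancel because both points have total mass one. The right-hand side has
  the form of a sum of tangents at \<open>1 / r\<close>, ready for a termwise comparison with the
  energy of \<open>x\<close>.\<close>

lemma energy_unif_tangent:
  assumes "1 < z" "x \<in> prob_simplex r" "1 \<le> r"
  shows "energy z r (unif r) = (\<Sum>i\<in>{1..r}. (1 / real r) powr z + z * (1 / real r) powr (z - 1) * (x i - 1 / real r)) / z"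
proof -
  have "(\<Sum>i\<in>{1..r}. x i - 1 / real r) = 0"
    using prob_simplexD(4)[OF assms(2)] assms(3) by (simp add: sum_subtractf)
  then show ?thesis
    by (simp add: energy_def unif_def sum.distrib flip: sum_distrib_left)
qed

lemma energy_unif_less:
  assumes z: "1 < z" and x: "x \<in> prob_simplex r" and r: "1 \<le> r" and ne: "x \<noteq> unif r"
  shows "energy z r (unif r) < energy z r x"
proof -
  obtain i where i: "x i \<noteq> unif r i" using ne by auto
  have "i \<in> {1..r}" using i prob_simplexD(3)[OF x, of i] by (auto simp: unif_def split: if_splits)
  then have "(\<Sum>i\<in>{1..r}. (1 / real r) powr z + z * (1 / real r) powr (z - 1) * (x i - 1 / real r))
      < (\<Sum>i\<in>{1..r}. x i powr z)"
    using i z r prob_simplexD[OF x]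
    by (intro sum_strict_mono_ex1 ballI bexI[of _ i] powr_tangent powr_tangent_strict) (auto simp: unif_def)
  then show ?thesis
    unfolding energy_unif_tangent[OF z x r] using z by (simp add: energy_def divide_strict_right_mono)
qed

lemma energy_unif_le:
  assumes "1 < z" "x \<in> prob_simplex r" "1 \<le> r"
  shows "energy z r (unif r) \<le> energy z r x"
  using energy_unif_less[OF assms] by (cases "x = unif r") auto

text \<open>The deviating coordinate contributes the tangent gap, the others at least their
  tangents. At the critical endpoint this is used with the exponent \<open>z - 1\<close> in place of
  \<open>z\<close>.\<close>

lemma energy_gap:
  assumes z: "1 < z" and r: "1 \<le> r" and \<delta>: "0 < \<delta>"
  shows "\<exists>\<kappa>>0. \<forall>x\<in>prob_simplex r. (\<exists>i\<in>{1..r}. \<delta> \<le> \<bar>x i - 1 / real r\<bar>) \<longrightarrow> energy z r (unif r) + \<kappa> \<le> energy z r x"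
proof -
  obtain \<kappa> where \<kappa>: "\<kappa> > 0" "\<And>y. y \<in> {0..1} \<Longrightarrow> \<delta> \<le> \<bar>y - 1 / real r\<bar> \<Longrightarrow>
      (1 / real r) powr z + z * (1 / real r) powr (z - 1) * (y - 1 / real r) + \<kappa> \<le> y powr z"
    using powr_tangent_gap[OF z _ \<delta>, of "1 / real r"] by auto
  have "energy z r (unif r) + \<kappa> / z \<le> energy z r x"
    if x: "x \<in> prob_simplex r" and i: "i \<in> {1..r}" "\<delta> \<le> \<bar>x i - 1 / real r\<bar>" for x i
  proof -
    let ?T = "\<lambda>i. (1 / real r) powr z + z * (1 / real r) powr (z - 1) * (x i - 1 / real r)"
    have "sum ?T {1..r} + \<kappa> = sum ?T ({1..r} - {i}) + (?T i + \<kappa>)"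
      using i(1) sum.remove[of "{1..r}" i ?T] by simp
    also have "\<dots> \<le> (\<Sum>i\<in>{1..r} - {i}. x i powr z) + x i powr z"
      using \<kappa>(2)[of "x i"] i(2) prob_simplexD[OF x] z by (intro add_mono sum_mono powr_tangent) auto
    also have "\<dots> = (\<Sum>i\<in>{1..r}. x i powr z)"
      using i(1) sum.remove[of "{1..r}" i "\<lambda>i. x i powr z"] by simp
      finally have "(sum ?T {1..r} + \<kappa>) / z \<le> (\<Sum>i\<in>{1..r}. x i powr z) / z"
      using z by (intro divide_right_mono) auto
    then show ?thesis
      unfolding energy_unif_tangent[OF z x r] by (simp only: energy_def add_divide_distrib)
  qed
  then show ?thesis using \<kappa>(1) z by (intro exI[of _ "\<kappa> / z"]) auto
qed

text \<open>From \<open>- ln x = 2 * ln (1 / sqrt x)\<close> and \<open>ln u \<le> u - 1\<close>. It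
  gives continuity of \<open>x * ln x\<close> at 0, where the product evaluates to 0, the correct
  entropy convention.\<close>

lemma xlnx_bound:
  fixes x :: real
  assumes "0 \<le> x" "x \<le> 1"
  shows "\<bar>x * ln x\<bar> \<le> 2 * sqrt x"
proof (cases "x = 0")
  case False
  then have x: "0 < x" using assms by simp
  have "- ln x = 2 * ln (1 / sqrt x)" using x by (simp add: ln_div ln_sqrt)
  also have "\<dots> \<le> 2 * (1 / sqrt x)" using ln_le_minus_one[of "1 / sqrt x"] x by simp
  finally have "x * (- ln x) \<le> x * (2 * (1 / sqrt x))" using x by (intro mult_left_mono) auto
  also have "\<dots> = 2 * sqrt x" using x by (simp add: field_simps real_div_sqrt flip: real_sqrt_mult)
  finally have "x * (- ln x) \<le> 2 * sqrt x" .
  moreover have "x * ln x \<le> 0" using x assms by (simp add: mult_nonneg_nonpos)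
  ultimately show ?thesis by simp
qed simp

lemma continuous_on_xlnx: "continuous_on {0..1::real} (\<lambda>x. x * ln x)"
proof (unfold continuous_on_eq_continuous_within, intro ballI)
  fix x :: real assume x: "x \<in> {0..1}"
  show "continuous (at x within {0..1}) (\<lambda>x. x * ln x)"
  proof (cases "x = 0")
    case True
    have "continuous_on {0..1} (\<lambda>x::real. 2 * sqrt x)" by (intro continuous_intros)
    then have "((\<lambda>x::real. 2 * sqrt x) \<longlongrightarrow> 0) (at 0 within {0..1})"
      unfolding continuous_on_def by (metis atLeastAtMost_iff mult_zero_right order_refl real_sqrt_zero zero_le_one)
    then have "((\<lambda>x::real. x * ln x) \<longlongrightarrow> 0) (at 0 within {0..1})"
    proof (rule Lim_null_comparison[rotated])
      show "\<forall>\<^sub>F x in at 0 within {0..1}. norm (x * ln x) \<le> 2 * sqrt (x::real)"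
        unfolding eventually_at_filter
      proof (intro always_eventually allI impI)
        fix x :: real assume "x \<in> {0..1}"
        then show "norm (x * ln x) \<le> 2 * sqrt x" using xlnx_bound[of x] by simp
      qed
    qed
    then show ?thesis using True by (simp add: continuous_within)
  next
    case False
    then have "((\<lambda>x. x * ln x) has_real_derivative ln x + 1) (at x)"
      using x by (auto intro!: derivative_eq_intros)
    then have "isCont (\<lambda>x. x * ln x) x" by (rule DERIV_isCont)
    then show ?thesis by (rule continuous_at_imp_continuous_within)
  qed
qed

lemma continuous_on_coord: "continuous_on S (\<lambda>x :: nat \<Rightarrow> real. x i)"
  by (rule continuous_on_subset[OF continuous_on_product_coordinates subset_UNIV])

lemma continuous_on_energy: "1 < z \<Longrightarrow> continuous_on (prob_simplex r) (energy z r)"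
proof -
  assume z: "1 < z"
  have "continuous_on (prob_simplex r) (\<lambda>x. x i powr z)" for i
    by (rule continuous_on_powr'[OF continuous_on_coord continuous_on_const])
       (use z in \<open>auto intro: prob_simplexD(1)\<close>)
  then show ?thesis
    unfolding energy_def using z by (intro continuous_on_divide continuous_on_sum continuous_on_const) auto
qed

lemma continuous_on_entropy: "continuous_on (prob_simplex r) (entropy r)"
  unfolding entropy_def
proof (intro continuous_on_minus continuous_on_sum)
  fix i
  show "continuous_on (prob_simplex r) (\<lambda>x. x i * ln (x i))"
    by (rule continuous_on_compose2[OF continuous_on_xlnx continuous_on_coord])
      (auto intro: prob_simplexD(1,2))
qed

lemma continuous_on_free_energy: "1 < z \<Longrightarrow> continuous_on (prob_simplex r) (free_energy z r b)"
  unfolding free_energy_def by (intro continuous_intros continuous_on_energy continuous_on_entropy) auto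

lemma max_free_energy_attained:
  assumes "1 < z" "1 \<le> r"
  shows "\<exists>x\<in>prob_simplex r. free_energy z r b x = max_free_energy z r b"
    and "\<And>x. x \<in> prob_simplex r \<Longrightarrow> free_energy z r b x \<le> max_free_energy z r b"
proof -
  obtain x where x: "x \<in> prob_simplex r" "\<And>y. y \<in> prob_simplex r \<Longrightarrow> free_energy z r b y \<le> free_energy z r b x"
    using continuous_attains_sup[OF compact_prob_simplex _ continuous_on_free_energy[OF assms(1)], of r b]
      unif_in_simplex[OF assms(2)] by blast
  then have "max_free_energy z r b = free_energy z r b x"
    unfolding max_free_energy_def by (intro cSup_eq_maximum) auto
  then show "\<exists>x\<in>prob_simplex r. free_energy z r b x = max_free_energy z r b"
    and "\<And>x. x \<in> prob_simplex r \<Longrightarrow> free_energy z r b x \<le> max_free_energy z r b"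
    using x by auto
qed

text \<open>A maximiser at one parameter competes at the other, and energies lie in
  \<open>[0, 1]\<close>.\<close>

lemma max_free_energy_Lipschitz:
  assumes z: "1 < z" and r: "1 \<le> r"
  shows "\<bar>max_free_energy z r b - max_free_energy z r b'\<bar> \<le> \<bar>b - b'\<bar>"
proof -
  have *: "max_free_energy z r b - max_free_energy z r b' \<le> \<bar>b - b'\<bar>" for b b'
  proof -
    obtain x where x: "x \<in> prob_simplex r" "free_energy z r b x = max_free_energy z r b"
      using max_free_energy_attained(1)[OF z r] by blast
    have "free_energy z r b' x \<le> max_free_energy z r b'" by (rule max_free_energy_attained(2)[OF z r x(1)])
    then have "max_free_energy z r b - max_free_energy z r b' \<le> (b - b') * energy z r x"
      using x(2) by (simp add: free_energy_def algebra_simps)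
    also have "\<dots> \<le> \<bar>b - b'\<bar> * 1"
      using energy_nonneg[of z r x] energy_le[OF z x(1)] z
      by (intro mult_mono) (auto intro: order_trans)
    finally show ?thesis by simp
  qed
  show ?thesis using *[of b b'] *[of b' b] by (simp add: abs_le_iff)
qed

text \<open>Nonnegativity of the relative entropy of \<open>x\<close> with respect to the Gibbs
  distribution of \<open>\<theta>\<close>, obtained termwise from \<open>ln u \<le> u - 1\<close>; a
  term with \<open>x i = 0\<close> only adds slack.\<close>

lemma gibbs_variational:
  assumes x: "x \<in> prob_simplex r" and r: "1 \<le> r"
  shows "(\<Sum>i\<in>{1..r}. x i * \<theta> i) + entropy r x \<le> ln (\<Sum>i\<in>{1..r}. exp (\<theta> i))"
proof -
  define Z where "Z = (\<Sum>i\<in>{1..r}. exp (\<theta> i))"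
  have Z: "0 < Z" unfolding Z_def using r by (intro sum_pos) auto
  have "x i * (\<theta> i - ln (x i) - ln Z) \<le> exp (\<theta> i) / Z - x i" for i
  proof (cases "x i = 0")
    case False
    then have xi: "0 < x i" using prob_simplexD(1)[OF x, of i] by simp
    have "\<theta> i - ln (x i) - ln Z = ln (exp (\<theta> i) / (x i * Z))"
      using xi Z by (simp add: ln_div ln_mult)
    also have "\<dots> \<le> exp (\<theta> i) / (x i * Z) - 1" using xi Z by (intro ln_le_minus_one) simp
    finally have "x i * (\<theta> i - ln (x i) - ln Z) \<le> x i * (exp (\<theta> i) / (x i * Z) - 1)"
      using xi by (intro mult_left_mono) auto
    also have "\<dots> = exp (\<theta> i) / Z - x i" using xi Z by (simp add: right_diff_distrib)
    finally show ?thesis .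
  qed (use Z in simp)
  then have "(\<Sum>i\<in>{1..r}. x i * (\<theta> i - ln (x i) - ln Z)) \<le> (\<Sum>i\<in>{1..r}. exp (\<theta> i) / Z - x i)"
    by (intro sum_mono)
  also have "\<dots> = 0"
  proof -
    have "(\<Sum>i\<in>{1..r}. exp (\<theta> i) / Z) = 1" using Z by (simp add: Z_def flip: sum_divide_distrib)
    then show ?thesis using prob_simplexD(4)[OF x] by (simp add: sum_subtractf)
  qed
  also have "(\<Sum>i\<in>{1..r}. x i * (\<theta> i - ln (x i) - ln Z)) = (\<Sum>i\<in>{1..r}. x i * \<theta> i) + entropy r x - ln Z"
    using prob_simplexD(4)[OF x]
    by (simp only: entropy_def right_diff_distrib sum_subtractf sum_distrib_right[symmetric])
  finally show ?thesis by (simp add: Z_def)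
qed

lemma gibbs_variational_attained:
  assumes r: "1 \<le> r"
  shows "\<exists>x\<in>prob_simplex r. (\<Sum>i\<in>{1..r}. x i * \<theta> i) + entropy r x = ln (\<Sum>i\<in>{1..r}. exp (\<theta> i))"
proof -
  define Z where "Z = (\<Sum>i\<in>{1..r}. exp (\<theta> i))"
  have Z: "0 < Z" unfolding Z_def using r by (intro sum_pos) auto
  define x where "x i = (if i \<in> {1..r} then exp (\<theta> i) / Z else 0)" for i
  have s: "sum x {1..r} = 1" using Z by (simp add: x_def Z_def flip: sum_divide_distrib)
  then have x: "x \<in> prob_simplex r" using Z by (auto simp: prob_simplex_def x_def)
  have "x i * \<theta> i - x i * ln (x i) = x i * ln Z" if "i \<in> {1..r}" for i
    using that Z by (simp add: x_def ln_div right_diff_distrib)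
  then have "(\<Sum>i\<in>{1..r}. x i * \<theta> i - x i * ln (x i)) = (\<Sum>i\<in>{1..r}. x i * ln Z)"
    by (intro sum.cong) auto
  then have "(\<Sum>i\<in>{1..r}. x i * \<theta> i) + entropy r x = ln Z"
    using s by (simp add: entropy_def sum_subtractf flip: sum_distrib_right)
  then show ?thesis using x by (auto simp: Z_def)
qed

section \<open>Bounds for the partition function\<close>

definition spin_weight :: "real \<Rightarrow> real \<Rightarrow> nat \<Rightarrow> nat \<Rightarrow> real" where
  "spin_weight z \<beta> N c = exp (real N * \<beta> / z * (real c / real N) powr z)"

text \<open>\<open>N\<close> only fixes the scale of the interaction. Values \<open>n > N\<close>
  occur in no fuzzy configuration but make sense here, so that at \<open>n / N = 1\<close> slopes on
  both sides are available when the pressure is differentiable.\<close>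

definition partition_fun :: "real \<Rightarrow> real \<Rightarrow> nat \<Rightarrow> nat \<Rightarrow> nat \<Rightarrow> real" where
  "partition_fun z \<beta> N r n = wsum {1..r} (\<lambda>_. spin_weight z \<beta> N) n"

text \<open>The exponential of the tangent at \<open>c = N * a\<close> to the exponent of
  \<open>spin_weight\<close>, hence a lower bound that is exponential in \<open>c\<close> and can be
  summed exactly.\<close>

definition tilt_weight :: "real \<Rightarrow> real \<Rightarrow> nat \<Rightarrow> real \<Rightarrow> nat \<Rightarrow> real" where
  "tilt_weight z \<beta> N a c =
     exp (real N * \<beta> / z * a powr z + \<beta> * a powr (z - 1) * (real c - real N * a))"

lemma scaled_tangent:
  fixes a y z \<beta> :: real
  assumes "1 < z" "0 \<le> \<beta>" "0 \<le> a" "0 \<le> y"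
  shows "real N * \<beta> / z * a powr z + \<beta> * a powr (z - 1) * (real N * y - real N * a)
       \<le> real N * \<beta> / z * y powr z"
proof -
  have "real N * \<beta> / z * (a powr z + z * a powr (z - 1) * (y - a)) \<le> real N * \<beta> / z * y powr z"
    using assms by (intro mult_left_mono powr_tangent) auto
  moreover have "real N * \<beta> / z * (a powr z + z * a powr (z - 1) * (y - a))
      = real N * \<beta> / z * a powr z + \<beta> * a powr (z - 1) * (real N * y - real N * a)"
    using assms by (simp add: field_simps)
  ultimately show ?thesis by simp
qed

lemma tilt_weight_le:
  assumes "1 < z" "0 \<le> \<beta>" "0 \<le> a" "0 < N"
  shows "tilt_weight z \<beta> N a c \<le> spin_weight z \<beta> N c"
  using scaled_tangent[OF assms(1-3), of "real c / real N" N] assms(4)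
  by (simp add: tilt_weight_def spin_weight_def)

lemma tilt_weight_self: "0 < N \<Longrightarrow> tilt_weight z \<beta> N (real c / real N) c = spin_weight z \<beta> N c"
  by (simp add: tilt_weight_def spin_weight_def)

lemma spin_weight_pos: "0 < spin_weight z \<beta> N c"
  by (simp add: spin_weight_def)

lemma tilt_weight_pos: "0 < tilt_weight z \<beta> N a c"
  by (simp add: tilt_weight_def)

lemma wsum_tilt_weight:
  "wsum {1..r} (\<lambda>i. tilt_weight z \<beta> N (y i)) n =
     exp (\<Sum>i\<in>{1..r}. real N * \<beta> / z * y i powr z - \<beta> * y i powr (z - 1) * (real N * y i)) *
     (\<Sum>i\<in>{1..r}. exp (\<beta> * y i powr (z - 1))) ^ n"
proof -
  have "(\<lambda>i. tilt_weight z \<beta> N (y i)) = (\<lambda>i m. exp ((real N * \<beta> / z * y i powr z - \<beta> * y i powr (z - 1) * (real N * y i)) +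
      \<beta> * y i powr (z - 1) * real m))"
    by (auto simp: tilt_weight_def fun_eq_iff algebra_simps)
  then show ?thesis using wsum_exp[of "{1..r}"] by simp
qed

lemma powr_rescale:
  "real N * (real n / real N) powr z = real n * (real n / real N) powr (z - 1)"
  by (cases "n = 0 \<or> N = 0") (auto simp: powr_diff)

lemma energy_rescale:
  assumes "x \<in> prob_simplex r"
  shows "(\<Sum>i\<in>{1..r}. real N * \<beta> / z * (real n / real N * x i) powr z)
       = real n * (\<beta> * (real n / real N) powr (z - 1) * energy z r x)"
proof -
  have "(\<Sum>i\<in>{1..r}. real N * \<beta> / z * (real n / real N * x i) powr z)
      = (\<Sum>i\<in>{1..r}. \<beta> / z * (real N * (real n / real N) powr z) * x i powr z)"
  proof (intro sum.cong refl)
    fix i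
    have "(real n / real N * x i) powr z = (real n / real N) powr z * x i powr z"
      using prob_simplexD(1)[OF assms] by (simp only: powr_mult)
    then show "real N * \<beta> / z * (real n / real N * x i) powr z
        = \<beta> / z * (real N * (real n / real N) powr z) * x i powr z"
      by simp
  qed
  then show ?thesis
    unfolding powr_rescale energy_def by (simp add: sum_distrib_left sum_divide_distrib mult_ac)
qed

text \<open>The tilted sum is explicit, and the variational inequality with
  \<open>\<theta> i = \<beta> * y i powr (z - 1)\<close> bounds its logarithm from below. The bound
  is stated for the tilted weights rather than the true ones because the ordered phase at the
  critical point is later located through the tilted mass itself.\<close>

lemma tilt_lower:
  assumes x: "x \<in> prob_simplex r" and r: "1 \<le> r" and N: "0 < N"
  shows "exp (real n * free_energy z r (\<beta> * (real n / real N) powr (z - 1)) x)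
       \<le> wsum {1..r} (\<lambda>i. tilt_weight z \<beta> N (real n / real N * x i)) n"
proof -
  define y where "y i = real n / real N * x i" for i
  have Ny: "real N * y i = real n * x i" for i using N by (simp add: y_def)
  define Z where "Z = (\<Sum>i\<in>{1..r}. exp (\<beta> * y i powr (z - 1)))"
  have Z: "0 < Z" unfolding Z_def using r by (intro sum_pos) auto
  have "real n * ((\<Sum>i\<in>{1..r}. x i * (\<beta> * y i powr (z - 1))) + entropy r x) \<le> real n * ln Z"
    unfolding Z_def by (intro mult_left_mono gibbs_variational[OF x r]) auto
  moreover have "(\<Sum>i\<in>{1..r}. real N * \<beta> / z * y i powr z)
      = real n * (\<beta> * (real n / real N) powr (z - 1) * energy z r x)"
    unfolding y_def by (rule energy_rescale[OF x])
  moreover have "(\<Sum>i\<in>{1..r}. real N * \<beta> / z * y i powr z - \<beta> * y i powr (z - 1) * (real N * y i))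
      + real n * (\<Sum>i\<in>{1..r}. x i * (\<beta> * y i powr (z - 1))) = (\<Sum>i\<in>{1..r}. real N * \<beta> / z * y i powr z)"
    unfolding sum_distrib_left sum.distrib[symmetric] Ny by (intro sum.cong refl) simp
  ultimately have "real n * free_energy z r (\<beta> * (real n / real N) powr (z - 1)) x
      \<le> (\<Sum>i\<in>{1..r}. real N * \<beta> / z * y i powr z - \<beta> * y i powr (z - 1) * (real N * y i)) + real n * ln Z"
    unfolding free_energy_def distrib_left by linarith
  then have "exp (real n * free_energy z r (\<beta> * (real n / real N) powr (z - 1)) x)
      \<le> exp ((\<Sum>i\<in>{1..r}. real N * \<beta> / z * y i powr z - \<beta> * y i powr (z - 1) * (real N * y i)) + real n * ln Z)"
    by simp
  also have "\<dots> = exp (\<Sum>i\<in>{1..r}. real N * \<beta> / z * y i powr z - \<beta> * y i powr (z - 1) * (real N * y i)) * Z ^ n"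
    using Z by (simp add: exp_add exp_of_nat_mult)
  finally show ?thesis unfolding wsum_tilt_weight Z_def y_def .
qed

text \<open>The Gibbs distribution \<open>x\<close> of the tilt gives equality in the variational
  principle, and the tangent at \<open>y\<close>, evaluated at the profile \<open>n / N * x\<close>,
  lies below the energy of that profile.\<close>

lemma tilt_upper:
  assumes z: "1 < z" and \<beta>: "0 \<le> \<beta>" and r: "1 \<le> r" and N: "0 < N" and y: "\<And>i. 0 \<le> y i"
  shows "wsum {1..r} (\<lambda>i. tilt_weight z \<beta> N (y i)) n
       \<le> exp (real n * max_free_energy z r (\<beta> * (real n / real N) powr (z - 1)))"
proof -
  define Z where "Z = (\<Sum>i\<in>{1..r}. exp (\<beta> * y i powr (z - 1)))"
  have Z: "0 < Z" unfolding Z_def using r by (intro sum_pos) auto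
  obtain x where x: "x \<in> prob_simplex r"
    "(\<Sum>i\<in>{1..r}. x i * (\<beta> * y i powr (z - 1))) + entropy r x = ln Z"
    unfolding Z_def using gibbs_variational_attained[OF r, of "\<lambda>i. \<beta> * y i powr (z - 1)"] by (elim bexE)
  have "(\<Sum>i\<in>{1..r}. real N * \<beta> / z * y i powr z + \<beta> * y i powr (z - 1) * (real N * (real n / real N * x i) - real N * y i))
      \<le> (\<Sum>i\<in>{1..r}. real N * \<beta> / z * (real n / real N * x i) powr z)"
  proof (intro sum_mono scaled_tangent[OF z \<beta> y])
    show "0 \<le> real n / real N * x i" for i using prob_simplexD(1)[OF x(1), of i] by simp
  qed
  moreover have "(\<Sum>i\<in>{1..r}. real N * \<beta> / z * y i powr z - \<beta> * y i powr (z - 1) * (real N * y i))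
      + real n * (\<Sum>i\<in>{1..r}. x i * (\<beta> * y i powr (z - 1))) =
      (\<Sum>i\<in>{1..r}. real N * \<beta> / z * y i powr z + \<beta> * y i powr (z - 1) * (real N * (real n / real N * x i) - real N * y i))"
    unfolding sum_distrib_left sum.distrib[symmetric]
  proof (intro sum.cong refl)
    fix i
    have "real n * (x i * (\<beta> * y i powr (z - 1))) = \<beta> * y i powr (z - 1) * (real N * (real n / real N * x i))"
      using N by simp
    then show "real N * \<beta> / z * y i powr z - \<beta> * y i powr (z - 1) * (real N * y i)
        + real n * (x i * (\<beta> * y i powr (z - 1))) =
        real N * \<beta> / z * y i powr z + \<beta> * y i powr (z - 1) * (real N * (real n / real N * x i) - real N * y i)"
      unfolding right_diff_distrib by linarith
  qed
  ultimately have "(\<Sum>i\<in>{1..r}. real N * \<beta> / z * y i powr z - \<beta> * y i powr (z - 1) * (real N * y i)) + real n * ln Z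
      \<le> real n * free_energy z r (\<beta> * (real n / real N) powr (z - 1)) x"
    unfolding energy_rescale[OF x(1)] x(2)[symmetric] free_energy_def distrib_left by linarith
  also have "\<dots> \<le> real n * max_free_energy z r (\<beta> * (real n / real N) powr (z - 1))"
    by (intro mult_left_mono max_free_energy_attained(2)[OF z r x(1)]) auto
  finally have "exp ((\<Sum>i\<in>{1..r}. real N * \<beta> / z * y i powr z - \<beta> * y i powr (z - 1) * (real N * y i)) + real n * ln Z)
      \<le> exp (real n * max_free_energy z r (\<beta> * (real n / real N) powr (z - 1)))"
    by (simp only: exp_le_cancel_iff)
  moreover have "exp (real n * ln Z) = Z ^ n" using Z by (simp add: exp_of_nat_mult)
  ultimately show ?thesis unfolding wsum_tilt_weight Z_def[symmetric] by (simp only: exp_add)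
qed

lemma partition_fun_pos: "1 \<le> r \<Longrightarrow> 0 < partition_fun z \<beta> N r n"
  unfolding partition_fun_def by (intro wsum_pos spin_weight_pos) auto

text \<open>Tangent weights at a maximiser lie below the true weights, so this side carries no
  polynomial correction, in contrast to the upper bound.\<close>

lemma partition_fun_lower:
  assumes z: "1 < z" and \<beta>: "0 \<le> \<beta>" and r: "1 \<le> r" and N: "0 < N"
  shows "real n * max_free_energy z r (\<beta> * (real n / real N) powr (z - 1)) \<le> ln (partition_fun z \<beta> N r n)"
proof -
  define b where "b = \<beta> * (real n / real N) powr (z - 1)"
  obtain x where x: "x \<in> prob_simplex r" "free_energy z r b x = max_free_energy z r b"
    using max_free_energy_attained(1)[OF z r] by blast
  have "exp (real n * free_energy z r b x) \<le> wsum {1..r} (\<lambda>i. tilt_weight z \<beta> N (real n / real N * x i)) n"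
    unfolding b_def by (rule tilt_lower[OF x(1) r N])
  also have "\<dots> \<le> partition_fun z \<beta> N r n"
    unfolding partition_fun_def wsum_def
    using prob_simplexD(1)[OF x(1)] z \<beta> N
    by (intro sum_mono prod_mono conjI tilt_weight_le less_imp_le[OF tilt_weight_pos]) auto
  finally show ?thesis using partition_fun_pos[OF r] x(2) by (simp add: ln_ge_iff b_def)
qed

text \<open>Every weight is the tangent weight at one of the \<open>(n + 1) ^ r\<close> possible occupation vectors.\<close>
lemma partition_fun_upper:
  assumes z: "1 < z" and \<beta>: "0 \<le> \<beta>" and r: "1 \<le> r" and N: "0 < N"
  shows "ln (partition_fun z \<beta> N r n)
       \<le> real r * ln (real n + 1) + real n * max_free_energy z r (\<beta> * (real n / real N) powr (z - 1))"
proof -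
  define G where "G = PiE {1..r} (\<lambda>_. {0..n})"
  define M where "M = real n * max_free_energy z r (\<beta> * (real n / real N) powr (z - 1))"
  have fG: "finite G" unfolding G_def by (intro finite_PiE) auto
  have cG: "real (card G) = (real n + 1) ^ r" unfolding G_def by (simp add: card_PiE add.commute)
  have "partition_fun z \<beta> N r n
      \<le> (\<Sum>xs\<in>configs n {1..r}. \<Sum>y\<in>G. \<Prod>i\<in>{1..r}. tilt_weight z \<beta> N (real (y i) / real N) (count_list xs i))"
    unfolding partition_fun_def wsum_def
  proof (intro sum_mono)
    fix xs assume xs: "xs \<in> configs n {1..r}"
    define y where "y = restrict (count_list xs) {1..r}"
    have y: "y \<in> G" using xs count_le_length[of xs] by (auto simp: G_def y_def configs_def)
    have "(\<Prod>i\<in>{1..r}. spin_weight z \<beta> N (count_list xs i))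
        = (\<Prod>i\<in>{1..r}. tilt_weight z \<beta> N (real (y i) / real N) (count_list xs i))"
      by (intro prod.cong) (auto simp: y_def tilt_weight_self[OF N])
    also have "\<dots> \<le> (\<Sum>y\<in>G. \<Prod>i\<in>{1..r}. tilt_weight z \<beta> N (real (y i) / real N) (count_list xs i))"
      using y fG less_imp_le[OF tilt_weight_pos]
      by (intro member_le_sum[of y G "\<lambda>y. \<Prod>i\<in>{1..r}. tilt_weight z \<beta> N (real (y i) / real N) (count_list xs i)"] prod_nonneg) auto
    finally show "(\<Prod>i\<in>{1..r}. spin_weight z \<beta> N (count_list xs i))
        \<le> (\<Sum>y\<in>G. \<Prod>i\<in>{1..r}. tilt_weight z \<beta> N (real (y i) / real N) (count_list xs i))" .
  qed
  also have "\<dots> = (\<Sum>y\<in>G. wsum {1..r} (\<lambda>i. tilt_weight z \<beta> N (real (y i) / real N)) n)"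
    unfolding wsum_def by (rule sum.swap)
  also have "\<dots> \<le> (\<Sum>y\<in>G. exp M)"
    unfolding M_def using z \<beta> r N by (intro sum_mono tilt_upper) auto
  also have "\<dots> = (real n + 1) ^ r * exp M" using cG by simp
  finally have "ln (partition_fun z \<beta> N r n) \<le> ln ((real n + 1) ^ r * exp M)"
    using partition_fun_pos[OF r] by (subst ln_le_cancel_iff) auto
  also have "\<dots> = real r * ln (real n + 1) + M" by (simp add: ln_mult ln_realpow)
  finally show ?thesis unfolding M_def .
qed

section \<open>Log-convexity in the number of sites\<close>

lemma spin_weight_log_convex:
  assumes "1 < z" "0 \<le> \<beta>"
  shows "(spin_weight z \<beta> N (Suc m))\<^sup>2 \<le> spin_weight z \<beta> N m * spin_weight z \<beta> N (Suc (Suc m))"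
proof -
  let ?a = "real (Suc m) / real N" and ?k = "real N * \<beta> / z"
  let ?d = "?k * (z * ?a powr (z - 1) * (1 / real N))"
  have t: "?k * (?a powr z + z * ?a powr (z - 1) * (y - ?a)) \<le> ?k * y powr z" if "0 \<le> y" for y
    using assms that by (intro mult_left_mono powr_tangent) auto
  have "?k * ?a powr z - ?d \<le> ?k * (real m / real N) powr z"
    using t[of "real m / real N"] by (simp add: algebra_simps add_divide_distrib)
  moreover have "?k * ?a powr z + ?d \<le> ?k * (real (Suc (Suc m)) / real N) powr z"
    using t[of "real (Suc (Suc m)) / real N"] by (simp add: algebra_simps add_divide_distrib)
  ultimately show ?thesis
    unfolding spin_weight_def power2_eq_square exp_add[symmetric] exp_le_cancel_iff by linarith
qed

definition partition_ratio :: "real \<Rightarrow> real \<Rightarrow> nat \<Rightarrow> nat \<Rightarrow> nat \<Rightarrow> real" where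
  "partition_ratio z \<beta> N r n = partition_fun z \<beta> N r (Suc n) / partition_fun z \<beta> N r n"

lemma partition_ratio_pos: "1 \<le> r \<Longrightarrow> 0 < partition_ratio z \<beta> N r n"
  by (simp add: partition_ratio_def partition_fun_pos)

lemma partition_ratio_mono:
  assumes z: "1 < z" and \<beta>: "0 \<le> \<beta>" and r: "1 \<le> r" and "n \<le> m"
  shows "partition_ratio z \<beta> N r n \<le> partition_ratio z \<beta> N r m"
proof -
  have "partition_ratio z \<beta> N r k \<le> partition_ratio z \<beta> N r (Suc k)" for k
  proof -
    have "(partition_fun z \<beta> N r (Suc k))\<^sup>2 \<le> partition_fun z \<beta> N r k * partition_fun z \<beta> N r (Suc (Suc k))"
      unfolding partition_fun_def
      by (intro wsum_log_convex spin_weight_pos spin_weight_log_convex z \<beta>) auto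
    then show ?thesis
      using partition_fun_pos[OF r, of z \<beta> N] unfolding partition_ratio_def
      by (simp add: pos_divide_le_eq pos_le_divide_eq power2_eq_square mult_ac)
  qed
  then show ?thesis using \<open>n \<le> m\<close> by (rule lift_Suc_mono_le)
qed

text \<open>The logarithm of the partition function is a discrete convex function with increments
  \<open>ln (partition_ratio z \<beta> N r k)\<close>, so a mean slope lies between the increments
  at both ends.\<close>

lemma ln_partition_fun_slope:
  assumes z: "1 < z" and \<beta>: "0 \<le> \<beta>" and r: "1 \<le> r" and nm: "n \<le> m"
  shows "real (m - n) * ln (partition_ratio z \<beta> N r n) \<le> ln (partition_fun z \<beta> N r m) - ln (partition_fun z \<beta> N r n)"
    and "ln (partition_fun z \<beta> N r m) - ln (partition_fun z \<beta> N r n) \<le> real (m - n) * ln (partition_ratio z \<beta> N r m)"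
proof -
  let ?A = "\<lambda>k. ln (partition_fun z \<beta> N r k)" and ?R = "\<lambda>k. ln (partition_ratio z \<beta> N r k)"
  have step: "?A (Suc k) - ?A k = ?R k" for k
    using partition_fun_pos[OF r] by (simp add: partition_ratio_def ln_div less_imp_neq[symmetric])
  have mono: "?R k \<le> ?R l" if "k \<le> l" for k l
    using partition_ratio_mono[OF z \<beta> r that] partition_ratio_pos[OF r] by simp
  have tel: "?A m - ?A n = (\<Sum>k=n..<m. ?R k)"
    using sum_Suc_diff'[OF nm, of ?A] step by simp
  have "(\<Sum>k=n..<m. ?R n) \<le> (\<Sum>k=n..<m. ?R k)" by (intro sum_mono mono) auto
  then show "real (m - n) * ?R n \<le> ?A m - ?A n" unfolding tel by simp
  have "(\<Sum>k=n..<m. ?R k) \<le> (\<Sum>k=n..<m. ?R m)" by (intro sum_mono mono) auto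
  then show "?A m - ?A n \<le> real (m - n) * ?R m" unfolding tel by simp
qed

section \<open>Limits of ratios of partition functions\<close>

text \<open>The limit of \<open>ln (partition_fun z \<beta> N r n) / N\<close> as
  \<open>n / N\<close> tends to \<open>v\<close>.\<close>

definition pressure :: "real \<Rightarrow> real \<Rightarrow> nat \<Rightarrow> real \<Rightarrow> real" where
  "pressure z \<beta> r v = v * max_free_energy z r (\<beta> * v powr (z - 1))"

lemma isCont_max_free_energy:
  assumes "1 < z" "1 \<le> r"
  shows "isCont (max_free_energy z r) b"
proof -
  have "((\<lambda>b'. max_free_energy z r b' - max_free_energy z r b) \<longlongrightarrow> 0) (at b)"
  proof (rule Lim_null_comparison)
    show "\<forall>\<^sub>F b' in at b. norm (max_free_energy z r b' - max_free_energy z r b) \<le> \<bar>b' - b\<bar>"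
      using max_free_energy_Lipschitz[OF assms] by (intro always_eventually allI) simp
    have "((\<lambda>b'. \<bar>b' - b\<bar>) \<longlongrightarrow> \<bar>b - b\<bar>) (at b)" by (intro tendsto_intros)
    then show "((\<lambda>b'. \<bar>b' - b\<bar>) \<longlongrightarrow> 0) (at b)" by simp
  qed
  then show ?thesis unfolding isCont_def by (simp add: LIM_zero_iff)
qed

lemma max_free_energy_0:
  assumes "1 < z" "1 \<le> r"
  shows "max_free_energy z r 0 = ln (real r)"
proof (rule antisym)
  obtain x where x: "x \<in> prob_simplex r" "free_energy z r 0 x = max_free_energy z r 0"
    using max_free_energy_attained(1)[OF assms] by blast
  then show "max_free_energy z r 0 \<le> ln (real r)"
    using gibbs_variational[OF x(1) assms(2), of "\<lambda>_. 0"] by (simp add: free_energy_def)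
  show "ln (real r) \<le> max_free_energy z r 0"
    using max_free_energy_attained(2)[OF assms unif_in_simplex[OF assms(2)], of 0] entropy_unif[OF assms(2)]
    by (simp add: free_energy_def)
qed

lemma real_div_nonneg_limit: "(\<lambda>N. real (n N) / real N) \<longlonglongrightarrow> v \<Longrightarrow> 0 \<le> v"
  by (rule LIMSEQ_le_const) auto

lemma tendsto_ln_Suc_div:
  assumes "(\<lambda>N. real (n N) / real N) \<longlonglongrightarrow> v"
  shows "(\<lambda>N. ln (real (n N) + 1) / real N) \<longlonglongrightarrow> 0"
proof (rule Lim_null_comparison)
  have "(\<lambda>N. sqrt (real (n N) / real N + 1 / real N) * (2 / sqrt (real N))) \<longlonglongrightarrow> sqrt (v + 0) * 0"
    by (intro tendsto_mult tendsto_real_sqrt tendsto_add assms lim_1_over_n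
        tendsto_divide_0[OF tendsto_const] filterlim_at_top_imp_at_infinity
        filterlim_compose[OF sqrt_at_top filterlim_real_sequentially])
  then show "(\<lambda>N. sqrt (real (n N) / real N + 1 / real N) * (2 / sqrt (real N))) \<longlonglongrightarrow> 0" by simp
  show "\<forall>\<^sub>F N in sequentially. norm (ln (real (n N) + 1) / real N)
      \<le> sqrt (real (n N) / real N + 1 / real N) * (2 / sqrt (real N))"
  proof (rule eventually_mono[OF eventually_gt_at_top[of 0]])
    fix N :: nat assume N: "0 < N"
    have "ln (sqrt (real (n N) + 1)) \<le> sqrt (real (n N) + 1)"
      using ln_le_minus_one[of "sqrt (real (n N) + 1)"] by simp
    then have "ln (real (n N) + 1) \<le> 2 * sqrt (real (n N) + 1)" by (simp add: ln_sqrt)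
    moreover have "sqrt (real (n N) / real N + 1 / real N) * (2 / sqrt (real N)) = 2 * sqrt (real (n N) + 1) / real N"
      using N by (simp add: real_sqrt_divide flip: add_divide_distrib)
    ultimately show "norm (ln (real (n N) + 1) / real N) \<le> sqrt (real (n N) / real N + 1 / real N) * (2 / sqrt (real N))"
      by (simp add: divide_right_mono)
  qed
qed

lemma tendsto_effective_temperature:
  assumes z: "1 < z" and lim: "(\<lambda>N. real (n N) / real N) \<longlonglongrightarrow> v"
  shows "(\<lambda>N. \<beta> * (real (n N) / real N) powr (z - 1)) \<longlonglongrightarrow> \<beta> * v powr (z - 1)"
  using z by (intro tendsto_mult tendsto_const tendsto_powr'[OF lim tendsto_const]) (auto intro!: always_eventually)

lemma ln_partition_fun_limit:
  assumes z: "1 < z" and \<beta>: "0 \<le> \<beta>" and r: "1 \<le> r" and lim: "(\<lambda>N. real (n N) / real N) \<longlonglongrightarrow> v"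
  shows "(\<lambda>N. ln (partition_fun z \<beta> N r (n N)) / real N) \<longlonglongrightarrow> pressure z \<beta> r v"
proof -
  define L where "L N = real (n N) / real N * max_free_energy z r (\<beta> * (real (n N) / real N) powr (z - 1))" for N
  have L: "L \<longlonglongrightarrow> pressure z \<beta> r v"
    unfolding L_def pressure_def
    by (intro tendsto_mult lim isCont_tendsto_compose[OF isCont_max_free_energy[OF z r]] tendsto_effective_temperature[OF z lim])
  have "(\<lambda>N. L N + real r * (ln (real (n N) + 1) / real N)) \<longlonglongrightarrow> pressure z \<beta> r v + real r * 0"
    by (intro tendsto_add L tendsto_mult tendsto_const tendsto_ln_Suc_div[OF lim])
  then have U: "(\<lambda>N. L N + real r * (ln (real (n N) + 1) / real N)) \<longlonglongrightarrow> pressure z \<beta> r v" by simp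
  show ?thesis
  proof (rule tendsto_sandwich[OF _ _ L U])
    show "\<forall>\<^sub>F N in sequentially. L N \<le> ln (partition_fun z \<beta> N r (n N)) / real N"
    proof (rule eventually_mono[OF eventually_gt_at_top[of 0]])
      fix N :: nat assume N: "0 < N"
      show "L N \<le> ln (partition_fun z \<beta> N r (n N)) / real N"
        using divide_right_mono[OF partition_fun_lower[OF z \<beta> r N, of "n N"], of "real N"] by (simp add: L_def)
    qed
    show "\<forall>\<^sub>F N in sequentially. ln (partition_fun z \<beta> N r (n N)) / real N \<le> L N + real r * (ln (real (n N) + 1) / real N)"
    proof (rule eventually_mono[OF eventually_gt_at_top[of 0]])
      fix N :: nat assume N: "0 < N"
      show "ln (partition_fun z \<beta> N r (n N)) / real N \<le> L N + real r * (ln (real (n N) + 1) / real N)"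
        using divide_right_mono[OF partition_fun_upper[OF z \<beta> r N, of "n N"], of "real N"]
        by (simp add: L_def add_divide_distrib add.commute)
    qed
  qed
qed

lemma tendsto_nat_floor_div:
  assumes "0 \<le> w"
  shows "(\<lambda>N. real (nat \<lfloor>w * real N\<rfloor>) / real N) \<longlonglongrightarrow> w"
proof (rule tendsto_sandwich)
  have "(\<lambda>N. w - 1 / real N) \<longlonglongrightarrow> w - 0" by (intro tendsto_diff tendsto_const lim_1_over_n)
  then show "(\<lambda>N. w - 1 / real N) \<longlonglongrightarrow> w" by simp
  show "(\<lambda>N. w) \<longlonglongrightarrow> w" by simp
  have fl: "real (nat \<lfloor>w * real N\<rfloor>) = of_int \<lfloor>w * real N\<rfloor>" for N using assms by simp
  show "\<forall>\<^sub>F N in sequentially. w - 1 / real N \<le> real (nat \<lfloor>w * real N\<rfloor>) / real N"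
  proof (rule eventually_mono[OF eventually_gt_at_top[of 0]])
    fix N :: nat assume N: "0 < N"
    have "w * real N - 1 \<le> real (nat \<lfloor>w * real N\<rfloor>)" unfolding fl by linarith
    then have "(w * real N - 1) / real N \<le> real (nat \<lfloor>w * real N\<rfloor>) / real N" by (rule divide_right_mono) simp
    then show "w - 1 / real N \<le> real (nat \<lfloor>w * real N\<rfloor>) / real N" using N by (simp add: diff_divide_distrib)
  qed
  show "\<forall>\<^sub>F N in sequentially. real (nat \<lfloor>w * real N\<rfloor>) / real N \<le> w"
    by (rule eventually_mono[OF eventually_gt_at_top[of 0]]) (simp add: fl divide_le_eq)
qed

lemma ln_partition_fun_slope_limit:
  assumes z: "1 < z" and \<beta>: "0 \<le> \<beta>" and r: "1 \<le> r" and vw: "v < w"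
    and n: "(\<lambda>N. real (n N) / real N) \<longlonglongrightarrow> v" and m: "(\<lambda>N. real (m N) / real N) \<longlonglongrightarrow> w"
  shows "(\<lambda>N. (ln (partition_fun z \<beta> N r (m N)) - ln (partition_fun z \<beta> N r (n N))) / real (m N - n N))
       \<longlonglongrightarrow> (pressure z \<beta> r w - pressure z \<beta> r v) / (w - v)"
    and "\<forall>\<^sub>F N in sequentially. n N < m N"
proof -
  let ?A = "\<lambda>N k. ln (partition_fun z \<beta> N r k)"
  have "\<forall>\<^sub>F N in sequentially. 0 < real (m N) / real N - real (n N) / real N"
    using tendsto_diff[OF m n] vw by (intro order_tendstoD(1)[of _ "w - v"]) auto
  then show ev: "\<forall>\<^sub>F N in sequentially. n N < m N"
  proof (rule eventually_mono)
    fix N assume "0 < real (m N) / real N - real (n N) / real N"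
    then show "n N < m N" by (cases "N = 0") (auto simp: field_simps)
  qed
  have "(\<lambda>N. (?A N (m N) / real N - ?A N (n N) / real N) / (real (m N) / real N - real (n N) / real N))
      \<longlonglongrightarrow> (pressure z \<beta> r w - pressure z \<beta> r v) / (w - v)"
    using vw by (intro tendsto_divide tendsto_diff ln_partition_fun_limit z \<beta> r n m) auto
  then show "(\<lambda>N. (?A N (m N) - ?A N (n N)) / real (m N - n N)) \<longlonglongrightarrow> (pressure z \<beta> r w - pressure z \<beta> r v) / (w - v)"
  proof (rule Lim_transform_eventually)
    show "\<forall>\<^sub>F N in sequentially. (?A N (m N) / real N - ?A N (n N) / real N) / (real (m N) / real N - real (n N) / real N)
        = (?A N (m N) - ?A N (n N)) / real (m N - n N)"
      using ev eventually_gt_at_top[of 0]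
    proof eventually_elim
      case (elim N)
      then show ?case by (simp add: of_nat_diff flip: diff_divide_distrib)
    qed
  qed
qed

text \<open>Griffiths' argument: by convexity the increment at \<open>n\<close> is at most the mean
  slope up to a site number near \<open>w * N\<close>, and that slope converges to the slope of the
  pressure. The bound remains meaningful at a kink.\<close>

lemma partition_ratio_eventually_less:
  assumes z: "1 < z" and \<beta>: "0 \<le> \<beta>" and r: "1 \<le> r" and vw: "v < w"
    and n: "(\<lambda>N. real (n N) / real N) \<longlonglongrightarrow> v"
    and \<kappa>: "(pressure z \<beta> r w - pressure z \<beta> r v) / (w - v) < \<kappa>"
  shows "\<forall>\<^sub>F N in sequentially. ln (partition_ratio z \<beta> N r (n N)) < \<kappa>"
proof -
  have "0 \<le> w" using real_div_nonneg_limit[OF n] vw by simp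
  note m = tendsto_nat_floor_div[OF this]
  note s = ln_partition_fun_slope_limit[OF z \<beta> r vw n m]
  show ?thesis using order_tendstoD(2)[OF s(1) \<kappa>] s(2)
  proof eventually_elim
    case (elim N)
    then have "ln (partition_ratio z \<beta> N r (n N)) \<le>
        (ln (partition_fun z \<beta> N r (nat \<lfloor>w * real N\<rfloor>)) - ln (partition_fun z \<beta> N r (n N))) / real (nat \<lfloor>w * real N\<rfloor> - n N)"
      using ln_partition_fun_slope(1)[OF z \<beta> r, of "n N" "nat \<lfloor>w * real N\<rfloor>" N]
      by (subst pos_le_divide_eq) (auto simp: mult.commute)
    then show ?case using elim by simp
  qed
qed

lemma partition_ratio_eventually_greater:
  assumes z: "1 < z" and \<beta>: "0 \<le> \<beta>" and r: "1 \<le> r" and w: "0 \<le> w" and wv: "w < v"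
    and n: "(\<lambda>N. real (n N) / real N) \<longlonglongrightarrow> v"
    and \<kappa>: "\<kappa> < (pressure z \<beta> r v - pressure z \<beta> r w) / (v - w)"
  shows "\<forall>\<^sub>F N in sequentially. \<kappa> < ln (partition_ratio z \<beta> N r (n N))"
proof -
  note m = tendsto_nat_floor_div[OF w]
  note s = ln_partition_fun_slope_limit[OF z \<beta> r wv m n]
  show ?thesis using order_tendstoD(1)[OF s(1) \<kappa>] s(2)
  proof eventually_elim
    case (elim N)
    then have "(ln (partition_fun z \<beta> N r (n N)) - ln (partition_fun z \<beta> N r (nat \<lfloor>w * real N\<rfloor>))) / real (n N - nat \<lfloor>w * real N\<rfloor>)
        \<le> ln (partition_ratio z \<beta> N r (n N))"
      using ln_partition_fun_slope(2)[OF z \<beta> r, of "nat \<lfloor>w * real N\<rfloor>" "n N" N]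
      by (subst pos_divide_le_eq) (auto simp: mult.commute)
    then show ?case using elim by simp
  qed
qed

lemma partition_ratio_tendsto:
  assumes z: "1 < z" and \<beta>: "0 \<le> \<beta>" and r: "1 \<le> r" and v: "0 < v"
    and n: "(\<lambda>N. real (n N) / real N) \<longlonglongrightarrow> v"
    and D: "(pressure z \<beta> r has_real_derivative l) (at v)"
  shows "(\<lambda>N. partition_ratio z \<beta> N r (n N)) \<longlonglongrightarrow> exp l"
proof -
  have D': "((\<lambda>w. (pressure z \<beta> r w - pressure z \<beta> r v) / (w - v)) \<longlongrightarrow> l) (at v)"
    using D by (simp add: has_field_derivative_iff)
  have "(\<lambda>N. ln (partition_ratio z \<beta> N r (n N))) \<longlonglongrightarrow> l"
  proof (rule order_tendstoI)
    fix \<kappa> assume "l < \<kappa>"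
    from order_tendstoD(2)[OF D' this] obtain d where d: "0 < d"
      "\<And>w. w \<noteq> v \<Longrightarrow> dist w v < d \<Longrightarrow> (pressure z \<beta> r w - pressure z \<beta> r v) / (w - v) < \<kappa>"
      unfolding eventually_at by blast
    show "\<forall>\<^sub>F N in sequentially. ln (partition_ratio z \<beta> N r (n N)) < \<kappa>"
    proof (rule partition_ratio_eventually_less[OF z \<beta> r _ n])
      show "v < v + d / 2" using d(1) by simp
      show "(pressure z \<beta> r (v + d / 2) - pressure z \<beta> r v) / (v + d / 2 - v) < \<kappa>"
        using d(1) by (intro d(2)) (auto simp: dist_real_def)
    qed
  next
    fix \<kappa> assume "\<kappa> < l"
    from order_tendstoD(1)[OF D' this] obtain d where d: "0 < d"
      "\<And>w. w \<noteq> v \<Longrightarrow> dist w v < d \<Longrightarrow> \<kappa> < (pressure z \<beta> r w - pressure z \<beta> r v) / (w - v)"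
      unfolding eventually_at by blast
    \<comment> \<open>The maximum with \<open>v / 2\<close> keeps \<open>w\<close> a possible limit
      of \<open>n / N\<close>, that is, nonnegative.\<close>
    define w where "w = max (v - d / 2) (v / 2)"
    have w: "0 \<le> w" "w < v" "dist w v < d" using d(1) v by (auto simp: w_def dist_real_def)
    have "\<kappa> < (pressure z \<beta> r v - pressure z \<beta> r w) / (v - w)"
      using d(2)[OF _ w(3)] w(2) minus_divide_divide[of "pressure z \<beta> r v - pressure z \<beta> r w" "v - w"] by simp
    then show "\<forall>\<^sub>F N in sequentially. \<kappa> < ln (partition_ratio z \<beta> N r (n N))"
      by (intro partition_ratio_eventually_greater[OF z \<beta> r w(1,2) n])
  qed
  then have "(\<lambda>N. exp (ln (partition_ratio z \<beta> N r (n N)))) \<longlonglongrightarrow> exp l" by (intro tendsto_exp)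
  then show ?thesis by (simp add: partition_ratio_pos[OF r])
qed

lemma partition_ratio_0:
  assumes r: "1 \<le> r"
  shows "partition_ratio z \<beta> N r 0 = real r * exp (real N * \<beta> / z * (1 / real N) powr z)"
proof -
  let ?w = "\<lambda>_::nat. spin_weight z \<beta> N"
  have 0: "spin_weight z \<beta> N 0 = 1" by (simp add: spin_weight_def)
  have "wsum {1..r} ?w (Suc 0) = (\<Sum>x\<in>{1..r}. \<Prod>i\<in>{1..r}. shift ?w x i 0)"
    by (simp add: wsum_Suc wsum_0)
  also have "\<dots> = (\<Sum>x\<in>{1..r}. spin_weight z \<beta> N 1)"
  proof (intro sum.cong refl)
    fix x assume "x \<in> {1..r}"
    then have "(\<Prod>i\<in>{1..r}. shift ?w x i 0) = (\<Prod>i\<in>{1..r}. spin_weight z \<beta> N 0) * (spin_weight z \<beta> N 1 / spin_weight z \<beta> N 0)"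
      by (intro prod_shift_0 spin_weight_pos) auto
    then show "(\<Prod>i\<in>{1..r}. shift ?w x i 0) = spin_weight z \<beta> N 1" unfolding 0 by simp
  qed
  finally show ?thesis
    by (simp add: partition_ratio_def partition_fun_def wsum_0 0) (simp add: spin_weight_def)
qed

lemma partition_ratio_ge:
  assumes z: "1 < z" and \<beta>: "0 \<le> \<beta>" and r: "1 \<le> r"
  shows "real r \<le> partition_ratio z \<beta> N r n"
proof -
  have "1 \<le> exp (real N * \<beta> / z * (1 / real N) powr z)" using z \<beta> by simp
  then have "real r * 1 \<le> partition_ratio z \<beta> N r 0" unfolding partition_ratio_0[OF r] by (intro mult_left_mono) auto
  also have "\<dots> \<le> partition_ratio z \<beta> N r n" by (rule partition_ratio_mono[OF z \<beta> r]) simp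
  finally show ?thesis by simp
qed

text \<open>At 0 only slopes to the right exist. The lower bound holds for every \<open>N\<close>,
  since the ratio is monotone and explicit for no sites; above, the slope of the pressure over
  \<open>[0, 1 / k]\<close> is the maximal free energy at an effective inverse temperature that
  vanishes as \<open>k\<close> grows.\<close>

lemma partition_ratio_tendsto_0:
  assumes z: "1 < z" and \<beta>: "0 \<le> \<beta>" and r: "1 \<le> r"
    and n: "(\<lambda>N. real (n N) / real N) \<longlonglongrightarrow> 0"
  shows "(\<lambda>N. partition_ratio z \<beta> N r (n N)) \<longlonglongrightarrow> real r"
proof -
  have "(\<lambda>N. ln (partition_ratio z \<beta> N r (n N))) \<longlonglongrightarrow> ln (real r)"
  proof (rule order_tendstoI)
    fix \<kappa> assume \<kappa>: "\<kappa> < ln (real r)"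
    have "\<kappa> < ln (partition_ratio z \<beta> N r (n N))" for N
      using partition_ratio_ge[OF z \<beta> r, of N "n N"] r \<kappa>
      by (intro less_le_trans[OF \<kappa>]) (simp add: partition_ratio_pos)
    then show "\<forall>\<^sub>F N in sequentially. \<kappa> < ln (partition_ratio z \<beta> N r (n N))" by simp
  next
    fix \<kappa> assume \<kappa>: "ln (real r) < \<kappa>"
    have "(\<lambda>k. \<beta> * (real 1 / real k) powr (z - 1)) \<longlonglongrightarrow> \<beta> * 0 powr (z - 1)"
      using lim_1_over_n by (intro tendsto_effective_temperature[OF z, of "\<lambda>_. 1"]) simp
    then have "(\<lambda>k. max_free_energy z r (\<beta> * (real 1 / real k) powr (z - 1))) \<longlonglongrightarrow> max_free_energy z r 0"
      by (intro isCont_tendsto_compose[OF isCont_max_free_energy[OF z r]]) simp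
    from order_tendstoD(2)[OF this, of \<kappa>] \<kappa> max_free_energy_0[OF z r]
    have "\<forall>\<^sub>F k in sequentially. max_free_energy z r (\<beta> * (real 1 / real k) powr (z - 1)) < \<kappa>" by simp
    then obtain k where k: "0 < k" "max_free_energy z r (\<beta> * (real 1 / real k) powr (z - 1)) < \<kappa>"
      using eventually_conj[OF eventually_gt_at_top[of 0]] eventually_happens'[OF sequentially_bot] by blast
    show "\<forall>\<^sub>F N in sequentially. ln (partition_ratio z \<beta> N r (n N)) < \<kappa>"
      using k by (intro partition_ratio_eventually_less[OF z \<beta> r _ n, of "1 / real k"]) (auto simp: pressure_def)
  qed
  then have "(\<lambda>N. exp (ln (partition_ratio z \<beta> N r (n N)))) \<longlonglongrightarrow> exp (ln (real r))" by (intro tendsto_exp)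
  then show ?thesis using r by (simp add: partition_ratio_pos[OF r])
qed

section \<open>The critical temperature\<close>

definition disordered :: "real \<Rightarrow> nat \<Rightarrow> real \<Rightarrow> bool" where
  "disordered z r b \<longleftrightarrow> (\<forall>x\<in>prob_simplex r. free_energy z r b x \<le> free_energy z r b (unif r))"

definition crit :: "real \<Rightarrow> nat \<Rightarrow> real" where
  "crit z r = Sup {b. 0 \<le> b \<and> disordered z r b}"

lemma free_energy_unif:
  "1 \<le> r \<Longrightarrow> free_energy z r b (unif r) = ln (real r) + b * energy z r (unif r)"
  by (simp add: free_energy_def entropy_unif)

lemma disordered_iff:
  assumes "1 < z" "1 \<le> r"
  shows "disordered z r b \<longleftrightarrow> max_free_energy z r b = ln (real r) + b * energy z r (unif r)"
  using max_free_energy_attained[OF assms, where b = b] unif_in_simplex[OF assms(2)]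
  unfolding disordered_def free_energy_unif[OF assms(2), symmetric]
  by (metis antisym)

text \<open>The uniform distribution has the least energy, so lowering the weight of the energy can
  only favour it.\<close>

lemma disordered_mono:
  assumes z: "1 < z" and r: "1 \<le> r" and b: "b \<le> b'" and d: "disordered z r b'"
  shows "disordered z r b"
  unfolding disordered_def
proof
  fix x assume x: "x \<in> prob_simplex r"
  have "free_energy z r b' x \<le> free_energy z r b' (unif r)" using d x by (simp add: disordered_def)
  moreover have "(b' - b) * energy z r (unif r) \<le> (b' - b) * energy z r x"
    using b by (intro mult_left_mono energy_unif_le[OF z x r]) auto
  ultimately show "free_energy z r b x \<le> free_energy z r b (unif r)"
    unfolding free_energy_def left_diff_distrib by linarith
qed

lemma free_energy_summand_deriv:
  fixes y z b :: real
  assumes "0 < y" "z \<noteq> 0"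
  shows "((\<lambda>y. b / z * y powr z - y * ln y) has_real_derivative b * y powr (z - 1) - ln y - 1) (at y)"
  using assms by (auto intro!: derivative_eq_intros simp: powr_diff)

text \<open>The condition on \<open>h\<close> says that the second derivative of the summand is nonpositive on \<open>{0<..h}\<close>.\<close>
lemma free_energy_summand_tangent:
  fixes y z a b h :: real
  assumes z: "1 < z" and b: "0 \<le> b" and a: "0 < a" "a \<le> h" and y: "0 \<le> y" "y \<le> h"
    and h: "b * (z - 1) * h powr (z - 1) \<le> 1"
  shows "b / z * y powr z - y * ln y
       \<le> (b / z * a powr z - a * ln a) + (b * a powr (z - 1) - ln a - 1) * (y - a)"
proof -
  let ?g = "\<lambda>y. b / z * y powr z - y * ln y" and ?g' = "\<lambda>y. b * y powr (z - 1) - ln y - 1"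
  have dec: "?g' y2 \<le> ?g' y1" if "0 < y1" "y1 \<le> y2" "y2 \<le> h" for y1 y2
  proof (rule DERIV_nonpos_imp_nonincreasing[OF that(2)])
    fix t assume t: "y1 \<le> t" "t \<le> y2"
    have t0: "0 < t" using t that by simp
    have "(?g' has_real_derivative b * ((z - 1) * t powr (z - 1 - 1)) - 1 / t) (at t)"
      using DERIV_diff[OF DERIV_diff[OF DERIV_cmult[OF has_real_derivative_powr[OF t0, of "z - 1"], of b]
            DERIV_ln_divide[OF t0]] DERIV_const[of 1]] by simp
    moreover have "b * ((z - 1) * t powr (z - 1 - 1)) - 1 / t \<le> 0"
    proof -
      have "b * (z - 1) * t powr (z - 1) \<le> b * (z - 1) * h powr (z - 1)"
        using z b t0 t that by (intro mult_left_mono powr_mono2) auto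
      then have "b * (z - 1) * t powr (z - 1) \<le> 1" using h by simp
      moreover have "t powr (z - 1) = t powr (z - 1 - 1) * t" using t0 powr_add[of t "z - 1 - 1" 1] by simp
      ultimately show ?thesis using t0 by (simp add: field_simps)
    qed
    ultimately show "\<exists>d. (?g' has_real_derivative d) (at t) \<and> d \<le> 0" by blast
  qed
  have der: "(?g has_real_derivative ?g' t) (at t)" if "0 < t" for t
    using that z by (intro free_energy_summand_deriv) auto
  consider "y = 0" | "0 < y" "y < a" | "y = a" | "a < y" using y by linarith
  then show ?thesis
  proof cases
    case 1
    \<comment> \<open>At \<open>y = 0\<close> the left side of the claim is 0, and the claim reduces
      to \<open>b * (z - 1) * a powr (z - 1) \<le> z\<close>.\<close>
    have "b * (z - 1) * a powr (z - 1) \<le> b * (z - 1) * h powr (z - 1)"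
      using z b a by (intro mult_left_mono powr_mono2) auto
    then have "b * (z - 1) * a powr (z - 1) \<le> z" using h z by simp
    then have "a * (b * (z - 1) * a powr (z - 1)) \<le> a * z" using a by simp
    moreover have "a powr z = a * a powr (z - 1)" using a by (simp add: powr_diff)
    ultimately show ?thesis using 1 z by (simp add: field_simps)
  next
    case 2
    obtain t where t: "y < t" "t < a" "?g a - ?g y = (a - y) * ?g' t"
      using MVT2[OF 2(2), of ?g ?g'] der 2 by force
    have "(a - y) * ?g' a \<le> (a - y) * ?g' t" using t 2 a by (intro mult_left_mono dec) auto
    then have "?g y \<le> ?g a - (a - y) * ?g' a" using t(3) by linarith
    also have "\<dots> = ?g a + ?g' a * (y - a)" by (simp add: algebra_simps)
    finally show ?thesis .
  next
    case 4
    obtain t where t: "a < t" "t < y" "?g y - ?g a = (y - a) * ?g' t"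
      using MVT2[OF 4, of ?g ?g'] der a by force
    have "(y - a) * ?g' t \<le> (y - a) * ?g' a" using t y a by (intro mult_left_mono dec) auto
    then have "?g y \<le> ?g a + (y - a) * ?g' a" using t(3) by linarith
    then show ?thesis by (simp add: mult.commute)
  qed simp
qed

text \<open>Jensen's inequality: each summand of the free energy lies below its tangent at
  \<open>1 / r\<close> on \<open>[0, h]\<close>, and the linear parts sum to 0.\<close>

lemma free_energy_le_unif:
  assumes z: "1 < z" and b: "0 \<le> b" and r: "1 \<le> r" and h: "1 / real r \<le> h" "b * (z - 1) * h powr (z - 1) \<le> 1"
    and x: "x \<in> prob_simplex r" "\<And>i. i \<in> {1..r} \<Longrightarrow> x i \<le> h"
  shows "free_energy z r b x \<le> free_energy z r b (unif r)"
proof -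
  let ?a = "1 / real r"
  let ?g = "\<lambda>y. b / z * y powr z - y * ln y" and ?c = "b * ?a powr (z - 1) - ln ?a - 1"
  have F: "free_energy z r b w = (\<Sum>i\<in>{1..r}. ?g (w i))" for w
    by (simp add: free_energy_def energy_def entropy_def sum_subtractf sum_distrib_left sum_divide_distrib)
  have "(\<Sum>i\<in>{1..r}. ?g (x i)) \<le> (\<Sum>i\<in>{1..r}. ?g ?a + ?c * (x i - ?a))"
    using r x prob_simplexD(1)[OF x(1)]
    by (intro sum_mono free_energy_summand_tangent[OF z b _ h(1) _ _ h(2)]) auto
  also have "\<dots> = (\<Sum>i\<in>{1..r}. ?g ?a) + ?c * (\<Sum>i\<in>{1..r}. x i - ?a)"
    by (simp only: sum.distrib sum_distrib_left)
  also have "(\<Sum>i\<in>{1..r}. x i - ?a) = 0"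
    using prob_simplexD(4)[OF x(1)] r by (simp add: sum_subtractf)
  also have "(\<Sum>i\<in>{1..r}. ?g ?a) + ?c * 0 = (\<Sum>i\<in>{1..r}. ?g (unif r i))"
    unfolding mult_zero_right add_0_right by (intro sum.cong refl) (simp add: unif_def)
  finally show ?thesis unfolding F .
qed

lemma disordered_small:
  assumes z: "1 < z" and b: "0 \<le> b" "b * (z - 1) \<le> 1" and r: "1 \<le> r"
  shows "disordered z r b"
  unfolding disordered_def
  using free_energy_le_unif[OF z b(1) r, of 1] b(2) r prob_simplexD(2) by (auto simp: divide_le_eq)

text \<open>Compare with a point mass, which has entropy 0 and energy \<open>1 / z\<close>.\<close>

lemma disordered_bound:
  assumes z: "1 < z" and r: "2 \<le> r" and d: "disordered z r b"
  shows "b \<le> z * ln (real r) / (1 - real r powr (1 - z))"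
proof -
  define e where "e i = (if i = 1 then 1 else 0 :: real)" for i :: nat
  have "sum e {1..r} = 1" using r by (simp add: e_def)
  then have e: "e \<in> prob_simplex r" using r by (auto simp: prob_simplex_def e_def)
  have "(\<Sum>i\<in>{1..r}. e i powr z) = (\<Sum>i\<in>{1..r}. e i)" by (intro sum.cong) (auto simp: e_def)
  then have en: "energy z r e = 1 / z" using \<open>sum e {1..r} = 1\<close> by (simp add: energy_def)
  have "entropy r e = 0" by (simp add: entropy_def e_def sum.neutral)
  then have "b * (1 / z) \<le> ln (real r) + b * (real r powr (1 - z) / z)"
    using d e r energy_unif[of r z] entropy_unif[of r] en by (auto simp: disordered_def free_energy_def)
  then have "b * (1 - real r powr (1 - z)) \<le> z * ln (real r)"
    using z by (simp add: field_simps)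
  moreover have "real r powr (1 - z) < 1" using r z powr_less_mono[of "1 - z" 0 "real r"] by simp
  ultimately show ?thesis by (simp add: pos_le_divide_eq)
qed

lemma crit_facts:
  assumes z: "1 < z" and r: "2 \<le> r"
  shows crit_pos: "0 < crit z r"
    and disordered_crit: "disordered z r (crit z r)"
    and crit_less: "\<And>b. crit z r < b \<Longrightarrow> \<not> disordered z r b"
    and crit_greatest: "\<And>b. disordered z r b \<Longrightarrow> b \<le> crit z r"
proof -
  let ?B = "{b. 0 \<le> b \<and> disordered z r b}"
  have r1: "1 \<le> r" using r by simp
  have bdd: "bdd_above ?B" using disordered_bound[OF z r] by (auto intro!: bdd_aboveI)
  have "1 / (z - 1) \<in> ?B" using z r1 by (auto intro!: disordered_small)
  then have "1 / (z - 1) \<le> crit z r" unfolding crit_def by (intro cSup_upper bdd)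
  then show pos: "0 < crit z r" using z by (auto intro: less_le_trans[rotated])
  show greatest: "b \<le> crit z r" if "disordered z r b" for b
  proof (cases "0 \<le> b")
    case True
    then show ?thesis unfolding crit_def using that by (intro cSup_upper bdd) auto
  qed (use pos in simp)
  then show "\<not> disordered z r b" if "crit z r < b" for b using that by fastforce
  \<comment> \<open>For a fixed \<open>x\<close> the condition is linear in \<open>b\<close>, namely
    \<open>b * d \<le> ln r - entropy r x\<close>, and therefore passes to the supremum. Division by
    \<open>d\<close> forces the separate case \<open>d = 0\<close>.\<close>
  show "disordered z r (crit z r)"
    unfolding disordered_def
  proof
    fix x assume x: "x \<in> prob_simplex r"
    define d where "d = energy z r x - energy z r (unif r)"
    have d: "0 \<le> d" using energy_unif_le[OF z x r1] by (simp add: d_def)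
    have "b * d \<le> ln (real r) - entropy r x" if "b \<in> ?B" for b
      using that x unfolding disordered_def d_def free_energy_unif[OF r1] by (auto simp: free_energy_def algebra_simps)
    then have "d = 0 \<Longrightarrow> 0 \<le> ln (real r) - entropy r x" and "d \<noteq> 0 \<Longrightarrow> b \<in> ?B \<Longrightarrow> b \<le> (ln (real r) - entropy r x) / d" for b
      using \<open>1 / (z - 1) \<in> ?B\<close> d by (force simp: pos_le_divide_eq)+
    then have "crit z r * d \<le> ln (real r) - entropy r x"
      using \<open>1 / (z - 1) \<in> ?B\<close> d unfolding crit_def
      by (cases "d = 0") (auto simp: pos_le_divide_eq[symmetric] intro!: cSup_least)
    then show "free_energy z r (crit z r) x \<le> free_energy z r (crit z r) (unif r)"
      unfolding free_energy_unif[OF r1] d_def by (simp add: free_energy_def algebra_simps)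
  qed
qed

section \<open>Weak limits of the Potts measure and the critical value\<close>

lemma emp_in_simplex:
  assumes "xs \<in> configs N {1..q}" "0 < N"
  shows "emp xs \<in> prob_simplex q"
proof -
  have xs: "length xs = N" "set xs \<subseteq> {1..q}" using assms(1) by (auto simp: configs_def)
  have "(\<Sum>i\<in>{1..q}. count_list xs i) = length xs"
    using xs(2) sum_count_set[of xs "{1..q}"] by simp
  then have "(\<Sum>i\<in>{1..q}. real (count_list xs i)) = real N" using xs(1) by (simp flip: of_nat_sum)
  then have "sum (emp xs) {1..q} = 1" using assms(2) xs(1) by (simp add: emp_def flip: sum_divide_distrib)
  moreover have "emp xs i = 0" if "i \<notin> {1..q}" for i
    using that xs(2) by (auto simp: emp_def count_list_0_iff)
  ultimately show ?thesis by (simp add: prob_simplex_def emp_def)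
qed

lemma potts_weight_energy:
  "potts_weight q z \<beta> xs = exp (real (length xs) * \<beta> * energy z q (emp xs))"
  by (simp add: potts_weight_def energy_def)

lemma potts_weight_prod:
  "potts_weight q z \<beta> xs = (\<Prod>i\<in>{1..q}. spin_weight z \<beta> (length xs) (count_list xs i))"
  by (simp add: potts_weight_def spin_weight_def emp_def sum_distrib_left flip: exp_sum)

lemma potts_Z_eq: "potts_Z q z \<beta> N = partition_fun z \<beta> N q N"
  unfolding potts_Z_def partition_fun_def wsum_def
  by (intro sum.cong refl) (simp add: potts_weight_prod configs_def)

lemma potts_prob_nonneg: "1 \<le> q \<Longrightarrow> 0 \<le> potts_prob q z \<beta> xs"
  using partition_fun_pos[of q z \<beta>] by (simp add: potts_prob_def potts_Z_eq potts_weight_def less_imp_le)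

lemma sum_potts_prob:
  assumes "1 \<le> q"
  shows "(\<Sum>xs\<in>configs N {1..q}. potts_prob q z \<beta> xs) = 1"
proof -
  have "(\<Sum>xs\<in>configs N {1..q}. potts_prob q z \<beta> xs) = (\<Sum>xs\<in>configs N {1..q}. potts_weight q z \<beta> xs / potts_Z q z \<beta> N)"
    by (intro sum.cong refl) (simp add: potts_prob_def configs_def)
  also have "\<dots> = potts_Z q z \<beta> N / potts_Z q z \<beta> N"
    by (simp only: potts_Z_def sum_divide_distrib)
  also have "\<dots> = 1" using partition_fun_pos[OF assms, of z \<beta> N N] by (simp add: potts_Z_eq)
  finally show ?thesis .
qed

text \<open>Exponential Markov inequality with the partition function at a larger disordered temperature.\<close>
lemma potts_energy_deviation:
  assumes z: "1 < z" and q: "1 \<le> q" and \<beta>: "0 \<le> \<beta>" "\<beta> < \<beta>'" and d: "disordered z q \<beta>'" and N: "0 < N"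
  shows "(\<Sum>xs\<in>{xs\<in>configs N {1..q}. energy z q (unif q) + \<delta> \<le> energy z q (emp xs)}. potts_prob q z \<beta> xs)
       \<le> (real N + 1) ^ q * exp (- ((\<beta>' - \<beta>) * \<delta>) * real N)"
proof -
  let ?B = "{xs\<in>configs N {1..q}. energy z q (unif q) + \<delta> \<le> energy z q (emp xs)}"
  let ?u = "energy z q (unif q)"
  have d0: "disordered z q \<beta>" using disordered_mono[OF z q _ d] \<beta> by simp
  have Z0: "exp (real N * (ln (real q) + \<beta> * ?u)) \<le> potts_Z q z \<beta> N"
    using partition_fun_lower[OF z \<beta>(1) q N, of N] d0 N partition_fun_pos[OF q, of z \<beta> N N]
    by (simp add: potts_Z_eq ln_ge_iff disordered_iff[OF z q])
  have "ln (potts_Z q z \<beta>' N) \<le> real q * ln (real N + 1) + real N * (ln (real q) + \<beta>' * ?u)"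
    using partition_fun_upper[OF z _ q N, of \<beta>' N] d N \<beta>
    by (simp add: potts_Z_eq disordered_iff[OF z q])
  moreover have "0 < potts_Z q z \<beta>' N" using partition_fun_pos[OF q] by (simp add: potts_Z_eq)
  ultimately have "potts_Z q z \<beta>' N \<le> exp (real q * ln (real N + 1) + real N * (ln (real q) + \<beta>' * ?u))"
    by (subst (asm) exp_le_cancel_iff[symmetric]) simp
  then have Z1: "potts_Z q z \<beta>' N \<le> (real N + 1) ^ q * exp (real N * (ln (real q) + \<beta>' * ?u))"
    by (simp add: exp_add exp_of_nat_mult)
  have Zpos: "0 < potts_Z q z \<beta> N" using partition_fun_pos[OF q] by (simp add: potts_Z_eq)
  have "(\<Sum>xs\<in>?B. potts_weight q z \<beta> xs) \<le> (\<Sum>xs\<in>?B. exp (- (real N * (\<beta>' - \<beta>) * (?u + \<delta>))) * potts_weight q z \<beta>' xs)"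
  proof (intro sum_mono)
    fix xs assume xs: "xs \<in> ?B"
    then have l: "length xs = N" by (simp add: configs_def)
    have "real N * (\<beta>' - \<beta>) * (?u + \<delta>) \<le> real N * (\<beta>' - \<beta>) * energy z q (emp xs)"
      using xs \<beta> by (intro mult_left_mono) auto
    then have "real N * \<beta> * energy z q (emp xs) \<le> - (real N * (\<beta>' - \<beta>) * (?u + \<delta>)) + real N * \<beta>' * energy z q (emp xs)"
      by (simp add: algebra_simps)
    then show "potts_weight q z \<beta> xs \<le> exp (- (real N * (\<beta>' - \<beta>) * (?u + \<delta>))) * potts_weight q z \<beta>' xs"
      unfolding potts_weight_energy l exp_add[symmetric] exp_le_cancel_iff .
  qed
  also have "\<dots> = exp (- (real N * (\<beta>' - \<beta>) * (?u + \<delta>))) * (\<Sum>xs\<in>?B. potts_weight q z \<beta>' xs)"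
    by (simp only: sum_distrib_left)
  also have "(\<Sum>xs\<in>?B. potts_weight q z \<beta>' xs) \<le> potts_Z q z \<beta>' N"
    unfolding potts_Z_def by (intro sum_mono2) (auto simp: potts_weight_def)
  also note Z1
  finally have "(\<Sum>xs\<in>?B. potts_weight q z \<beta> xs)
      \<le> exp (- (real N * (\<beta>' - \<beta>) * (?u + \<delta>))) * ((real N + 1) ^ q * exp (real N * (ln (real q) + \<beta>' * ?u)))"
    by simp
  also have "\<dots> = (real N + 1) ^ q * exp (- ((\<beta>' - \<beta>) * \<delta>) * real N) * exp (real N * (ln (real q) + \<beta> * ?u))"
  proof -
    have "- (real N * (\<beta>' - \<beta>) * (?u + \<delta>)) + real N * (ln (real q) + \<beta>' * ?u)
        = - ((\<beta>' - \<beta>) * \<delta>) * real N + real N * (ln (real q) + \<beta> * ?u)" by (simp add: algebra_simps)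
    then have e: "exp (- (real N * (\<beta>' - \<beta>) * (?u + \<delta>))) * exp (real N * (ln (real q) + \<beta>' * ?u))
        = exp (- ((\<beta>' - \<beta>) * \<delta>) * real N) * exp (real N * (ln (real q) + \<beta> * ?u))"
      unfolding exp_add[symmetric] by (rule arg_cong)
    show ?thesis unfolding mult.assoc mult.left_commute[of _ "(real N + 1) ^ q"] e[unfolded mult.assoc] ..
  qed
  also have "\<dots> \<le> (real N + 1) ^ q * exp (- ((\<beta>' - \<beta>) * \<delta>) * real N) * potts_Z q z \<beta> N"
    using Z0 by (intro mult_left_mono) auto
  finally have "(\<Sum>xs\<in>?B. potts_weight q z \<beta> xs) / potts_Z q z \<beta> N \<le> (real N + 1) ^ q * exp (- ((\<beta>' - \<beta>) * \<delta>) * real N)"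
    using Zpos by (simp add: divide_le_eq)
  moreover have "(\<Sum>xs\<in>?B. potts_prob q z \<beta> xs) = (\<Sum>xs\<in>?B. potts_weight q z \<beta> xs) / potts_Z q z \<beta> N"
    unfolding sum_divide_distrib by (intro sum.cong refl) (simp add: potts_prob_def configs_def)
  ultimately show ?thesis by simp
qed

lemma polynomial_times_exp_decay:
  fixes c :: real
  assumes "0 < c" "1 \<le> q"
  shows "(\<lambda>N. (real N + 1) ^ q * exp (- c * real N)) \<longlonglongrightarrow> 0"
proof -
  \<comment> \<open>The decay is split evenly among the \<open>q\<close> polynomial factors, so that
    \<open>N * y ^ N\<close> is all that has to be controlled.\<close>
  define y where "y = exp (- c / real q)"
  have y: "norm y < 1" using assms by (simp add: y_def)
  have "(\<lambda>N. real N * y ^ N + y ^ N) \<longlonglongrightarrow> 0 + 0"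
    using powser_times_n_limit_0[OF y] LIMSEQ_power_zero[OF y] by (intro tendsto_add) auto
  then have "(\<lambda>N. (real N * y ^ N + y ^ N) ^ q) \<longlonglongrightarrow> 0 ^ q" by (intro tendsto_power) simp
  moreover have "(real N * y ^ N + y ^ N) ^ q = (real N + 1) ^ q * exp (- c * real N)" for N
  proof -
    have "(y ^ N) ^ q = exp (real (N * q) * (- c / real q))"
      unfolding y_def power_mult[symmetric] by (rule exp_of_nat_mult[symmetric])
    also have "real (N * q) * (- c / real q) = - c * real N" using assms by simp
    finally have "(y ^ N) ^ q = exp (- c * real N)" .
    moreover have "real N * y ^ N + y ^ N = (real N + 1) * y ^ N" by (simp add: algebra_simps)
    ultimately show ?thesis by (simp only: power_mult_distrib)
  qed
  ultimately show ?thesis using assms(2) by (simp add: power_0_left)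
qed

text \<open>The uniform distribution is the only minimiser of the energy. On the compact set where
  \<open>f\<close> differs from its uniform value by at least \<open>e / 2\<close> the energy thus
  exceeds its minimum by some \<open>\<delta>\<close>, and such configurations are exponentially
  unlikely; the room between \<open>\<beta>\<close> and \<open>crit z q\<close> provides the
  \<open>\<beta>'\<close> of the deviation bound.\<close>

lemma potts_unif_limit_below:
  assumes z: "1 < z" and q: "2 \<le> q" and \<beta>: "0 \<le> \<beta>" "\<beta> < crit z q"
  shows "potts_unif_limit q z \<beta>"
  unfolding potts_unif_limit_def
proof (intro allI impI)
  fix f :: "(nat \<Rightarrow> real) \<Rightarrow> real" assume f: "continuous_on (prob_simplex q) f"
  have q1: "1 \<le> q" using q by simp
  let ?u = "unif q" and ?P = "potts_prob q z \<beta>"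
  have u: "?u \<in> prob_simplex q" by (rule unif_in_simplex[OF q1])
  obtain M where M: "\<And>x. x \<in> prob_simplex q \<Longrightarrow> \<bar>f x\<bar> \<le> M"
    using compact_imp_bounded[OF compact_continuous_image[OF f compact_prob_simplex]]
    unfolding bounded_iff by fastforce
  have "(\<lambda>N. (\<Sum>xs\<in>configs N {1..q}. ?P xs * f (emp xs))) \<longlonglongrightarrow> f ?u"
  proof (rule LIMSEQ_I)
    fix e :: real assume e: "0 < e"
    define K where "K = prob_simplex q \<inter> {x. e / 2 \<le> \<bar>f x - f ?u\<bar>}"
    have "K = prob_simplex q \<inter> (\<lambda>x. \<bar>f x - f ?u\<bar>) -` {e / 2..}" by (auto simp: K_def)
    also have "closed \<dots>"
      by (intro continuous_closed_preimage closed_atLeast compact_imp_closed[OF compact_prob_simplex] continuous_intros f)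
    finally have "compact (prob_simplex q \<inter> K)" by (intro compact_Int_closed compact_prob_simplex)
    then have K: "compact K" by (simp add: K_def Int_assoc[symmetric])
    have "\<exists>\<delta>>0. \<forall>x\<in>K. energy z q ?u + \<delta> \<le> energy z q x"
    proof (cases "K = {}")
      case False
      obtain x where x: "x \<in> K" "\<And>y. y \<in> K \<Longrightarrow> energy z q x \<le> energy z q y"
        using continuous_attains_inf[OF K False continuous_on_subset[OF continuous_on_energy[OF z]]]
        by (metis K_def inf_le1)
      have "x \<noteq> ?u" using x(1) e by (auto simp: K_def)
      then have "energy z q ?u < energy z q x" using x(1) by (intro energy_unif_less z q1) (auto simp: K_def)
      then show ?thesis using x(2) by (intro exI[of _ "energy z q x - energy z q ?u"]) auto
    qed (auto intro: exI[of _ 1])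
    then obtain \<delta> where \<delta>: "0 < \<delta>" "\<And>x. x \<in> K \<Longrightarrow> energy z q ?u + \<delta> \<le> energy z q x" by blast
    obtain \<beta>' where \<beta>': "\<beta> < \<beta>'" "\<beta>' < crit z q" using dense[OF \<beta>(2)] by blast
    have d: "disordered z q \<beta>'" using disordered_mono[OF z q1 _ disordered_crit[OF z q]] \<beta>'(2) by simp
    let ?t = "\<lambda>N. (real N + 1) ^ q * exp (- ((\<beta>' - \<beta>) * \<delta>) * real N)"
    have "(\<lambda>N. 2 * M * ?t N) \<longlonglongrightarrow> 2 * M * 0"
      using \<beta>' \<delta> q1 by (intro tendsto_mult tendsto_const polynomial_times_exp_decay) auto
    then have "\<forall>\<^sub>F N in sequentially. 2 * M * ?t N < e / 2"
      using e by (intro order_tendstoD) auto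
    then obtain N0 where N0: "\<And>N. N0 \<le> N \<Longrightarrow> 2 * M * ?t N < e / 2"
      unfolding eventually_sequentially by blast
    have "norm ((\<Sum>xs\<in>configs N {1..q}. ?P xs * f (emp xs)) - f ?u) < e" if N: "Suc N0 \<le> N" for N
    proof -
      let ?C = "configs N {1..q}"
      let ?B = "{xs\<in>?C. energy z q ?u + \<delta> \<le> energy z q (emp xs)}"
      have Npos: "0 < N" using N by simp
      have pn: "0 \<le> ?P xs" for xs by (rule potts_prob_nonneg[OF q1])
      have M0: "0 \<le> M" using M[OF u] by simp
      have "(\<Sum>xs\<in>?C. ?P xs * f (emp xs)) - f ?u = (\<Sum>xs\<in>?C. ?P xs * (f (emp xs) - f ?u))"
        unfolding right_diff_distrib sum_subtractf sum_distrib_right[symmetric] sum_potts_prob[OF q1] by simp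
      also have "\<bar>\<dots>\<bar> \<le> (\<Sum>xs\<in>?C. \<bar>?P xs * (f (emp xs) - f ?u)\<bar>)" by (rule sum_abs)
      also have "\<dots> \<le> (\<Sum>xs\<in>?C. ?P xs * (e / 2) + (if xs \<in> ?B then 2 * M * ?P xs else 0))"
      proof (intro sum_mono)
        fix xs assume xs: "xs \<in> ?C"
        have es: "emp xs \<in> prob_simplex q" by (rule emp_in_simplex[OF xs Npos])
        show "\<bar>?P xs * (f (emp xs) - f ?u)\<bar> \<le> ?P xs * (e / 2) + (if xs \<in> ?B then 2 * M * ?P xs else 0)"
        proof (cases "xs \<in> ?B")
          case True
          have "\<bar>f (emp xs) - f ?u\<bar> \<le> 2 * M" using M[OF es] M[OF u] by linarith
          then have "?P xs * \<bar>f (emp xs) - f ?u\<bar> \<le> 2 * M * ?P xs"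
            using mult_left_mono[OF _ pn[of xs], of "\<bar>f (emp xs) - f ?u\<bar>" "2 * M"] by (simp add: mult_ac)
          moreover have "0 \<le> ?P xs * (e / 2)" using pn[of xs] e by simp
          moreover have "\<bar>?P xs * (f (emp xs) - f ?u)\<bar> = ?P xs * \<bar>f (emp xs) - f ?u\<bar>"
            using pn[of xs] by (simp add: abs_mult)
          ultimately show ?thesis using True by (simp only: if_True)
        next
          case False
          then have "emp xs \<notin> K" using \<delta>(2) xs by auto
          then have "\<bar>f (emp xs) - f ?u\<bar> \<le> e / 2" using es by (simp add: K_def)
          then have "?P xs * \<bar>f (emp xs) - f ?u\<bar> \<le> ?P xs * (e / 2)" using pn by (intro mult_left_mono)
          moreover have "\<bar>?P xs * (f (emp xs) - f ?u)\<bar> = ?P xs * \<bar>f (emp xs) - f ?u\<bar>"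
            using pn[of xs] by (simp add: abs_mult)
          ultimately show ?thesis using False by (simp only: if_False)
        qed
      qed
      also have "\<dots> = e / 2 + 2 * M * (\<Sum>xs\<in>?B. ?P xs)"
      proof -
        have "(\<Sum>xs\<in>?C. if xs \<in> ?B then 2 * M * ?P xs else 0) = (\<Sum>xs\<in>?B. 2 * M * ?P xs)"
          by (intro sum.mono_neutral_cong_right) auto
        then show ?thesis
          unfolding sum.distrib sum_distrib_right[symmetric] sum_distrib_left[symmetric] sum_potts_prob[OF q1] by simp
      qed
      also have "\<dots> \<le> e / 2 + 2 * M * ?t N"
        using M0 by (intro add_left_mono mult_left_mono potts_energy_deviation[OF z q1 \<beta>(1) \<beta>'(1) d Npos]) auto
      also have "\<dots> < e" using N0[of N] N by simp
      finally show ?thesis by simp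
    qed
    then show "\<exists>no. \<forall>N\<ge>no. norm ((\<Sum>xs\<in>configs N {1..q}. ?P xs * f (emp xs)) - f ?u) < e" by blast
  qed
  moreover have "?u = (\<lambda>i. if i \<in> {1..q} then 1 / real q else 0)" by (auto simp: unif_def)
  ultimately show "(\<lambda>N. (\<Sum>xs\<in>configs N {1..q}. ?P xs * f (emp xs)))
      \<longlonglongrightarrow> f (\<lambda>i. if i \<in> {1..q} then 1 / real q else 0)" by simp
qed

text \<open>Under the Potts measure the mean of \<open>exp (- N * \<beta> * energy)\<close> is
  \<open>q ^ N / Z\<close>, so Jensen's inequality gives
  \<open>ln Z / N \<le> ln q + \<beta> * m N\<close> with the mean energy \<open>m N\<close>. The
  weak limit sends \<open>m N\<close> to the energy of the uniform distribution, while
  \<open>ln Z / N\<close> tends to the maximal free energy.\<close>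

lemma disordered_if_potts_unif_limit:
  assumes z: "1 < z" and q: "1 \<le> q" and \<beta>: "0 \<le> \<beta>" and lim: "potts_unif_limit q z \<beta>"
  shows "disordered z q \<beta>"
proof -
  let ?P = "potts_prob q z \<beta>" and ?u = "unif q"
  define m where "m N = (\<Sum>xs\<in>configs N {1..q}. ?P xs * energy z q (emp xs))" for N
  have "?u = (\<lambda>i. if i \<in> {1..q} then 1 / real q else 0)" by (auto simp: unif_def)
  then have m: "m \<longlonglongrightarrow> energy z q ?u"
    using lim continuous_on_energy[OF z, of q] unfolding potts_unif_limit_def m_def by metis
  have le: "ln (partition_fun z \<beta> N q N) / real N \<le> ln (real q) + \<beta> * m N" if N: "0 < N" for N
  proof -
    let ?C = "configs N {1..q}" and ?k = "real N * \<beta>" and ?Z = "partition_fun z \<beta> N q N"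
    have Z: "0 < ?Z" by (rule partition_fun_pos[OF q])
    \<comment> \<open>The tangent to \<open>exp\<close> at the mean, averaged over the Potts
      measure: the linear term drops out because \<open>m N\<close> is the mean energy.\<close>
    have "exp (- ?k * m N) = (\<Sum>xs\<in>?C. ?P xs * (exp (- ?k * m N) * (1 - ?k * (energy z q (emp xs) - m N))))"
    proof -
      have "(\<Sum>xs\<in>?C. ?P xs * (1 - ?k * (energy z q (emp xs) - m N)))
          = (\<Sum>xs\<in>?C. (1 + ?k * m N) * ?P xs - ?k * (?P xs * energy z q (emp xs)))"
        by (intro sum.cong refl) (simp add: algebra_simps)
      also have "\<dots> = (1 + ?k * m N) * (\<Sum>xs\<in>?C. ?P xs) - ?k * m N"
        unfolding sum_subtractf sum_distrib_left[symmetric] m_def[symmetric] ..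
      also have "\<dots> = 1" unfolding sum_potts_prob[OF q] by simp
      finally have "exp (- ?k * m N) * (\<Sum>xs\<in>?C. ?P xs * (1 - ?k * (energy z q (emp xs) - m N))) = exp (- ?k * m N)"
        by simp
      then show ?thesis unfolding sum_distrib_left by (simp only: mult.left_commute)
    qed
    also have "\<dots> \<le> (\<Sum>xs\<in>?C. ?P xs * exp (- ?k * energy z q (emp xs)))"
    proof (intro sum_mono mult_left_mono potts_prob_nonneg q)
      fix xs
      have "1 + - ?k * (energy z q (emp xs) - m N) \<le> exp (- ?k * (energy z q (emp xs) - m N))" by (rule exp_ge_add_one_self)
      then have "exp (- ?k * m N) * (1 - ?k * (energy z q (emp xs) - m N)) \<le> exp (- ?k * m N) * exp (- ?k * (energy z q (emp xs) - m N))"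
        by (intro mult_left_mono) auto
      then show "exp (- ?k * m N) * (1 - ?k * (energy z q (emp xs) - m N)) \<le> exp (- ?k * energy z q (emp xs))"
        by (simp add: exp_add[symmetric] algebra_simps)
    qed
    also have "\<dots> = (\<Sum>xs\<in>?C. 1 / ?Z)"
    proof (intro sum.cong refl)
      fix xs assume "xs \<in> ?C"
      then have l: "length xs = N" by (simp add: configs_def)
      show "?P xs * exp (- ?k * energy z q (emp xs)) = 1 / ?Z"
        unfolding potts_prob_def potts_weight_energy l potts_Z_eq by (simp add: exp_minus)
    qed
    also have "\<dots> = real q ^ N / ?Z"
    proof -
      have "wsum {1..q} (\<lambda>i m. exp (0 + 0 * real m)) N = exp (\<Sum>i\<in>{1..q}. 0) * (\<Sum>i\<in>{1..q}. exp 0) ^ N"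
        using wsum_exp[of "{1..q}" "\<lambda>_. 0" "\<lambda>_. 0" N] by simp
      then have "real (card ?C) = real q ^ N" by (simp add: wsum_def)
      then show ?thesis by simp
    qed
    finally have "ln (exp (- ?k * m N)) \<le> ln (real q ^ N / ?Z)"
      using Z q by (subst ln_le_cancel_iff) auto
    then have "- ?k * m N \<le> real N * ln (real q) - ln ?Z" using Z q by (simp add: ln_div ln_realpow)
    then show ?thesis using N by (simp add: divide_le_eq algebra_simps)
  qed
  have "(\<lambda>N. real N / real N) \<longlonglongrightarrow> 1"
    by (rule tendsto_eventually, rule eventually_mono[OF eventually_gt_at_top[of 0]]) simp
  note L1 = ln_partition_fun_limit[OF z \<beta> q this]
  have L2: "(\<lambda>N. ln (real q) + \<beta> * m N) \<longlonglongrightarrow> ln (real q) + \<beta> * energy z q ?u"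
    by (intro tendsto_intros m)
  have "pressure z \<beta> q 1 \<le> ln (real q) + \<beta> * energy z q ?u"
    by (rule tendsto_le[OF sequentially_bot L2 L1])
       (rule eventually_mono[OF eventually_gt_at_top[of 0]], rule le)
  then have "max_free_energy z q \<beta> \<le> free_energy z q \<beta> ?u"
    unfolding free_energy_unif[OF q] by (simp add: pressure_def)
  then show ?thesis
    using max_free_energy_attained(2)[OF z q] unfolding disordered_def by (meson order_trans)
qed

text \<open>A uniform weak limit occurs everywhere below \<open>crit z q\<close> and nowhere above
  it. This fixes the supremum without deciding the limit at \<open>crit z q\<close> itself.\<close>

lemma potts_crit_eq_crit:
  assumes z: "1 < z" and q: "2 \<le> q"
  shows "potts_crit q z = crit z q"
proof (rule antisym)
  let ?S = "{\<beta>. 0 \<le> \<beta> \<and> potts_unif_limit q z \<beta>}"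
  have sub: "\<beta> \<le> crit z q" if "\<beta> \<in> ?S" for \<beta>
    using that q by (intro crit_greatest[OF z q] disordered_if_potts_unif_limit z) auto
  then have bdd: "bdd_above ?S" by (rule bdd_aboveI)
  have "0 \<in> ?S" using potts_unif_limit_below[OF z q] crit_pos[OF z q] by simp
  then show "potts_crit q z \<le> crit z q" unfolding potts_crit_def using sub by (intro cSup_least) auto
  show "crit z q \<le> potts_crit q z"
  proof (rule dense_le_bounded[OF crit_pos[OF z q]])
    fix w assume "0 < w" "w < crit z q"
    then show "w \<le> potts_crit q z"
      unfolding potts_crit_def by (intro cSup_upper bdd) (simp add: potts_unif_limit_below[OF z q])
  qed
qed

section \<open>Monotonicity in the number of states and coexistence\<close>

lemma disordered_one_state: "disordered z 1 b"
proof -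
  have "x = unif 1" if "x \<in> prob_simplex 1" for x
  proof
    fix i show "x i = unif 1 i"
      using prob_simplexD(3,4)[OF that] by (cases "i = 1") (auto simp: unif_def)
  qed
  then show ?thesis by (auto simp: disordered_def)
qed

text \<open>The strict inequality \<open>\<beta> * v powr (z - 1) < b\<close> is open in
  \<open>v\<close>, so the pressure has its explicit disordered form on a whole neighbourhood, also
  for \<open>v = 1\<close>.\<close>

lemma pressure_deriv_disordered:
  assumes z: "1 < z" and r: "1 \<le> r" and v: "0 < v"
    and d: "disordered z r b" and b: "\<beta> * v powr (z - 1) < b"
  shows "(pressure z \<beta> r has_real_derivative
           ln (real r) + z * (\<beta> * v powr (z - 1) * energy z r (unif r))) (at v)"
proof -
  let ?E = "energy z r (unif r)"
  have "((\<lambda>w. \<beta> * w powr (z - 1)) \<longlongrightarrow> \<beta> * v powr (z - 1)) (nhds v)"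
    using v by (intro tendsto_mult tendsto_const tendsto_powr filterlim_ident) auto
  then have ev1: "\<forall>\<^sub>F w in nhds v. \<beta> * w powr (z - 1) < b" by (rule order_tendstoD(2)) (rule b)
  have ev2: "\<forall>\<^sub>F w in nhds v. 0 < w" using v by (rule eventually_nhds_in_open[OF open_greaterThan, simplified])
  have eq: "\<forall>\<^sub>F w in nhds v. pressure z \<beta> r w = ln (real r) * w + \<beta> * ?E * w powr z"
    using ev1 ev2
  proof eventually_elim
    case (elim w)
    have "disordered z r (\<beta> * w powr (z - 1))" using disordered_mono[OF z r _ d] elim by simp
    then have "pressure z \<beta> r w = w * (ln (real r) + \<beta> * w powr (z - 1) * ?E)"
      using disordered_iff[OF z r] by (simp add: pressure_def)
    moreover have "w powr z = w * w powr (z - 1)" using elim powr_add[of w 1 "z - 1"] by simp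
    ultimately show ?case by (simp add: algebra_simps)
  qed
  have "((\<lambda>w. ln (real r) * w + \<beta> * ?E * w powr z) has_real_derivative
      ln (real r) * 1 + \<beta> * ?E * (z * v powr (z - 1))) (at v)"
    by (intro DERIV_add DERIV_cmult DERIV_ident has_real_derivative_powr v)
  then show ?thesis
    by (subst DERIV_cong_ev[OF refl eq refl]) (simp add: mult_ac)
qed

text \<open>The grouping rule: normalising a block of mass \<open>m\<close> splits its entropy into
  \<open>- m * ln m\<close> and \<open>m\<close> times the entropy within the block, and scales its
  energy by \<open>m powr z\<close>. The bijection numbers the block.\<close>

lemma simplex_block:
  fixes x :: "nat \<Rightarrow> real" and J :: "nat set"
  assumes x: "\<And>i. i \<in> J \<Longrightarrow> 0 \<le> x i" and f: "bij_betw f {1..r} J" and m: "m = sum x J" "0 < m"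
    and z: "z \<noteq> 0"
  defines "y \<equiv> \<lambda>k. if k \<in> {1..r} then x (f k) / m else 0"
  shows "y \<in> prob_simplex r"
    and "(\<Sum>i\<in>J. x i powr z) / z = m powr z * energy z r y"
    and "(\<Sum>i\<in>J. x i * ln (x i)) = m * ln m - m * entropy r y"
proof -
  have fJ: "f k \<in> J" if "k \<in> {1..r}" for k using f that by (auto simp: bij_betw_def)
  have re: "(\<Sum>i\<in>J. h i) = (\<Sum>k\<in>{1..r}. h (f k))" for h :: "nat \<Rightarrow> real"
    using sum.reindex_bij_betw[OF f, of h] by simp
  have "sum y {1..r} = sum x J / m" unfolding re by (simp add: y_def sum_divide_distrib)
  then show y: "y \<in> prob_simplex r"
    using m x fJ by (auto simp: prob_simplex_def y_def)
  have "x (f k) powr z = m powr z * y k powr z" if "k \<in> {1..r}" for k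
    using that m(2) x[OF fJ[OF that]] by (simp add: y_def powr_divide)
  then have "(\<Sum>i\<in>J. x i powr z) = (\<Sum>k\<in>{1..r}. m powr z * y k powr z)"
    unfolding re by (intro sum.cong) auto
  then show "(\<Sum>i\<in>J. x i powr z) / z = m powr z * energy z r y"
    by (simp add: energy_def sum_distrib_left)
  have "x (f k) * ln (x (f k)) = ln m * (m * y k) + m * (y k * ln (y k))" if "k \<in> {1..r}" for k
    using that m(2) x[OF fJ[OF that]]
    by (cases "x (f k) = 0") (auto simp: y_def ln_div right_diff_distrib)
  then have "(\<Sum>i\<in>J. x i * ln (x i)) = (\<Sum>k\<in>{1..r}. ln m * (m * y k) + m * (y k * ln (y k)))"
    unfolding re by (intro sum.cong) auto
  also have "\<dots> = ln m * (m * sum y {1..r}) + m * (\<Sum>k\<in>{1..r}. y k * ln (y k))"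
    by (simp only: sum.distrib sum_distrib_left)
  finally show "(\<Sum>i\<in>J. x i * ln (x i)) = m * ln m - m * entropy r y"
    using prob_simplexD(4)[OF y] by (simp add: entropy_def)
qed

text \<open>Averaging \<open>r\<close> coordinates of mass \<open>m\<close> changes the free energy as in the \<open>r\<close>-state model at the
  lower temperature \<open>b * m powr (z - 1)\<close>, so it does not decrease it, and it decreases the energy.\<close>
lemma average_block:
  assumes z: "1 < z" and b: "0 \<le> b" and r: "1 \<le> r" and d: "disordered z r b"
    and x: "x \<in> prob_simplex r'" and J: "J \<subseteq> {1..r'}" "card J = r" and ij: "i \<in> J" "j \<in> J" "x i \<noteq> x j"
  shows "\<exists>x'\<in>prob_simplex r'. free_energy z r' b x \<le> free_energy z r' b x' \<and> energy z r' x' < energy z r' x"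
proof -
  define m where "m = sum x J"
  define x' where "x' i = (if i \<in> J then m / real r else x i)" for i
  have fJ: "finite J" using J(1) finite_subset by blast
  obtain f where f: "bij_betw f {1..r} J"
    using ex_bij_betw_nat_finite_1[OF fJ] J(2) by auto
  have xn: "0 \<le> x i" for i by (rule prob_simplexD(1)[OF x])
  have "0 < max (x i) (x j)" using ij(3) xn[of i] xn[of j] by linarith
  then have m0: "0 < m"
    unfolding m_def using ij xn sum_nonneg_0[OF fJ, of x] sum_nonneg[of J x]
    by (metis max.idem order_less_irrefl order_le_less)
  have sJ: "sum x' J = m" using J(2) r by (simp add: x'_def)
  have split: "sum h {1..r'} = sum h J + sum h ({1..r'} - J)" for h :: "nat \<Rightarrow> real"
    using sum.subset_diff[OF J(1), of h] by simp
  have cng: "(\<Sum>i\<in>{1..r'} - J. h (x' i)) = (\<Sum>i\<in>{1..r'} - J. h (x i))" for h :: "real \<Rightarrow> real"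
    by (intro sum.cong) (auto simp: x'_def)
  have "sum x' {1..r'} = sum x {1..r'}"
    unfolding split[of x'] split[of x] using cng[of "\<lambda>t. t"] sJ by (simp add: m_def)
  then have x': "x' \<in> prob_simplex r'"
    using x m0 J(1) xn by (auto simp: prob_simplex_def x'_def)
  define y where "y k = (if k \<in> {1..r} then x (f k) / m else 0)" for k
  define y' where "y' k = (if k \<in> {1..r} then x' (f k) / m else 0)" for k
  have z0: "z \<noteq> 0" using z by simp
  note By = simplex_block[where x = x, OF xn f m_def m0 z0, folded y_def]
  have xn': "0 \<le> x' i" for i by (rule prob_simplexD(1)[OF x'])
  note By' = simplex_block[where x = x', OF xn' f sJ[symmetric] m0 z0, folded y'_def]
  have fk: "f k \<in> J" if "k \<in> {1..r}" for k using f that by (auto simp: bij_betw_def)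
  have y': "y' = unif r"
    using m0 fk by (auto simp: y'_def unif_def x'_def fun_eq_iff)
  have yne: "y \<noteq> unif r"
  proof
    assume y: "y = unif r"
    have "x l = m / real r" if l: "l \<in> J" for l
    proof -
      obtain k where k: "k \<in> {1..r}" "l = f k" using f l by (auto simp: bij_betw_def)
      then have "x l / m = 1 / real r" using fun_cong[OF y, of k] by (simp add: y_def unif_def)
      then show ?thesis using m0 by (simp add: field_simps)
    qed
    then show False using ij by metis
  qed
  have e: "energy z r' x' = m powr z * energy z r (unif r) + (\<Sum>i\<in>{1..r'} - J. x i powr z) / z"
    unfolding energy_def[of z r' x'] split add_divide_distrib cng[of "\<lambda>t. t powr z"] By'(2) y' ..
  have e0: "energy z r' x = m powr z * energy z r y + (\<Sum>i\<in>{1..r'} - J. x i powr z) / z"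
    unfolding energy_def[of z r' x] split add_divide_distrib By(2) ..
  have h: "entropy r' x' = m * entropy r (unif r) - m * ln m - (\<Sum>i\<in>{1..r'} - J. x i * ln (x i))"
    unfolding entropy_def[of r' x'] split cng[of "\<lambda>t. t * ln t"] By'(3) y' by simp
  have h0: "entropy r' x = m * entropy r y - m * ln m - (\<Sum>i\<in>{1..r'} - J. x i * ln (x i))"
    unfolding entropy_def[of r' x] split By(3) by simp
  have "m \<le> sum x {1..r'}" unfolding m_def using J(1) xn by (intro sum_mono2) auto
  then have m1: "m \<le> 1" using prob_simplexD(4)[OF x] by simp
  have "m powr (z - 1) \<le> 1" using m0 m1 z powr_mono2[of "z - 1" m 1] by simp
  then have "b * m powr (z - 1) \<le> b" using b by (simp add: mult_left_le)
  then have "disordered z r (b * m powr (z - 1))" by (rule disordered_mono[OF z r _ d])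
  then have "free_energy z r (b * m powr (z - 1)) y \<le> free_energy z r (b * m powr (z - 1)) (unif r)"
    using By(1) by (simp add: disordered_def)
  then have "m * free_energy z r (b * m powr (z - 1)) y \<le> m * free_energy z r (b * m powr (z - 1)) (unif r)"
    using m0 by simp
  moreover have "m powr z = m * m powr (z - 1)" using m0 powr_add[of m 1 "z - 1"] by simp
  ultimately have "free_energy z r' b x \<le> free_energy z r' b x'"
    unfolding free_energy_def e e0 h h0 by (simp add: algebra_simps)
  moreover have "energy z r' x' < energy z r' x"
    unfolding e e0 using m0 energy_unif_less[OF z By(1) r yne] by simp
  ultimately show ?thesis using x' by blast
qed

lemma compact_free_energy_level:
  assumes "1 < z"
  shows "compact (prob_simplex r \<inter> {x. c \<le> free_energy z r b x})"
proof -
  have eq: "prob_simplex r \<inter> {x. c \<le> free_energy z r b x} = prob_simplex r \<inter> (prob_simplex r \<inter> free_energy z r b -` {c..})"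
    by auto
  have "closed (prob_simplex r \<inter> free_energy z r b -` {c..})"
    by (intro continuous_closed_preimage closed_atLeast compact_imp_closed[OF compact_prob_simplex] continuous_on_free_energy assms)
  then show ?thesis unfolding eq by (rule compact_Int_closed[OF compact_prob_simplex])
qed

text \<open>Among the points whose free energy is at least that of \<open>x0\<close>, take one of
  least energy. Two unequal coordinates would fit into a block of \<open>r \<ge> 2\<close>
  coordinates, and averaging it would lower the energy further; so this point is uniform. Energy is
  minimised instead of maximising the free energy, because averaging may leave the free energy
  unchanged.\<close>

lemma disordered_more_states:
  assumes z: "1 < z" and b: "0 \<le> b" and r: "2 \<le> r" "r \<le> r'" and d: "disordered z r b"
  shows "disordered z r' b"
  unfolding disordered_def
proof
  fix x0 assume x0: "x0 \<in> prob_simplex r'"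
  define K where "K = prob_simplex r' \<inter> {x. free_energy z r' b x0 \<le> free_energy z r' b x}"
  have K: "compact K" unfolding K_def by (rule compact_free_energy_level[OF z])
  have K0: "x0 \<in> K" using x0 by (simp add: K_def)
  have "continuous_on K (energy z r')"
    by (rule continuous_on_subset[OF continuous_on_energy[OF z]]) (simp add: K_def)
  from continuous_attains_inf[OF K _ this] K0
  obtain x where x: "x \<in> K" "\<And>y. y \<in> K \<Longrightarrow> energy z r' x \<le> energy z r' y" by blast
  have xs: "x \<in> prob_simplex r'" using x(1) by (simp add: K_def)
  have const: "x i = x j" if ij: "i \<in> {1..r'}" "j \<in> {1..r'}" for i j
  proof (rule ccontr)
    assume ne: "x i \<noteq> x j"
    then have "i \<noteq> j" by auto
    then have c2: "card {i, j} = 2" by simp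
    obtain J where J: "{i, j} \<subseteq> J" "J \<subseteq> {1..r'}" "card J = r"
      using exists_subset_between[of "{i, j}" r "{1..r'}"] c2 r ij by auto
    obtain x' where "x' \<in> prob_simplex r'" "free_energy z r' b x \<le> free_energy z r' b x'" "energy z r' x' < energy z r' x"
      using average_block[OF z b _ d xs J(2,3) _ _ ne] J(1) r(1) by auto
    then show False using x(2)[of x'] x(1) by (auto simp: K_def)
  qed
  have "x = unif r'"
  proof
    fix i show "x i = unif r' i"
    proof (cases "i \<in> {1..r'}")
      case True
      have "(\<Sum>j\<in>{1..r'}. x j) = (\<Sum>j\<in>{1..r'}. x i)" by (intro sum.cong refl const True)
      then have "real r' * x i = 1" using prob_simplexD(4)[OF xs] by simp
      then show ?thesis using True r by (simp add: unif_def field_simps)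
    qed (use prob_simplexD(3)[OF xs] in \<open>auto simp: unif_def\<close>)
  qed
  then show "free_energy z r' b x0 \<le> free_energy z r' b (unif r')" using x(1) by (simp add: K_def)
qed

text \<open>The hypothesis places the critical value below the spinodal one, where the uniform point
  stops being a local maximum. For \<open>b\<close> slightly above the critical value, every point
  that beats the uniform one then still has a coordinate above some fixed \<open>h > 1 / r\<close>.
  Letting \<open>b\<close> decrease on the compact set of such points gives coexistence.\<close>

lemma nonuniform_maximizer:
  assumes z: "1 < z" and r: "2 \<le> r" and s: "crit z r * (z - 1) * (1 / real r) powr (z - 1) < 1"
  shows "\<exists>x\<in>prob_simplex r. x \<noteq> unif r \<and> free_energy z r (crit z r) x = free_energy z r (crit z r) (unif r)"
proof -
  let ?c = "crit z r" and ?a = "1 / real r"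
  have r1: "1 \<le> r" using r by simp
  have c0: "0 < ?c" by (rule crit_pos[OF z r])
  have "((\<lambda>h. ?c * (z - 1) * h powr (z - 1)) \<longlongrightarrow> ?c * (z - 1) * ?a powr (z - 1)) (at_right ?a)"
    using r z by (intro tendsto_mult tendsto_const tendsto_powr tendsto_ident_at) auto
  from order_tendstoD(2)[OF this s]
  have "\<forall>\<^sub>F h in at_right ?a. ?c * (z - 1) * h powr (z - 1) < 1 \<and> ?a < h"
    using eventually_at_right_less by (rule eventually_conj)
  then obtain h where h: "?a < h" "?c * (z - 1) * h powr (z - 1) < 1"
    using eventually_happens'[OF trivial_limit_at_right_real] by blast
  have h0: "0 < h" using h(1) r by (auto intro: less_trans[rotated])
  \<comment> \<open>Up to \<open>b1\<close> each summand of the free energy is concave on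
    \<open>[0, h]\<close>.\<close>
  define b1 where "b1 = 1 / ((z - 1) * h powr (z - 1))"
  have b1: "?c < b1" using h(2) h0 z by (simp add: b1_def pos_less_divide_eq mult_ac)
  define K where "K = prob_simplex r \<inter> (\<Union>i\<in>{1..r}. {x. h \<le> x i})"
  have "closed {x :: nat \<Rightarrow> real. h \<le> x i}" for i
    by (intro closed_Collect_le continuous_on_const continuous_on_coord)
  then have K: "compact K" unfolding K_def by (intro compact_Int_closed compact_prob_simplex closed_UN) auto
  have ex: "\<exists>x\<in>K. free_energy z r b (unif r) < free_energy z r b x" if b: "?c < b" "b \<le> b1" for b
  proof -
    obtain x where x: "x \<in> prob_simplex r" "free_energy z r b (unif r) < free_energy z r b x"
      using crit_less[OF z r b(1)] by (auto simp: disordered_def not_le)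
    have "b * (z - 1) * h powr (z - 1) \<le> b1 * (z - 1) * h powr (z - 1)"
      using b z by (intro mult_right_mono) auto
    then have "b * (z - 1) * h powr (z - 1) \<le> 1" using z h0 by (simp add: b1_def)
    then have "\<not> (\<forall>i\<in>{1..r}. x i \<le> h)"
      using free_energy_le_unif[OF z _ r1 less_imp_le[OF h(1)] _ x(1), of b] x(2) b c0 by force
    then have "x \<in> K" using x(1) by (force simp: K_def)
    then show ?thesis using x(2) by blast
  qed
  have Kn: "K \<noteq> {}" using ex[of b1] b1 by auto
  have "continuous_on K (free_energy z r ?c)"
    by (rule continuous_on_subset[OF continuous_on_free_energy[OF z]]) (simp add: K_def)
  then obtain x where x: "x \<in> K" "\<And>y. y \<in> K \<Longrightarrow> free_energy z r ?c y \<le> free_energy z r ?c x"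
    using continuous_attains_sup[OF K Kn] by blast
  have xs: "x \<in> prob_simplex r" using x(1) by (simp add: K_def)
  have "free_energy z r ?c (unif r) \<le> free_energy z r ?c x"
  proof (rule ccontr)
    \<comment> \<open>If the best point of \<open>K\<close> fell short by \<open>g\<close> at the
      critical value, raising \<open>b\<close> by at most \<open>g\<close> could not make up for it,
      since energies lie in \<open>[0, 1]\<close>.\<close>
    define g where "g = free_energy z r ?c (unif r) - free_energy z r ?c x"
    assume "\<not> ?thesis"
    then have g: "0 < g" by (simp add: g_def)
    define b where "b = min b1 (?c + g)"
    have b: "?c < b" "b \<le> b1" "b - ?c \<le> g" using b1 g by (auto simp: b_def)
    obtain y where y: "y \<in> K" "free_energy z r b (unif r) < free_energy z r b y" using ex[OF b(1,2)] by blast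
    have ys: "y \<in> prob_simplex r" using y(1) by (simp add: K_def)
    have "energy z r y \<le> 1 / z" by (rule energy_le[OF z ys])
    also have "\<dots> \<le> 1" using z by simp
    finally have "(b - ?c) * energy z r y \<le> g * 1"
      using b energy_nonneg[of z r y] z g by (intro mult_mono) auto
    then have "(b - ?c) * energy z r y \<le> g" by simp
    moreover have "0 \<le> (b - ?c) * energy z r (unif r)" using b energy_nonneg[of z r "unif r"] z by simp
    moreover have "free_energy z r ?c y \<le> free_energy z r ?c x" by (rule x(2)[OF y(1)])
    ultimately show False using y(2) unfolding g_def free_energy_def left_diff_distrib by linarith
  qed
  moreover have "free_energy z r ?c x \<le> free_energy z r ?c (unif r)"
    using disordered_crit[OF z r] xs by (simp add: disordered_def)
  moreover have "x \<noteq> unif r"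
  proof
    assume "x = unif r"
    then show False using x(1) h(1) by (auto simp: K_def unif_def)
  qed
  ultimately show ?thesis using xs by (intro bexI[of _ x]) auto
qed

section \<open>The order of the transition\<close>

lemma greater_if_deriv_pos:
  fixes f f' :: "real \<Rightarrow> real"
  assumes "a < b" and "\<And>t. a \<le> t \<Longrightarrow> t < b \<Longrightarrow> (f has_real_derivative f' t) (at t)"
    and "\<And>t. a < t \<Longrightarrow> t < b \<Longrightarrow> 0 < f' t" and t: "a < t" "t < b"
  shows "f a < f t"
proof (rule DERIV_pos_imp_increasing_open[OF t(1)])
  show "\<exists>y. (f has_real_derivative y) (at x) \<and> 0 < y" if "a < x" "x < t" for x
    using assms(2)[of x] assms(3)[of x] that t by auto
  show "continuous_on {a..t} f"
    using assms(2) t by (intro DERIV_atLeastAtMost_imp_continuous_on) force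
qed

text \<open>At the spinodal value \<open>b\<close> the second derivative of a free energy summand
  vanishes at \<open>1 / r\<close>. The displayed sum is, up to the factor \<open>1 / r\<close>, the
  gain in free energy from the relative perturbation \<open>s\<close> of the uniform point at this
  \<open>b\<close>; a positive gain shows that order has set in strictly earlier.\<close>

lemma crit_below_spinodal:
  fixes d :: real
  assumes z: "1 < z" and r: "2 \<le> r" and k: "0 < d" "d < 1"
    and x: "\<And>t. 0 < t \<Longrightarrow> t < d \<Longrightarrow> \<exists>s. (\<forall>i\<in>{1..r}. -1 < s i) \<and> (\<Sum>i\<in>{1..r}. s i) = 0 \<and>
       0 < (\<Sum>i\<in>{1..r}. (1 + s i) powr z / (z * (z - 1)) - (1 + s i) * ln (1 + s i) - 1 / (z * (z - 1)))"
  shows "crit z r * (z - 1) * (1 / real r) powr (z - 1) < 1"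
proof -
  let ?a = "1 / real r"
  define b where "b = 1 / ((z - 1) * ?a powr (z - 1))"
  have a: "0 < ?a" using r by simp
  have r1: "1 \<le> r" using r by simp
  have b0: "0 < b" using z a by (simp add: b_def)
  have d2: "0 < d / 2" "d / 2 < d" using k by auto
  from x[OF d2] obtain s where s: "\<And>i. i \<in> {1..r} \<Longrightarrow> -1 < s i" "(\<Sum>i\<in>{1..r}. s i) = 0"
      "0 < (\<Sum>i\<in>{1..r}. (1 + s i) powr z / (z * (z - 1)) - (1 + s i) * ln (1 + s i) - 1 / (z * (z - 1)))"
    by (elim exE conjE) (metis (no_types, lifting))
  define y where "y i = (if i \<in> {1..r} then ?a * (1 + s i) else 0)" for i
  have "(\<Sum>i\<in>{1..r}. ?a * (1 + s i)) = 1"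
    unfolding sum_distrib_left[symmetric] sum.distrib s(2) using r by simp
  then have sy: "sum y {1..r} = 1" by (simp add: y_def)
  have y: "y \<in> prob_simplex r"
    unfolding prob_simplex_def
  proof (intro CollectI conjI allI impI sy)
    show "0 \<le> y i" for i
      using s(1)[of i] a by (cases "i \<in> {1..r}") (auto simp: y_def simp del: times_divide_eq_left)
  qed (auto simp: y_def)
  have az: "b / z * ?a powr z = ?a / (z * (z - 1))"
  proof -
    have "?a powr z = ?a * ?a powr (z - 1)" using a powr_add[of ?a 1 "z - 1"] by simp
    then show ?thesis using z a by (simp add: b_def)
  qed
  have F: "free_energy z r b w = (\<Sum>i\<in>{1..r}. b / z * w i powr z - w i * ln (w i))" for w
    by (simp add: free_energy_def energy_def entropy_def sum_subtractf sum_distrib_left sum_divide_distrib)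
  have "b / z * y i powr z - y i * ln (y i) - (b / z * ?a powr z - ?a * ln ?a)
      = ?a * ((1 + s i) powr z / (z * (z - 1)) - (1 + s i) * ln (1 + s i) - 1 / (z * (z - 1))) - (?a * ln ?a) * s i"
    if i: "i \<in> {1..r}" for i
  proof -
    have s1: "0 < 1 + s i" using s(1)[OF i] by simp
    have yi: "y i = ?a * (1 + s i)" using i by (simp add: y_def)
    have "b / z * y i powr z = b / z * ?a powr z * (1 + s i) powr z"
      unfolding yi by (simp only: powr_mult mult.assoc)
    moreover have "ln (y i) = ln ?a + ln (1 + s i)"
      unfolding yi using a s1 by (intro ln_mult_pos)
    moreover have "A * W - a * (1 + t) * (la + l1) - (A - a * la) = a * (W / c - (1 + t) * l1 - 1 / c) - (a * la) * t"
      if "A = a / c" for a A W l1 la t c :: real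
      unfolding that by (simp add: algebra_simps)
    note this[OF az]
    ultimately show ?thesis unfolding yi by (simp only:)
  qed
  then have "(\<Sum>i\<in>{1..r}. b / z * y i powr z - y i * ln (y i) - (b / z * ?a powr z - ?a * ln ?a))
      = (\<Sum>i\<in>{1..r}. ?a * ((1 + s i) powr z / (z * (z - 1)) - (1 + s i) * ln (1 + s i) - 1 / (z * (z - 1))) - (?a * ln ?a) * s i)"
    by (intro sum.cong) auto
  also have "\<dots> = ?a * (\<Sum>i\<in>{1..r}. (1 + s i) powr z / (z * (z - 1)) - (1 + s i) * ln (1 + s i) - 1 / (z * (z - 1)))"
    unfolding sum_subtractf[of "\<lambda>i. ?a * _ i"] sum_distrib_left[symmetric] s(2) by simp
  also have "\<dots> > 0" using a s(3) by simp
  finally have "(\<Sum>i\<in>{1..r}. b / z * ?a powr z - ?a * ln ?a) < free_energy z r b y"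
    unfolding F sum_subtractf by simp
  moreover have "(\<Sum>i\<in>{1..r}. b / z * ?a powr z - ?a * ln ?a) = free_energy z r b (unif r)"
    unfolding F by (intro sum.cong) (auto simp: unif_def)
  ultimately have "\<not> disordered z r b" using y by (force simp: disordered_def)
  then have "crit z r < b" using disordered_mono[OF z r1 _ disordered_crit[OF z r]] by (metis not_le)
  then show ?thesis using z a by (simp add: b_def pos_less_divide_eq mult_ac)
qed

lemma DERIV_rescale:
  fixes f :: "real \<Rightarrow> real"
  assumes "(f has_real_derivative D) (at (c * t))"
  shows "((\<lambda>t. f (c * t)) has_real_derivative c * D) (at t)"
proof -
  have "((\<lambda>t. c * t) has_real_derivative c) (at t)" using DERIV_cmult_Id by simp
  from DERIV_chain2[OF assms this] show ?thesis by (simp add: mult.commute)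
qed

lemma powr_one_plus_deriv:
  fixes p s :: real
  assumes "-1 < s"
  shows "((\<lambda>s. (1 + s) powr p) has_real_derivative p * (1 + s) powr (p - 1)) (at s)"
proof -
  have "((\<lambda>s. 1 + s) has_real_derivative 1) (at s)" by (auto intro!: derivative_eq_intros)
  from DERIV_chain2[OF has_real_derivative_powr[of "1 + s" p] this] assms show ?thesis by simp
qed

text \<open>Expansion of the free energy at the spinodal temperature: \<open>G\<close> is a normalised summand. The
  direction \<open>(2, -1, -1, 0, \<dots>)\<close> sees its positive third derivative, \<open>(1, -1)\<close> its fourth derivative,
  which is positive for \<open>z > 4\<close>.\<close>
lemma crit_below_spinodal_cases:
  assumes z: "1 < z" and r: "3 \<le> r \<or> r = 2 \<and> 4 < z"
  shows "crit z r * (z - 1) * (1 / real r) powr (z - 1) < 1"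
proof -
  define p where "p = z - 1"
  have p: "0 < p" "z = p + 1" using z by (auto simp: p_def)
  define G where "G s = (1 + s) powr z / (z * p) - (1 + s) * ln (1 + s)" for s :: real
  define G1 where "G1 s = (1 + s) powr p / p - ln (1 + s) - 1" for s :: real
  define G2 where "G2 s = (1 + s) powr (p - 1) - 1 / (1 + s)" for s :: real
  define G3 where "G3 s = (p - 1) * (1 + s) powr (p - 2) + 1 / (1 + s)\<^sup>2" for s :: real
  have lnd: "((\<lambda>s. ln (1 + s)) has_real_derivative 1 / (1 + s)) (at s)" if "-1 < s" for s :: real
    using that by (auto intro!: derivative_eq_intros)
  have dG: "(G has_real_derivative G1 s) (at s)" if s: "-1 < s" for s
  proof -
    have "((\<lambda>s. (1 + s) * ln (1 + s)) has_real_derivative 1 * ln (1 + s) + (1 / (1 + s)) * (1 + s)) (at s)"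
      using s by (intro DERIV_mult lnd) (auto intro!: derivative_eq_intros)
    then have 1: "((\<lambda>s. (1 + s) * ln (1 + s)) has_real_derivative ln (1 + s) + 1) (at s)"
      using s by simp
    have "((\<lambda>s. (1 + s) powr z / (z * p)) has_real_derivative z * (1 + s) powr (z - 1) / (z * p)) (at s)"
      by (rule DERIV_cdivide[OF powr_one_plus_deriv[OF s]])
    then have 2: "((\<lambda>s. (1 + s) powr z / (z * p)) has_real_derivative (1 + s) powr p / p) (at s)"
      unfolding p_def using z by simp
    show ?thesis using DERIV_diff[OF 2 1] unfolding G_def G1_def by (simp add: algebra_simps)
  qed
  have dG1: "(G1 has_real_derivative G2 s) (at s)" if s: "-1 < s" for s
    using DERIV_diff[OF DERIV_diff[OF DERIV_cdivide[OF powr_one_plus_deriv[OF s], of p p] lnd[OF s]] DERIV_const[of 1]] p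
    unfolding G1_def G2_def by simp
  have inv: "((\<lambda>s. 1 / (1 + s)) has_real_derivative - 1 / (1 + s)\<^sup>2) (at s)" if "-1 < s" for s :: real
    using that by (auto intro!: derivative_eq_intros simp: power2_eq_square)
  have dG2: "(G2 has_real_derivative G3 s) (at s)" if s: "-1 < s" for s
    using DERIV_diff[OF powr_one_plus_deriv[OF s, of "p - 1"] inv[OF s]]
    unfolding G2_def G3_def by simp
  have dG3: "(G3 has_real_derivative (p - 1) * (p - 2) - 2) (at 0)"
  proof -
    have "((\<lambda>s::real. 1 / (1 + s)\<^sup>2) has_real_derivative - 2) (at 0)"
      by (auto intro!: derivative_eq_intros simp: power2_eq_square)
    from DERIV_add[OF DERIV_cmult[OF powr_one_plus_deriv[of 0 "p - 2"], of "p - 1"] this]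
    show ?thesis unfolding G3_def by simp
  qed
  have G_eq: "(1 + s) powr z / (z * (z - 1)) - (1 + s) * ln (1 + s) - 1 / (z * (z - 1)) = G s - G 0" for s
    by (simp add: G_def p_def)
  show ?thesis
  proof (cases "3 \<le> r")
    case True
    \<comment> \<open>Here \<open>k1\<close> and \<open>k2\<close> vanish at 0 while the third
      derivative of \<open>k\<close> there is \<open>6 * p\<close>; positivity is integrated back to
      \<open>k 0 < k t\<close>.\<close>
    define k where "k t = G (2 * t) + 2 * G ((-1) * t)" for t
    define k1 where "k1 t = 2 * (G1 (2 * t) - G1 ((-1) * t))" for t
    define k2 where "k2 t = 2 * (2 * G2 (2 * t) + G2 ((-1) * t))" for t
    have dk: "(k has_real_derivative k1 t) (at t)" if "0 \<le> t" "t < 1 / 2" for t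
    proof -
      have "(k has_real_derivative 2 * G1 (2 * t) + 2 * ((-1) * G1 ((-1) * t))) (at t)"
        unfolding k_def using that
        by (intro DERIV_add[OF DERIV_rescale[OF dG] DERIV_cmult[OF DERIV_rescale[OF dG]]]) auto
      then show ?thesis by (simp add: k1_def algebra_simps)
    qed
    have dk1: "(k1 has_real_derivative k2 t) (at t)" if "0 \<le> t" "t < 1 / 2" for t
    proof -
      have "(k1 has_real_derivative 2 * (2 * G2 (2 * t) - (-1) * G2 ((-1) * t))) (at t)"
        unfolding k1_def using that
        by (intro DERIV_cmult[OF DERIV_diff[OF DERIV_rescale[OF dG1] DERIV_rescale[OF dG1]]]) auto
      then show ?thesis by (simp add: k2_def algebra_simps)
    qed
    have "(k2 has_real_derivative 2 * (2 * (2 * G3 (2 * 0)) + (-1) * G3 ((-1) * 0))) (at 0)"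
      unfolding k2_def
      by (intro DERIV_cmult[OF DERIV_add[OF DERIV_cmult[OF DERIV_rescale[OF dG2]] DERIV_rescale[OF dG2]]]) auto
    moreover have "2 * (2 * (2 * G3 (2 * 0)) + (-1) * G3 ((-1) * 0)) = 6 * p" by (simp add: G3_def)
    ultimately have "(k2 has_real_derivative 6 * p) (at 0)" by simp
    from DERIV_pos_inc_right[OF this] p obtain d0 where d0: "0 < d0" "\<And>h. 0 < h \<Longrightarrow> h < d0 \<Longrightarrow> k2 0 < k2 h"
      by auto
    define d where "d = min d0 (1 / 2)"
    have d: "0 < d" "d < 1" "d \<le> 1 / 2" "d \<le> d0" using d0 by (auto simp: d_def)
    have k20: "k2 0 = 0" by (simp add: k2_def G2_def)
    have k1p: "0 < k1 t" if "0 < t" "t < d" for t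
      using greater_if_deriv_pos[of 0 d k1 k2 t] dk1 d0(2) d that k20 by (auto simp: k1_def)
    have kp: "k 0 < k t" if "0 < t" "t < d" for t
      using greater_if_deriv_pos[of 0 d k k1 t] dk k1p d that by auto
    show ?thesis
    proof (rule crit_below_spinodal[OF z _ d(1,2)])
      fix t assume t: "0 < t" "t < d"
      define s where "s i = (if i = 1 then 2 * t else if i \<in> {2, 3} then (-1) * t else 0)" for i :: nat
      have split: "{1..r} = {1, 2, 3} \<union> {4..r}" using True by auto
      have sum: "(\<Sum>i\<in>{1..r}. f (s i)) = f (2 * t) + 2 * f ((-1) * t) + (\<Sum>i\<in>{4..r}. f 0)" for f :: "real \<Rightarrow> real"
      proof -
        have "(\<Sum>i\<in>{1..r}. f (s i)) = (\<Sum>i\<in>{1, 2, 3}. f (s i)) + (\<Sum>i\<in>{4..r}. f (s i))"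
          unfolding split by (rule sum.union_disjoint) auto
        moreover have "(\<Sum>i\<in>{4..r}. f (s i)) = (\<Sum>i\<in>{4..r}. f 0)" by (intro sum.cong) (auto simp: s_def)
        ultimately show ?thesis by (simp add: s_def)
      qed
      have "(\<Sum>i\<in>{1..r}. s i) = 0" using sum[of "\<lambda>x. x"] by simp
      moreover have "0 < (\<Sum>i\<in>{1..r}. G (s i) - G 0)"
        unfolding sum[of "\<lambda>x. G x - G 0"] using kp[OF t] by (simp add: k_def)
      moreover have "-1 < s i" for i using t d by (simp add: s_def)
      ultimately show "\<exists>s. (\<forall>i\<in>{1..r}. -1 < s i) \<and> (\<Sum>i\<in>{1..r}. s i) = 0 \<and>
         0 < (\<Sum>i\<in>{1..r}. (1 + s i) powr z / (z * (z - 1)) - (1 + s i) * ln (1 + s i) - 1 / (z * (z - 1)))"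
        unfolding G_eq by (intro exI[of _ s]) auto
    qed (use True in simp)
  next
    case False
    then have r2: "r = 2" and z4: "4 < z" using r by auto
    \<comment> \<open>By symmetry the odd derivatives vanish at 0, and so does the second. The
      fourth is \<open>2 * (p * (p - 3))\<close>, positive because \<open>z > 4\<close> means
      \<open>p > 3\<close>.\<close>
    define k where "k t = G t + G ((-1) * t)" for t
    define k1 where "k1 t = G1 t - G1 ((-1) * t)" for t
    define k2 where "k2 t = G2 t + G2 ((-1) * t)" for t
    define k3 where "k3 t = G3 t - G3 ((-1) * t)" for t
    have dk: "(k has_real_derivative k1 t) (at t)" if "0 \<le> t" "t < 1 / 2" for t
    proof -
      have "(k has_real_derivative G1 t + (-1) * G1 ((-1) * t)) (at t)"
        unfolding k_def using that by (intro DERIV_add[OF dG DERIV_rescale[OF dG]]) auto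
      then show ?thesis by (simp add: k1_def)
    qed
    have dk1: "(k1 has_real_derivative k2 t) (at t)" if "0 \<le> t" "t < 1 / 2" for t
    proof -
      have "(k1 has_real_derivative G2 t - (-1) * G2 ((-1) * t)) (at t)"
        unfolding k1_def using that by (intro DERIV_diff[OF dG1 DERIV_rescale[OF dG1]]) auto
      then show ?thesis by (simp add: k2_def)
    qed
    have dk2: "(k2 has_real_derivative k3 t) (at t)" if "0 \<le> t" "t < 1 / 2" for t
    proof -
      have "(k2 has_real_derivative G3 t + (-1) * G3 ((-1) * t)) (at t)"
        unfolding k2_def using that by (intro DERIV_add[OF dG2 DERIV_rescale[OF dG2]]) auto
      then show ?thesis by (simp add: k3_def)
    qed
    have "(k3 has_real_derivative ((p - 1) * (p - 2) - 2) - (-1) * ((p - 1) * (p - 2) - 2)) (at 0)"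
      unfolding k3_def using dG3 by (intro DERIV_diff[OF dG3 DERIV_rescale]) auto
    moreover have "((p - 1) * (p - 2) - 2) - (-1) * ((p - 1) * (p - 2) - 2) = 2 * (p * (p - 3))"
      by (simp add: algebra_simps)
    ultimately have "(k3 has_real_derivative 2 * (p * (p - 3))) (at 0)" by simp
    from DERIV_pos_inc_right[OF this] p z4 obtain d0 where d0: "0 < d0" "\<And>h. 0 < h \<Longrightarrow> h < d0 \<Longrightarrow> k3 0 < k3 h"
      by auto
    define d where "d = min d0 (1 / 2)"
    have d: "0 < d" "d < 1" "d \<le> 1 / 2" "d \<le> d0" using d0 by (auto simp: d_def)
    have k2p: "0 < k2 t" if "0 < t" "t < d" for t
      using greater_if_deriv_pos[of 0 d k2 k3 t] dk2 d0(2) d that by (auto simp: k2_def k3_def G2_def)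
    have k1p: "0 < k1 t" if "0 < t" "t < d" for t
      using greater_if_deriv_pos[of 0 d k1 k2 t] dk1 k2p d that by (auto simp: k1_def)
    have kp: "k 0 < k t" if "0 < t" "t < d" for t
      using greater_if_deriv_pos[of 0 d k k1 t] dk k1p d that by auto
    show ?thesis
    proof (rule crit_below_spinodal[OF z _ d(1,2)])
      fix t assume t: "0 < t" "t < d"
      define s where "s i = (if i = 1 then t else (-1) * t)" for i :: nat
      have set: "{1..r} = {1, 2}" using r2 by auto
      have sum: "(\<Sum>i\<in>{1..r}. f (s i)) = f t + f ((-1) * t)" for f :: "real \<Rightarrow> real"
        unfolding set by (simp add: s_def)
      have "(\<Sum>i\<in>{1..r}. s i) = 0" using sum[of "\<lambda>x. x"] by simp
      moreover have "0 < (\<Sum>i\<in>{1..r}. G (s i) - G 0)"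
        unfolding sum[of "\<lambda>x. G x - G 0"] using kp[OF t] by (simp add: k_def)
      moreover have "-1 < s i" for i using t d by (simp add: s_def)
      ultimately show "\<exists>s. (\<forall>i\<in>{1..r}. -1 < s i) \<and> (\<Sum>i\<in>{1..r}. s i) = 0 \<and>
         0 < (\<Sum>i\<in>{1..r}. (1 + s i) powr z / (z * (z - 1)) - (1 + s i) * ln (1 + s i) - 1 / (z * (z - 1)))"
        unfolding G_eq by (intro exI[of _ s]) auto
    qed (use r2 in simp)
  qed
qed

text \<open>Danskin's theorem. Points whose energy is \<open>e / 2\<close> away from
  \<open>\<sigma>\<close> are suboptimal at \<open>b\<close> by some \<open>g\<close>, hence not
  maximal at nearby \<open>b'\<close>; so maximisers at \<open>b'\<close> have energy near
  \<open>\<sigma>\<close> and squeeze the difference quotient. Asking for a common energy instead of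
  a single maximiser accommodates the permutation symmetry.\<close>

lemma max_free_energy_deriv:
  assumes z: "1 < z" and r: "1 \<le> r"
    and \<sigma>: "\<And>x. x \<in> prob_simplex r \<Longrightarrow> free_energy z r b x = max_free_energy z r b \<Longrightarrow> energy z r x = \<sigma>"
  shows "(max_free_energy z r has_real_derivative \<sigma>) (at b)"
  unfolding has_field_derivative_iff
proof (rule LIM_I)
  fix e :: real assume e: "0 < e"
  let ?M = "max_free_energy z r"
  obtain x0 where x0: "x0 \<in> prob_simplex r" "free_energy z r b x0 = ?M b"
    using max_free_energy_attained(1)[OF z r] by blast
  define K where "K = prob_simplex r \<inter> (\<lambda>x. \<bar>energy z r x - \<sigma>\<bar>) -` {e / 2..}"
  have "closed K" unfolding K_def
    by (intro continuous_closed_preimage closed_atLeast compact_imp_closed[OF compact_prob_simplex]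
        continuous_on_rabs continuous_on_diff continuous_on_const continuous_on_energy z)
  then have "compact (prob_simplex r \<inter> K)" by (intro compact_Int_closed compact_prob_simplex)
  then have K: "compact K" by (simp add: K_def Int_assoc[symmetric])
  have "\<exists>g>0. \<forall>x\<in>K. free_energy z r b x \<le> ?M b - g"
  proof (cases "K = {}")
    case False
    have "continuous_on K (free_energy z r b)"
      by (rule continuous_on_subset[OF continuous_on_free_energy[OF z]]) (simp add: K_def)
    from continuous_attains_sup[OF K False this]
    obtain x where x: "x \<in> K" "\<And>y. y \<in> K \<Longrightarrow> free_energy z r b y \<le> free_energy z r b x" by blast
    have "free_energy z r b x \<noteq> ?M b" using \<sigma>[of x] x(1) e by (auto simp: K_def)
    then have "free_energy z r b x < ?M b"
      using max_free_energy_attained(2)[OF z r, of x b] x(1) by (auto simp: K_def)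
    then show ?thesis using x(2) by (intro exI[of _ "?M b - free_energy z r b x"]) auto
  qed (auto intro: exI[of _ 1])
  then obtain g where g: "0 < g" "\<And>x. x \<in> K \<Longrightarrow> free_energy z r b x \<le> ?M b - g" by blast
  show "\<exists>s>0. \<forall>b'. b' \<noteq> b \<and> norm (b' - b) < s \<longrightarrow> norm ((?M b' - ?M b) / (b' - b) - \<sigma>) < e"
  proof (intro exI conjI allI impI)
    \<comment> \<open>Half of the gap, because the maximum and the energy term each move by at most
      \<open>\<bar>b' - b\<bar>\<close>.\<close>
    show "0 < g / 2" using g by simp
    fix b' assume b': "b' \<noteq> b \<and> norm (b' - b) < g / 2"
    obtain x where x: "x \<in> prob_simplex r" "free_energy z r b' x = ?M b'"
      using max_free_energy_attained(1)[OF z r] by blast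
    have "energy z r x \<le> 1 / z" by (rule energy_le[OF z x(1)])
    also have "\<dots> \<le> 1" using z by simp
    finally have "\<bar>(b' - b) * energy z r x\<bar> \<le> \<bar>b' - b\<bar>"
      using energy_nonneg[of z r x] z by (simp add: abs_mult mult_left_le)
    moreover have "\<bar>?M b' - ?M b\<bar> \<le> \<bar>b' - b\<bar>" by (rule max_free_energy_Lipschitz[OF z r])
    moreover have "free_energy z r b x = ?M b' - (b' - b) * energy z r x"
      unfolding x(2)[symmetric] by (simp add: free_energy_def algebra_simps)
    ultimately have "?M b - g < free_energy z r b x" using b' unfolding real_norm_def by linarith
    then have "x \<notin> K" using g(2)[of x] by auto
    then have ex: "\<bar>energy z r x - \<sigma>\<bar> < e / 2" using x(1) by (simp add: K_def)
    have "?M b' - (b' - b) * energy z r x \<le> ?M b"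
      unfolding \<open>free_energy z r b x = _\<close>[symmetric] by (rule max_free_energy_attained(2)[OF z r x(1)])
    moreover have "?M b + (b' - b) * \<sigma> \<le> ?M b'"
    proof -
      have "?M b + (b' - b) * \<sigma> = free_energy z r b' x0"
        unfolding x0(2)[symmetric] \<sigma>[OF x0, symmetric] by (simp add: free_energy_def algebra_simps)
      then show ?thesis using max_free_energy_attained(2)[OF z r x0(1), of b'] by simp
    qed
    ultimately have "\<bar>?M b' - ?M b - (b' - b) * \<sigma>\<bar> \<le> \<bar>(b' - b) * (energy z r x - \<sigma>)\<bar>"
      by (simp add: right_diff_distrib)
    also have "\<dots> \<le> \<bar>b' - b\<bar> * (e / 2)" unfolding abs_mult using ex by (intro mult_left_mono) auto
    finally have "\<bar>?M b' - ?M b - (b' - b) * \<sigma>\<bar> / \<bar>b' - b\<bar> \<le> e / 2"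
      using b' by (simp add: divide_le_eq mult.commute)
    moreover have "(?M b' - ?M b) / (b' - b) - \<sigma> = (?M b' - ?M b - (b' - b) * \<sigma>) / (b' - b)"
      using b' by (simp add: diff_divide_distrib)
    ultimately have "norm ((?M b' - ?M b) / (b' - b) - \<sigma>) \<le> e / 2" by (simp only: real_norm_def abs_divide)
    then show "norm ((?M b' - ?M b) / (b' - b) - \<sigma>) < e" using e by linarith
  qed
qed

text \<open>The bound \<open>p \<le> 3\<close>, that is \<open>z \<le> 4\<close>, enters twice:
  \<open>\<psi> 1 = 3 - p\<close> is nonnegative, and \<open>t - (p - 2)\<close> is positive for
  \<open>t > 1\<close>. The inequality is what makes the second derivative of the two-state free
  energy change sign at most once on each side of \<open>1 / 2\<close>.\<close>

lemma powr_ratio_inequality: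
  fixes p w :: real
  assumes p: "1 < p" "p \<le> 3" and w: "1 < w"
  shows "0 < w powr p - 1 - p * w powr (p - 1) + p * w"
proof -
  define \<psi> where "\<psi> t = t powr (p - 1) - (p - 1) * t powr (p - 2) + 1" for t
  define \<phi> where "\<phi> t = t powr p - 1 - p * t powr (p - 1) + p * t" for t
  have d\<psi>: "(\<psi> has_real_derivative (p - 1) * t powr (p - 3) * (t - (p - 2))) (at t)" if t: "0 < t" for t
  proof -
    have "(\<psi> has_real_derivative (p - 1) * t powr (p - 1 - 1) - (p - 1) * ((p - 2) * t powr (p - 2 - 1)) + 0) (at t)"
      unfolding \<psi>_def by (intro DERIV_add DERIV_diff DERIV_cmult DERIV_const has_real_derivative_powr t)
    moreover have "t powr (p - 1 - 1) = t powr (p - 3) * t" using t powr_add[of t "p - 3" 1] by simp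
    ultimately show ?thesis by (simp add: algebra_simps)
  qed
  have d\<phi>: "(\<phi> has_real_derivative p * \<psi> t) (at t)" if t: "0 < t" for t
  proof -
    have "(\<phi> has_real_derivative p * t powr (p - 1) - 0 - p * ((p - 1) * t powr (p - 1 - 1)) + p * 1) (at t)"
      unfolding \<phi>_def by (intro DERIV_add DERIV_diff DERIV_cmult DERIV_const DERIV_ident has_real_derivative_powr t)
    then show ?thesis by (simp add: \<psi>_def algebra_simps)
  qed
  have "0 < \<psi> t" if t: "1 < t" for t
  proof -
    have "\<psi> 1 < \<psi> t"
    proof (rule greater_if_deriv_pos[of 1 "t + 1", OF _ d\<psi>])
      fix s assume "1 < s" "s < t + 1"
      then show "0 < (p - 1) * s powr (p - 3) * (s - (p - 2))" using p by simp
    qed (use t in auto)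
    then show ?thesis using p by (simp add: \<psi>_def)
  qed
  then have "\<phi> 1 < \<phi> w"
    using p w by (intro greater_if_deriv_pos[of 1 "w + 1" \<phi>, OF _ d\<phi>]) auto
  then show ?thesis by (simp add: \<phi>_def)
qed

text \<open>With \<open>a\<close> the larger coordinate, \<open>f\<close> has derivative
  \<open>h\<close>, and the derivative of \<open>h\<close> has the sign of
  \<open>b * p * M a - 1\<close>, where \<open>M\<close> is strictly decreasing. So \<open>h\<close>
  first increases and then decreases. It vanishes at \<open>1 / 2\<close> and at the interior
  maximiser \<open>a2\<close>, hence is positive in between, and \<open>f a1 < f a2\<close>.\<close>

lemma two_state_unique_maximizer:
  fixes b z :: real
  assumes z: "2 < z" "z \<le> 4" and b: "0 \<le> b"
  defines "f \<equiv> \<lambda>a. b / z * a powr z - a * ln a + (b / z * (1 - a) powr z - (1 - a) * ln (1 - a))"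
  assumes a1: "1 / 2 \<le> a1" "a1 \<le> 1" "\<And>a. a \<in> {0..1} \<Longrightarrow> f a \<le> f a1"
    and a2: "1 / 2 \<le> a2" "a2 \<le> 1" "\<And>a. a \<in> {0..1} \<Longrightarrow> f a \<le> f a2"
    and lt: "a1 < a2"
  shows False
proof -
  define p where "p = z - 1"
  have p: "1 < p" "p \<le> 3" using z by (auto simp: p_def)
  define h where "h a = b * a powr p - ln a - (b * (1 - a) powr p - ln (1 - a))" for a
  define M where "M a = a powr p * (1 - a) + (1 - a) powr p * a" for a :: real
  have g: "((\<lambda>y. b / z * y powr z - y * ln y) has_real_derivative b * y powr p - ln y - 1) (at y)" if "0 < y" for y
    unfolding p_def using free_energy_summand_deriv[OF that] z by simp
  have om: "((\<lambda>a. 1 - a) has_real_derivative - 1) (at a)" for a :: real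
    by (auto intro!: derivative_eq_intros)
  have df: "(f has_real_derivative h a) (at a)" if a: "0 < a" "a < 1" for a
  proof -
    have "0 < 1 - a" using a by simp
    from DERIV_add[OF g[OF a(1)] DERIV_chain2[OF g[OF this] om]]
    show ?thesis unfolding f_def h_def by (simp add: algebra_simps)
  qed
  have dh: "(h has_real_derivative (b * p * M a - 1) / (a * (1 - a))) (at a)" if a: "0 < a" "a < 1" for a
  proof -
    have a1: "0 < 1 - a" using a by simp
    have 1: "((\<lambda>y. b * y powr p - ln y) has_real_derivative b * (p * y powr (p - 1)) - 1 / y) (at y)" if "0 < y" for y
      using that by (intro DERIV_diff DERIV_cmult has_real_derivative_powr DERIV_ln_divide)
    have "(h has_real_derivative (b * (p * a powr (p - 1)) - 1 / a) - (b * (p * (1 - a) powr (p - 1)) - 1 / (1 - a)) * (- 1)) (at a)"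
      unfolding h_def by (rule DERIV_diff[OF 1[OF a(1)] DERIV_chain2[OF 1[OF a1] om]])
    moreover have "(b * (p * a powr (p - 1)) - 1 / a) - (b * (p * (1 - a) powr (p - 1)) - 1 / (1 - a)) * (- 1)
        = (b * p * M a - 1) / (a * (1 - a))"
    proof -
      have e: "a powr p = a * a powr (p - 1)" "(1 - a) powr p = (1 - a) * (1 - a) powr (p - 1)"
        using powr_add[of a 1 "p - 1"] powr_add[of "1 - a" 1 "p - 1"] a by auto
      show ?thesis unfolding M_def e using a a1 by (simp add: divide_simps) (simp add: algebra_simps)
    qed
    ultimately show ?thesis by simp
  qed
  have M_dec: "M t < M s" if st: "1 / 2 \<le> s" "s < t" "t < 1" for s t
  proof (rule DERIV_neg_imp_decreasing_open[OF st(2)])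
    have dM: "(M has_real_derivative p * a powr (p - 1) * (1 - a) - a powr p - (p * (1 - a) powr (p - 1) * a - (1 - a) powr p)) (at a)"
      if a: "0 < a" "a < 1" for a
    proof -
      have a1: "0 < 1 - a" using a by simp
      have "(M has_real_derivative (p * a powr (p - 1)) * (1 - a) + (- 1) * a powr p
          + ((p * (1 - a) powr (p - 1) * (- 1)) * a + 1 * (1 - a) powr p)) (at a)"
        unfolding M_def
        by (rule DERIV_add[OF DERIV_mult[OF has_real_derivative_powr[OF a(1)] om]
              DERIV_mult[OF DERIV_chain2[OF has_real_derivative_powr[OF a1] om] DERIV_ident]])
      then show ?thesis by (simp add: algebra_simps)
    qed
    show "continuous_on {s..t} M"
      by (rule DERIV_atLeastAtMost_imp_continuous_on, rule exI, rule dM) (use st in auto)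
    fix a assume a: "s < a" "a < t"
    have a0: "0 < a" "0 < 1 - a" "a < 1" using a st by auto
    \<comment> \<open>The derivative of \<open>M\<close> is homogeneous of degree \<open>p\<close>
      in \<open>a\<close> and \<open>1 - a\<close>; up to the factor \<open>(1 - a) powr p\<close>
      it depends on their quotient only.\<close>
    define w where "w = a / (1 - a)"
    have w: "1 < w" using a st a0 by (simp add: w_def)
    have e: "a = (1 - a) * w" using a0 by (simp add: w_def)
    have pw: "a powr u = (1 - a) powr u * w powr u" for u
      by (subst e) (use a0 w in \<open>simp add: powr_mult\<close>)
    have q: "(1 - a) powr p = (1 - a) powr (p - 1) * (1 - a)"
      using a0 powr_add[of "1 - a" "p - 1" 1] by simp
    have "p * a powr (p - 1) * (1 - a) - a powr p - (p * (1 - a) powr (p - 1) * a - (1 - a) powr p)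
        = - ((1 - a) powr p * (w powr p - 1 - p * w powr (p - 1) + p * w))"
    proof -
      have Y: "p * (1 - a) powr (p - 1) * a = p * (1 - a) powr p * w"
        unfolding q using a0 by (simp add: w_def)
      have X: "p * a powr (p - 1) * (1 - a) = p * (1 - a) powr p * w powr (p - 1)"
        unfolding pw q by simp
      show ?thesis unfolding X Y pw[of p] by (simp only: right_diff_distrib distrib_left) simp
    qed
    also have "\<dots> < 0" using powr_ratio_inequality[OF p w] a0 by simp
    finally show "\<exists>y. (M has_real_derivative y) (at a) \<and> y < 0" using dM[OF a0(1,3)] by blast
  qed
  have cf: "continuous_on {0..1} f"
  proof -
    have c: "continuous_on {0..1} (\<lambda>y. b / z * y powr z - y * ln y)"
      using z by (intro continuous_on_diff continuous_on_xlnx continuous_on_mult continuous_on_const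
          continuous_on_powr' continuous_on_id) auto
    then have "continuous_on {0..1} (\<lambda>a. b / z * (1 - a) powr z - (1 - a) * ln (1 - a))"
      by (rule continuous_on_compose2) (auto intro!: continuous_intros)
    with c show ?thesis unfolding f_def by (rule continuous_on_add)
  qed
  have a2lt: "a2 < 1"
  proof (rule ccontr)
    assume "\<not> a2 < 1"
    then have a21: "a2 = 1" using a2 by simp
    \<comment> \<open>The logarithmic slope of the entropy excludes the pure state: beyond
      \<open>s\<close>, \<open>ln (1 - a) < - b - 1 - ln 2\<close> outweighs the bounds
      \<open>b\<close> and \<open>ln 2\<close> for the positive terms of \<open>h\<close>.\<close>
    define s where "s = 1 - exp (- b - 1) / 2"
    have s: "1 / 2 < s" "s < 1"
    proof -
      have "exp (- b - 1) < 1" using b by simp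
      then show "1 / 2 < s" by (simp add: s_def)
    qed (simp add: s_def)
    have "f 1 < f s"
    proof (rule DERIV_neg_imp_decreasing_open[OF s(2)])
      show "continuous_on {s..1} f" using s by (intro continuous_on_subset[OF cf]) auto
      fix a assume a: "s < a" "a < 1"
      have "a powr p \<le> 1" using a s p powr_mono2[of p a 1] by simp
      then have "b * a powr p \<le> b" using b by (simp add: mult_left_le)
      moreover have "0 \<le> b * (1 - a) powr p" using b by simp
      moreover have "ln (1 - a) < - b - 1 - ln 2"
      proof -
        have "ln (1 - a) < ln (exp (- b - 1) / 2)" using a s by (subst ln_less_cancel_iff) (auto simp: s_def)
        then show ?thesis by (simp add: ln_div)
      qed
      moreover have "- ln a \<le> ln 2"
      proof -
        have "ln (1 / 2) \<le> ln a" using a s by (subst ln_le_cancel_iff) auto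
        then show ?thesis by (simp add: ln_div)
      qed
      ultimately have "h a < 0" by (simp add: h_def)
      then show "\<exists>y. (f has_real_derivative y) (at a) \<and> y < 0" using df[of a] a s by auto
    qed
    then show False using a2(3)[of s] s a21 by simp
  qed
  have a2pos: "1 / 2 < a2" using a1 lt by simp
  have h2: "h a2 = 0"
  proof (rule DERIV_local_max[OF df])
    show "0 < min a2 (1 - a2)" using a2lt a2pos by simp
    show "\<forall>y. \<bar>a2 - y\<bar> < min a2 (1 - a2) \<longrightarrow> f y \<le> f a2" by (auto intro!: a2(3))
  qed (use a2lt a2pos in auto)
  have hh: "h (1 / 2) = 0" by (simp add: h_def)
  have "\<exists>\<xi>. 1 / 2 < \<xi> \<and> \<xi> < a2 \<and> (h has_real_derivative 0) (at \<xi>)"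
  proof (rule Rolle[OF a2pos])
    show "h (1 / 2) = h a2" using hh h2 by simp
    show "continuous_on {1 / 2..a2} h"
      by (rule DERIV_atLeastAtMost_imp_continuous_on, rule exI, rule dh) (use a2lt in auto)
    show "h differentiable (at a)" if "1 / 2 < a" "a < a2" for a
      using dh[of a] that a2lt real_differentiable_def by force
  qed
  then obtain \<xi> where \<xi>: "1 / 2 < \<xi>" "\<xi> < a2" "(h has_real_derivative 0) (at \<xi>)" by blast
  have "(b * p * M \<xi> - 1) / (\<xi> * (1 - \<xi>)) = 0"
    using DERIV_unique[OF dh \<xi>(3)] \<xi> a2lt by auto
  then have M1: "b * p * M \<xi> = 1" using \<xi> a2lt by simp
  then have bp: "0 < b * p" using b p by (cases "b = 0") auto
  have hpos: "0 < h a" if a: "1 / 2 < a" "a < a2" for a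
  proof (cases "a \<le> \<xi>")
    case True
    have "h (1 / 2) < h a"
    proof (rule DERIV_pos_imp_increasing_open[OF a(1)])
      show "continuous_on {1 / 2..a} h"
        by (rule DERIV_atLeastAtMost_imp_continuous_on, rule exI, rule dh) (use a a2lt in auto)
      fix t assume t: "1 / 2 < t" "t < a"
      have "M \<xi> < M t" using t True \<xi> a2lt by (intro M_dec) auto
      from mult_strict_left_mono[OF this bp] have "b * p * M \<xi> < b * p * M t" .
      then have "0 < (b * p * M t - 1) / (t * (1 - t))" using M1 t a a2lt by simp
      then show "\<exists>y. (h has_real_derivative y) (at t) \<and> 0 < y" using dh[of t] t a a2lt by auto
    qed
    then show ?thesis using hh by simp
  next
    case False
    have "h a2 < h a"
    proof (rule DERIV_neg_imp_decreasing_open[OF a(2)])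
      show "continuous_on {a..a2} h"
        by (rule DERIV_atLeastAtMost_imp_continuous_on, rule exI, rule dh) (use a a2lt in auto)
      fix t assume t: "a < t" "t < a2"
      have "M t < M \<xi>" using t False \<xi> a2lt by (intro M_dec) auto
      from mult_strict_left_mono[OF this bp] have "b * p * M t < b * p * M \<xi>" .
      then have "(b * p * M t - 1) / (t * (1 - t)) < 0" using M1 t a a2lt by (intro divide_neg_pos) auto
      then show "\<exists>y. (h has_real_derivative y) (at t) \<and> y < 0" using dh[of t] t a a2lt by auto
    qed
    then show ?thesis using h2 by simp
  qed
  have "f a1 < f a2"
  proof (rule DERIV_pos_imp_increasing_open[OF lt])
    show "continuous_on {a1..a2} f" using a1 a2 by (intro continuous_on_subset[OF cf]) auto
    show "\<exists>y. (f has_real_derivative y) (at t) \<and> 0 < y" if "a1 < t" "t < a2" for t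
      using df[of t] hpos[of t] that a1 a2lt by auto
  qed
  then show False using a1(3)[of a2] a2 by simp
qed

lemma two_state_max_free_energy_deriv:
  assumes z: "2 < z" "z \<le> 4" and b: "0 \<le> b"
  shows "\<exists>\<sigma>. (max_free_energy z 2 has_real_derivative \<sigma>) (at b)"
proof -
  have z1: "1 < z" using z by simp
  define f where "f a = b / z * a powr z - a * ln a + (b / z * (1 - a) powr z - (1 - a) * ln (1 - a))" for a
  define e where "e a = (a powr z + (1 - a) powr z) / z" for a
  have set: "{1..2} = {1, 2::nat}" by auto
  have F: "free_energy z 2 b x = f (max (x 1) (x 2))" and E: "energy z 2 x = e (max (x 1) (x 2))"
    and mx: "1 / 2 \<le> max (x 1) (x 2)" "max (x 1) (x 2) \<le> 1" if x: "x \<in> prob_simplex 2" for x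
  proof -
    have s: "x 1 + x 2 = 1" using prob_simplexD(4)[OF x] unfolding set by simp
    then have o: "x 2 = 1 - x 1" by simp
    have m: "max (x 1) (x 2) = x 1 \<or> max (x 1) (x 2) = 1 - x 1" using o by (auto simp: max_def)
    have sf: "f (1 - a) = f a" and se: "e (1 - a) = e a" for a by (simp_all add: f_def e_def)
    have "free_energy z 2 b x = f (x 1)"
      unfolding free_energy_def energy_def entropy_def f_def set by (simp add: o algebra_simps add_divide_distrib)
    then show "free_energy z 2 b x = f (max (x 1) (x 2))" using m sf[of "x 1"] by metis
    have "energy z 2 x = e (x 1)" unfolding energy_def e_def set by (simp add: o)
    then show "energy z 2 x = e (max (x 1) (x 2))" using m se[of "x 1"] by metis
    show "1 / 2 \<le> max (x 1) (x 2)" using s by simp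
    show "max (x 1) (x 2) \<le> 1" using prob_simplexD(2)[OF x] by simp
  qed
  have fa: "f a \<le> max_free_energy z 2 b" if "a \<in> {0..1}" for a
  proof -
    define x where "x i = (if i = 1 then a else if i = 2 then 1 - a else 0)" for i :: nat
    have "sum x {1..2} = 1" unfolding set by (simp add: x_def)
    then have x: "x \<in> prob_simplex 2" using that by (auto simp: prob_simplex_def x_def)
    have "free_energy z 2 b x = f a"
      unfolding F[OF x] by (simp add: x_def max_def f_def)
    then show ?thesis using max_free_energy_attained(2)[OF z1 _ x, of b] by simp
  qed
  obtain x0 where x0: "x0 \<in> prob_simplex 2" "free_energy z 2 b x0 = max_free_energy z 2 b"
    using max_free_energy_attained(1)[OF z1, of 2] by auto
  have "energy z 2 x = energy z 2 x0" if x: "x \<in> prob_simplex 2" "free_energy z 2 b x = max_free_energy z 2 b" for x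
  proof -
    let ?a = "max (x 1) (x 2)" and ?c = "max (x0 1) (x0 2)"
    have m: "f a \<le> f ?a" "f a \<le> f ?c" if "a \<in> {0..1}" for a
      using fa[OF that] x(2) x0(2) F[OF x(1)] F[OF x0(1)] by auto
    have "\<not> ?a < ?c"
      using two_state_unique_maximizer[OF z b mx[OF x(1)] _ mx[OF x0(1)], folded f_def] m by blast
    moreover have "\<not> ?c < ?a"
      using two_state_unique_maximizer[OF z b mx[OF x0(1)] _ mx[OF x(1)], folded f_def] m by blast
    ultimately have "?a = ?c" by linarith
    then have "e ?a = e ?c" by (rule arg_cong)
    then show ?thesis using E[OF x(1)] E[OF x0(1)] by (simp only:)
  qed
  then show ?thesis using max_free_energy_deriv[OF z1, of 2 b "energy z 2 x0"] by auto
qed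

lemma pressure_deriv_two_states:
  assumes z: "2 < z" "z \<le> 4" and \<beta>: "0 \<le> \<beta>" and v: "0 < v"
  shows "\<exists>l. (pressure z \<beta> 2 has_real_derivative l) (at v)"
proof -
  obtain \<sigma> where "(max_free_energy z 2 has_real_derivative \<sigma>) (at (\<beta> * v powr (z - 1)))"
    using two_state_max_free_energy_deriv[OF z, of "\<beta> * v powr (z - 1)"] \<beta> by auto
  moreover have "((\<lambda>v. \<beta> * v powr (z - 1)) has_real_derivative \<beta> * ((z - 1) * v powr (z - 1 - 1))) (at v)"
    by (intro DERIV_cmult has_real_derivative_powr v)
  ultimately have "((\<lambda>v. max_free_energy z 2 (\<beta> * v powr (z - 1))) has_real_derivative
      \<sigma> * (\<beta> * ((z - 1) * v powr (z - 1 - 1)))) (at v)" by (rule DERIV_chain2)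
  from DERIV_mult[OF DERIV_ident this] show ?thesis unfolding pressure_def by blast
qed

section \<open>Gaussian bounds\<close>

text \<open>Second-order Taylor bound, phrased as convexity of the difference;
  \<open>z \<ge> 2\<close> lets the second derivative be bounded by its value at the right end
  \<open>h\<close>.\<close>

lemma powr_quadratic_bound:
  fixes y a z h l :: real
  assumes z: "2 \<le> z" and l: "0 < l" and a: "l \<le> a" "a \<le> h" and y: "l \<le> y" "y \<le> h"
  shows "y powr z / z \<le> a powr z / z + a powr (z - 1) * (y - a) + (z - 1) * h powr (z - 2) / 2 * (y - a)\<^sup>2"
proof -
  let ?B = "(z - 1) * h powr (z - 2)"
  let ?f = "\<lambda>t. ?B / 2 * (t - a)\<^sup>2 - t powr z / z" and ?f' = "\<lambda>t. ?B * (t - a) - t powr (z - 1)"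
    and ?f'' = "\<lambda>t. ?B - (z - 1) * t powr (z - 1 - 1)"
  have "?f' a * (y - a) \<le> ?f y - ?f a"
  proof (rule f''_imp_f'[of "{l..h}" ?f ?f' ?f''])
    fix t assume t: "t \<in> {l..h}"
    then have t0: "0 < t" using l by simp
    have "((\<lambda>t. (t - a)\<^sup>2) has_real_derivative 2 * (t - a)) (at t)"
      by (auto intro!: derivative_eq_intros)
    moreover have "((\<lambda>t. t powr z / z) has_real_derivative z * t powr (z - 1) / z) (at t)"
      by (rule DERIV_cdivide[OF has_real_derivative_powr[OF t0]])
    ultimately have "(?f has_real_derivative ?B / 2 * (2 * (t - a)) - z * t powr (z - 1) / z) (at t)"
      by (intro DERIV_diff[OF DERIV_cmult])
    moreover have "b / 2 * (2 * c) - z * x / z = b * c - x" for b c x :: real using z by simp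
    ultimately show "(?f has_real_derivative ?f' t) (at t)" by (simp only:)
    have "((\<lambda>t. t - a) has_real_derivative 1) (at t)" by (auto intro!: derivative_eq_intros)
    from DERIV_diff[OF DERIV_cmult[OF this, of ?B] has_real_derivative_powr[OF t0, of "z - 1"]]
    show "(?f' has_real_derivative ?f'' t) (at t)" by simp
    have "t powr (z - 2) \<le> h powr (z - 2)" using t t0 z by (intro powr_mono2) auto
    then have "(z - 1) * t powr (z - 2) \<le> ?B" using z by (intro mult_left_mono) auto
    then show "0 \<le> ?f'' t" by simp
  qed (use a y in auto)
  then show ?thesis by simp
qed

lemma exp_quadratic_bound:
  fixes x e :: real
  assumes e: "0 < e" and x: "x \<le> ln (1 + e)"
  shows "exp x \<le> 1 + x + (1 + e) / 2 * x\<^sup>2"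
proof -
  let ?f = "\<lambda>t. (1 + e) / 2 * t\<^sup>2 - exp t" and ?f' = "\<lambda>t. (1 + e) * t - exp t" and ?f'' = "\<lambda>t. (1 + e) - exp t"
  have "?f' 0 * (x - 0) \<le> ?f x - ?f 0"
  proof (rule f''_imp_f'[of "{..ln (1 + e)}" ?f ?f' ?f''])
    fix t assume t: "t \<in> {..ln (1 + e)}"
    have "((\<lambda>t. t\<^sup>2) has_real_derivative 2 * t) (at t)" by (auto intro!: derivative_eq_intros)
    from DERIV_diff[OF DERIV_cmult[OF this, of "(1 + e) / 2"] DERIV_exp]
    show "(?f has_real_derivative ?f' t) (at t)" by simp
    from DERIV_diff[OF DERIV_cmult[OF DERIV_ident, of "1 + e"] DERIV_exp]
    show "(?f' has_real_derivative ?f'' t) (at t)" by simp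
    have "exp t \<le> exp (ln (1 + e))" using t by simp
    then show "0 \<le> ?f'' t" using e by simp
  qed (use e x in auto)
  then show ?thesis by simp
qed

text \<open>The bound must not depend on \<open>K\<close>: \<open>j \<le> j\<^sup>2\<close> for
  naturals reduces both halves to a geometric series.\<close>

lemma sum_exp_minus_square_le:
  fixes w :: real
  assumes w: "0 < w"
  shows "(\<Sum>k\<in>{-K..K::int}. exp (- w * (real_of_int k)\<^sup>2)) \<le> 2 / (1 - exp (- w))"
proof -
  let ?f = "\<lambda>k::int. exp (- w * (real_of_int k)\<^sup>2)"
  define m where "m = nat K"
  have "{-K..K} \<subseteq> int ` {..m} \<union> (\<lambda>j. - int j) ` {..m}"
  proof
    fix k assume k: "k \<in> {-K..K}"
    show "k \<in> int ` {..m} \<union> (\<lambda>j. - int j) ` {..m}"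
    proof (cases "0 \<le> k")
      case True
      then have "k = int (nat k)" "nat k \<in> {..m}" using k by (auto simp: m_def)
      then show ?thesis by blast
    next
      case False
      then have "k = - int (nat (- k))" "nat (- k) \<in> {..m}" using k by (auto simp: m_def)
      then show ?thesis by blast
    qed
  qed
  then have "(\<Sum>k\<in>{-K..K}. ?f k) \<le> (\<Sum>k\<in>int ` {..m} \<union> (\<lambda>j. - int j) ` {..m}. ?f k)"
    by (intro sum_mono2) auto
  also have "\<dots> \<le> (\<Sum>k\<in>int ` {..m}. ?f k) + (\<Sum>k\<in>(\<lambda>j. - int j) ` {..m}. ?f k)"
    by (subst sum_Un) (auto intro!: sum_nonneg)
  also have "\<dots> = 2 * (\<Sum>j\<le>m. exp (- w * (real j)\<^sup>2))"
    by (simp add: sum.reindex inj_on_def)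
  also have "\<dots> \<le> 2 * (\<Sum>j\<le>m. exp (- w) ^ j)"
  proof (intro mult_left_mono sum_mono)
    fix j :: nat
    have "real j \<le> (real j)\<^sup>2" by (cases j) (auto simp: power2_eq_square)
    then have "exp (- w * (real j)\<^sup>2) \<le> exp (real j * (- w))" using w by simp
    then show "exp (- w * (real j)\<^sup>2) \<le> exp (- w) ^ j" by (simp only: exp_of_nat_mult)
  qed simp
  also have "(\<Sum>j\<le>m. exp (- w) ^ j) \<le> 1 / (1 - exp (- w))"
  proof -
    have s: "summable (\<lambda>j. exp (- w) ^ j)" using w by (intro summable_geometric) simp
    have "(\<Sum>j\<le>m. exp (- w) ^ j) \<le> (\<Sum>j. exp (- w) ^ j)"
      using sum_le_suminf[OF s, of "{..m}"] by simp
    also have "\<dots> = 1 / (1 - exp (- w))" using w by (intro suminf_geometric) simp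
    finally show ?thesis .
  qed
  finally show ?thesis by simp
qed

text \<open>A sub-Gaussian bound for one uniformly distributed state. After centring at the mean
  \<open>\<mu>\<close> the exponents are at most \<open>2 * \<eta> \<le> ln (1 + e)\<close>, where
  \<open>exp\<close> lies below its quadratic Taylor polynomial enlarged by \<open>1 + e\<close>;
  the variance is then bounded by the second moment.\<close>

lemma sum_exp_tilt_le:
  fixes t :: "nat \<Rightarrow> real"
  assumes r: "1 \<le> r" and e: "0 < e" and \<eta>: "2 * \<eta> \<le> ln (1 + e)" and t: "\<And>i. i \<in> {1..r} \<Longrightarrow> \<bar>t i\<bar> \<le> \<eta>"
  shows "exp (- (\<Sum>i\<in>{1..r}. t i) / real r) * (\<Sum>i\<in>{1..r}. exp (t i))
       \<le> real r * exp ((1 + e) / (2 * real r) * (\<Sum>i\<in>{1..r}. (t i)\<^sup>2))"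
proof -
  define \<mu> where "\<mu> = (\<Sum>i\<in>{1..r}. t i) / real r"
  have r0: "0 < real r" using r by simp
  have s\<mu>: "(\<Sum>i\<in>{1..r}. t i) = real r * \<mu>" using r0 by (simp add: \<mu>_def)
  have "\<bar>\<Sum>i\<in>{1..r}. t i\<bar> \<le> (\<Sum>i\<in>{1..r}. \<bar>t i\<bar>)" by (rule sum_abs)
  also have "\<dots> \<le> (\<Sum>i\<in>{1..r}. \<eta>)" by (intro sum_mono t)
  finally have "real r * \<bar>\<mu>\<bar> \<le> real r * \<eta>" unfolding s\<mu> by (simp add: abs_mult)
  then have \<mu>: "\<bar>\<mu>\<bar> \<le> \<eta>" using r0 by simp
  have "exp (- (\<Sum>i\<in>{1..r}. t i) / real r) * (\<Sum>i\<in>{1..r}. exp (t i)) = (\<Sum>i\<in>{1..r}. exp (t i - \<mu>))"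
    unfolding sum_distrib_left by (intro sum.cong refl) (simp add: \<mu>_def exp_add[symmetric])
  also have "\<dots> \<le> (\<Sum>i\<in>{1..r}. 1 + (t i - \<mu>) + (1 + e) / 2 * (t i - \<mu>)\<^sup>2)"
  proof (intro sum_mono exp_quadratic_bound e)
    fix i assume "i \<in> {1..r}"
    then show "t i - \<mu> \<le> ln (1 + e)" using t[of i] \<mu> \<eta> by linarith
  qed
  also have "\<dots> = real r + (1 + e) / 2 * (\<Sum>i\<in>{1..r}. (t i - \<mu>)\<^sup>2)"
  proof -
    have "(\<Sum>i\<in>{1..r}. t i - \<mu>) = 0" using s\<mu> by (simp add: sum_subtractf)
    then show ?thesis unfolding sum.distrib sum_distrib_left[symmetric] by simp
  qed
  also have "(\<Sum>i\<in>{1..r}. (t i - \<mu>)\<^sup>2) \<le> (\<Sum>i\<in>{1..r}. (t i)\<^sup>2)"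
  proof -
    have "(\<Sum>i\<in>{1..r}. (t i - \<mu>)\<^sup>2) = (\<Sum>i\<in>{1..r}. (t i)\<^sup>2 - 2 * \<mu> * t i + \<mu>\<^sup>2)"
      by (intro sum.cong refl) (simp add: power2_diff mult_ac)
    also have "\<dots> = (\<Sum>i\<in>{1..r}. (t i)\<^sup>2) - 2 * \<mu> * (real r * \<mu>) + real r * \<mu>\<^sup>2"
      unfolding sum.distrib sum_subtractf sum_distrib_left[symmetric] s\<mu> by simp
    also have "\<dots> = (\<Sum>i\<in>{1..r}. (t i)\<^sup>2) - real r * \<mu>\<^sup>2" by (simp add: power2_eq_square)
    finally show ?thesis using r0 by simp
  qed
  also have "real r + (1 + e) / 2 * (\<Sum>i\<in>{1..r}. (t i)\<^sup>2)
      = real r * (1 + (1 + e) / (2 * real r) * (\<Sum>i\<in>{1..r}. (t i)\<^sup>2))"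
    using r0 by (simp add: distrib_left)
  also have "\<dots> \<le> real r * exp ((1 + e) / (2 * real r) * (\<Sum>i\<in>{1..r}. (t i)\<^sup>2))"
    by (intro mult_left_mono exp_ge_add_one_self) auto
  finally show ?thesis using e by (simp add: mult_left_mono)
qed

text \<open>The Gaussian bound for the disordered phase without a polynomial loss: the quadratic exponential
  is dominated by a sum of linear tilts with slopes on a grid of mesh \<open>1 / sqrt n\<close>, a discrete
  Hubbard-Stratonovich transformation.\<close>
lemma quadratic_tilt_sum_bound:
  fixes A :: real
  assumes r: "1 \<le> r" and A: "0 < A" "A < real r"
  shows "\<exists>\<delta>0>0. \<exists>C>0. \<forall>\<^sub>F n in sequentially.
    (\<Sum>xs\<in>{xs\<in>configs n {1..r}. \<forall>i\<in>{1..r}. \<bar>emp xs i - 1 / real r\<bar> \<le> \<delta>0}.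
       exp (real n * (A / 2 * (\<Sum>i\<in>{1..r}. (emp xs i - 1 / real r)\<^sup>2)))) \<le> C * real r ^ n"
proof -
  let ?a = "1 / real r"
  have r0: "0 < real r" using r by simp
  obtain e where e: "0 < e" "A * (1 + e) < real r"
  proof
    have m: "A * (real r / A - 1) = real r - A" using A by (simp add: right_diff_distrib)
    show "0 < (real r / A - 1) / 2" using A by simp
    have eq: "A * (1 + (real r / A - 1) / 2) = A + (real r - A) / 2"
      unfolding m[symmetric] by (simp add: distrib_left)
    show "A * (1 + (real r / A - 1) / 2) < real r" unfolding eq using A by (simp add: field_simps)
  qed
  \<comment> \<open>The Gaussian damping \<open>1 / (2 * A)\<close> of a tilt minus its cost
    \<open>(1 + e) / (2 * r)\<close>. That this is positive makes the sum over all slopes bounded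
    uniformly in \<open>n\<close>.\<close>
  define \<omega> where "\<omega> = 1 / (2 * A) - (1 + e) / (2 * real r)"
  have \<omega>: "0 < \<omega>" using e A r0 by (simp add: \<omega>_def field_simps)
  define \<eta> where "\<eta> = ln (1 + e) / 2"
  have \<eta>: "0 < \<eta>" using e by (simp add: \<eta>_def)
  have \<eta>2: "2 * \<eta> \<le> ln (1 + e)" by (simp add: \<eta>_def)
  \<comment> \<open>A deviation \<open>s\<close> calls for a slope near \<open>A * s\<close>.
    Deviations up to \<open>\<delta>0\<close> use half of the range
    \<open>[- \<eta>, \<eta>]\<close>, which leaves room for rounding to the grid.\<close>
  define \<delta>0 where "\<delta>0 = \<eta> / (2 * A)"
  have \<delta>0: "0 < \<delta>0" "A * \<delta>0 = \<eta> / 2" using \<eta> A by (auto simp: \<delta>0_def)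
  define C where "C = (exp (1 / (2 * A)) * (2 / (1 - exp (- \<omega>)))) ^ r"
  have C: "0 < C" using \<omega> by (simp add: C_def)
  have main: "(\<Sum>xs\<in>{xs\<in>configs n {1..r}. \<forall>i\<in>{1..r}. \<bar>emp xs i - ?a\<bar> \<le> \<delta>0}.
       exp (real n * (A / 2 * (\<Sum>i\<in>{1..r}. (emp xs i - ?a)\<^sup>2)))) \<le> C * real r ^ n"
    if n: "0 < n" "1 \<le> \<eta> / 2 * sqrt (real n)" for n
  proof -
    let ?B = "{xs\<in>configs n {1..r}. \<forall>i\<in>{1..r}. \<bar>emp xs i - ?a\<bar> \<le> \<delta>0}"
    define q where "q = sqrt (real n)"
    have q: "0 < q" "q * q = real n" using n by (auto simp: q_def)
    define K where "K = \<lfloor>\<eta> * q\<rfloor>"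
    define t where "t k = real_of_int k / q" for k :: int
    have tK: "\<bar>t k\<bar> \<le> \<eta>" if "k \<in> {-K..K}" for k
    proof -
      have "\<bar>real_of_int k\<bar> \<le> real_of_int K" using that by auto
      also have "\<dots> \<le> \<eta> * q" by (simp add: K_def)
      finally show ?thesis using q by (simp add: t_def abs_divide pos_divide_le_eq)
    qed
    define f where "f s k = exp (1 / (2 * A)) * exp (real n * (t k * s - (t k)\<^sup>2 / (2 * A)))" for s :: real and k :: int
    have f0: "0 \<le> f s k" for s k by (simp add: f_def)
    have nt: "real n * (t k)\<^sup>2 = (real_of_int k)\<^sup>2" for k
      unfolding q(2)[symmetric] t_def using q(1) by (simp add: power2_eq_square)
    have single: "exp (real n * (A / 2 * s\<^sup>2)) \<le> (\<Sum>k\<in>{-K..K}. f s k)" if s: "\<bar>s\<bar> \<le> \<delta>0" for s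
    proof -
      define k where "k = round (A * s * q)"
      have rk: "\<bar>real_of_int k - A * s * q\<bar> \<le> 1 / 2" unfolding k_def by (rule of_int_round_abs_le)
      have "\<bar>A * s * q\<bar> \<le> A * \<delta>0 * q" using A q s by (simp add: abs_mult mult_mono)
      then have "\<bar>A * s * q\<bar> \<le> \<eta> / 2 * q" unfolding \<delta>0(2) .
      then have "\<bar>real_of_int k\<bar> \<le> \<eta> * q" using rk n(2) unfolding q_def[symmetric] by linarith
      then have "k \<in> {-K..K}" unfolding K_def by (auto simp: le_floor_iff abs_le_iff) linarith
      \<comment> \<open>Completing the square: what remains is the rounding error of
        \<open>k\<close>, and it costs at most the factor \<open>exp (1 / (2 * A))\<close> built
        into \<open>f\<close>.\<close>
      have id: "real n * (A / 2 * s\<^sup>2) - real n * (t k * s - (t k)\<^sup>2 / (2 * A)) = (real_of_int k - A * s * q)\<^sup>2 / (2 * A)"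
      proof -
        have "real_of_int k = t k * q" using q by (simp add: t_def)
        then show ?thesis unfolding q(2)[symmetric] using A by (simp add: field_simps power2_eq_square)
      qed
      have "(real_of_int k - A * s * q)\<^sup>2 \<le> 1\<^sup>2" using rk by (intro power2_le_iff_abs_le[THEN iffD2]) auto
      then have "(real_of_int k - A * s * q)\<^sup>2 / (2 * A) \<le> 1 / (2 * A)"
        using A by (intro divide_right_mono) auto
      then have "real n * (A / 2 * s\<^sup>2) \<le> 1 / (2 * A) + real n * (t k * s - (t k)\<^sup>2 / (2 * A))"
        using id by linarith
      then have "exp (real n * (A / 2 * s\<^sup>2)) \<le> f s k" unfolding f_def exp_add[symmetric] exp_le_cancel_iff .
      also have "\<dots> \<le> (\<Sum>k\<in>{-K..K}. f s k)" by (rule member_le_sum[OF \<open>k \<in> {-K..K}\<close> f0]) simp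
      finally show ?thesis .
    qed
    \<comment> \<open>One slope for every coordinate; expanding the product of sums turns each such
      choice into a single linear tilt.\<close>
    define G where "G = PiE {1..r} (\<lambda>_. {-K..K})"
    have fG: "finite G" unfolding G_def by (intro finite_PiE) auto
    have "(\<Sum>xs\<in>?B. exp (real n * (A / 2 * (\<Sum>i\<in>{1..r}. (emp xs i - ?a)\<^sup>2))))
        \<le> (\<Sum>xs\<in>?B. \<Sum>g\<in>G. \<Prod>i\<in>{1..r}. f (emp xs i - ?a) (g i))"
    proof (intro sum_mono)
      fix xs assume xs: "xs \<in> ?B"
      have "exp (real n * (A / 2 * (\<Sum>i\<in>{1..r}. (emp xs i - ?a)\<^sup>2))) = (\<Prod>i\<in>{1..r}. exp (real n * (A / 2 * (emp xs i - ?a)\<^sup>2)))"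
        unfolding sum_distrib_left by (rule exp_sum) simp
      also have "\<dots> \<le> (\<Prod>i\<in>{1..r}. \<Sum>k\<in>{-K..K}. f (emp xs i - ?a) k)"
        using xs by (intro prod_mono conjI single) auto
      also have "\<dots> = (\<Sum>g\<in>G. \<Prod>i\<in>{1..r}. f (emp xs i - ?a) (g i))"
        unfolding G_def by (rule prod_sum_PiE) auto
      finally show "exp (real n * (A / 2 * (\<Sum>i\<in>{1..r}. (emp xs i - ?a)\<^sup>2))) \<le> (\<Sum>g\<in>G. \<Prod>i\<in>{1..r}. f (emp xs i - ?a) (g i))" .
    qed
    also have "\<dots> \<le> (\<Sum>xs\<in>configs n {1..r}. \<Sum>g\<in>G. \<Prod>i\<in>{1..r}. f (emp xs i - ?a) (g i))"
      by (intro sum_mono2 sum_nonneg prod_nonneg f0) auto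
    also have "\<dots> = (\<Sum>g\<in>G. \<Sum>xs\<in>configs n {1..r}. \<Prod>i\<in>{1..r}. f (emp xs i - ?a) (g i))"
      by (rule sum.swap)
    \<comment> \<open>For fixed slopes the sum over all configurations is a power of a one-site sum,
      and the sub-Gaussian bound leaves \<open>r ^ n\<close> times a Gaussian factor in the grid
      indices.\<close>
    also have "\<dots> \<le> (\<Sum>g\<in>G. real r ^ n * (\<Prod>i\<in>{1..r}. exp (1 / (2 * A)) * exp (- \<omega> * (real_of_int (g i))\<^sup>2)))"
    proof (intro sum_mono)
      fix g assume g: "g \<in> G"
      define T where "T i = t (g i)" for i
      have T: "\<bar>T i\<bar> \<le> \<eta>" if "i \<in> {1..r}" for i unfolding T_def using g that by (intro tK) (auto simp: G_def)
      define c where "c i = 1 / (2 * A) - real n * (T i)\<^sup>2 / (2 * A) - real n * ?a * T i" for i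
      have "(\<Sum>xs\<in>configs n {1..r}. \<Prod>i\<in>{1..r}. f (emp xs i - ?a) (g i)) = wsum {1..r} (\<lambda>i m. exp (c i + T i * real m)) n"
        unfolding wsum_def
      proof (intro sum.cong refl prod.cong)
        fix xs i assume "xs \<in> configs n {1..r}"
        then have ne: "real n * emp xs i = real (count_list xs i)" using n by (simp add: emp_def configs_def)
        have alg: "k + N * (u * (x - a) - v / w) = k - N * v / w - N * a * u + u * (N * x)" for k N u x a v w :: real
          by (simp add: algebra_simps)
        show "f (emp xs i - ?a) (g i) = exp (c i + T i * real (count_list xs i))"
          unfolding f_def c_def T_def exp_add[symmetric] ne[symmetric]
          by (rule arg_cong[where f = exp, OF alg])
      qed
      also have "\<dots> = exp (\<Sum>i\<in>{1..r}. c i) * (\<Sum>i\<in>{1..r}. exp (T i)) ^ n" by (rule wsum_exp) simp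
      also have "(\<Sum>i\<in>{1..r}. c i) = (\<Sum>i\<in>{1..r}. 1 / (2 * A) - real n * (T i)\<^sup>2 / (2 * A)) + real n * (- (\<Sum>i\<in>{1..r}. T i) / real r)"
        unfolding c_def sum_subtractf sum_distrib_left[symmetric] by simp
      also have "exp \<dots> * (\<Sum>i\<in>{1..r}. exp (T i)) ^ n
          = exp (\<Sum>i\<in>{1..r}. 1 / (2 * A) - real n * (T i)\<^sup>2 / (2 * A)) *
            (exp (- (\<Sum>i\<in>{1..r}. T i) / real r) * (\<Sum>i\<in>{1..r}. exp (T i))) ^ n"
        unfolding exp_add exp_of_nat_mult power_mult_distrib by (rule mult.assoc)
      also have "\<dots> \<le> exp (\<Sum>i\<in>{1..r}. 1 / (2 * A) - real n * (T i)\<^sup>2 / (2 * A)) *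
            (real r * exp ((1 + e) / (2 * real r) * (\<Sum>i\<in>{1..r}. (T i)\<^sup>2))) ^ n"
        by (intro mult_left_mono power_mono sum_exp_tilt_le[OF r e(1) \<eta>2 T] mult_nonneg_nonneg sum_nonneg) auto
      also have "\<dots> = real r ^ n * exp (\<Sum>i\<in>{1..r}. 1 / (2 * A) + - \<omega> * (real_of_int (g i))\<^sup>2)"
      proof -
        have "(\<Sum>i\<in>{1..r}. 1 / (2 * A) - real n * (T i)\<^sup>2 / (2 * A)) + real n * ((1 + e) / (2 * real r) * (\<Sum>i\<in>{1..r}. (T i)\<^sup>2))
            = (\<Sum>i\<in>{1..r}. 1 / (2 * A) + - \<omega> * (real_of_int (g i))\<^sup>2)"
          unfolding sum_distrib_left sum.distrib[symmetric]
        proof (intro sum.cong refl)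
          fix i
          show "1 / (2 * A) - real n * (T i)\<^sup>2 / (2 * A) + real n * ((1 + e) / (2 * real r) * (T i)\<^sup>2)
              = 1 / (2 * A) + - \<omega> * (real_of_int (g i))\<^sup>2"
            unfolding nt[symmetric] T_def \<omega>_def by (simp add: algebra_simps)
        qed
        then show ?thesis
          unfolding power_mult_distrib exp_of_nat_mult[symmetric] mult.left_commute[of _ "real r ^ n"] exp_add[symmetric]
          by (simp only:)
      qed
      also have "exp (\<Sum>i\<in>{1..r}. 1 / (2 * A) + - \<omega> * (real_of_int (g i))\<^sup>2)
          = (\<Prod>i\<in>{1..r}. exp (1 / (2 * A)) * exp (- \<omega> * (real_of_int (g i))\<^sup>2))"
        unfolding exp_add[symmetric] by (rule exp_sum) simp
      finally show "(\<Sum>xs\<in>configs n {1..r}. \<Prod>i\<in>{1..r}. f (emp xs i - ?a) (g i))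
          \<le> real r ^ n * (\<Prod>i\<in>{1..r}. exp (1 / (2 * A)) * exp (- \<omega> * (real_of_int (g i))\<^sup>2))" .
    qed
    also have "\<dots> = real r ^ n * (\<Sum>g\<in>G. \<Prod>i\<in>{1..r}. exp (1 / (2 * A)) * exp (- \<omega> * (real_of_int (g i))\<^sup>2))"
      by (rule sum_distrib_left[symmetric])
    also have "(\<Sum>g\<in>G. \<Prod>i\<in>{1..r}. exp (1 / (2 * A)) * exp (- \<omega> * (real_of_int (g i))\<^sup>2))
        = (\<Prod>i\<in>{1..r}. \<Sum>k\<in>{-K..K}. exp (1 / (2 * A)) * exp (- \<omega> * (real_of_int k)\<^sup>2))"
      unfolding G_def by (rule prod_sum_PiE[symmetric]) auto
    also have "real r ^ n * (\<Prod>i\<in>{1..r}. \<Sum>k\<in>{-K..K}. exp (1 / (2 * A)) * exp (- \<omega> * (real_of_int k)\<^sup>2))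
        \<le> real r ^ n * (\<Prod>i\<in>{1..r}. exp (1 / (2 * A)) * (2 / (1 - exp (- \<omega>))))"
      unfolding sum_distrib_left[symmetric]
      by (intro mult_left_mono prod_mono conjI mult_nonneg_nonneg sum_nonneg sum_exp_minus_square_le \<omega>) auto
    also have "\<dots> = C * real r ^ n" by (simp add: C_def)
    finally show ?thesis .
  qed
  have "filterlim (\<lambda>n. \<eta> / 2 * sqrt (real n)) at_top sequentially"
    using \<eta> by (intro filterlim_tendsto_pos_mult_at_top[OF tendsto_const]
        filterlim_compose[OF sqrt_at_top filterlim_real_sequentially]) auto
  then have "\<forall>\<^sub>F n in sequentially. 1 \<le> \<eta> / 2 * sqrt (real n)"
    unfolding filterlim_at_top by blast
  then have "\<forall>\<^sub>F n in sequentially. (\<Sum>xs\<in>{xs\<in>configs n {1..r}. \<forall>i\<in>{1..r}. \<bar>emp xs i - ?a\<bar> \<le> \<delta>0}.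
       exp (real n * (A / 2 * (\<Sum>i\<in>{1..r}. (emp xs i - ?a)\<^sup>2)))) \<le> C * real r ^ n"
    using eventually_gt_at_top[of 0] by eventually_elim (rule main)
  then show ?thesis using \<delta>0(1) C by blast
qed

section \<open>The partition function at the critical point\<close>

lemma prod_weight_Cons:
  fixes w :: "nat \<Rightarrow> real"
  assumes "finite I" "x \<in> I" "\<And>m. 0 < w m"
  shows "(\<Prod>i\<in>I. w (count_list (x # xs) i))
       = (\<Prod>i\<in>I. w (count_list xs i)) * (w (Suc (count_list xs x)) / w (count_list xs x))"
proof -
  have "(\<Prod>i\<in>I. w (count_list (x # xs) i)) = w (count_list (x # xs) x) * (\<Prod>i\<in>I - {x}. w (count_list (x # xs) i))"
    by (rule prod.remove[OF assms(1,2)])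
  also have "(\<Prod>i\<in>I - {x}. w (count_list (x # xs) i)) = (\<Prod>i\<in>I - {x}. w (count_list xs i))"
    by (intro prod.cong) auto
  finally show ?thesis
    using prod.remove[OF assms(1,2), of "\<lambda>i. w (count_list xs i)"] assms(3)[of "count_list xs x"] by simp
qed

text \<open>It exhibits the ratio of successive partition functions as the mean, over the weights on
  \<open>n\<close> sites, of the factor gained by one more spin.\<close>

lemma partition_fun_Suc_eq:
  "partition_fun z \<beta> N r (Suc n) = (\<Sum>xs\<in>configs n {1..r}.
     (\<Prod>i\<in>{1..r}. spin_weight z \<beta> N (count_list xs i)) *
     (\<Sum>j\<in>{1..r}. spin_weight z \<beta> N (Suc (count_list xs j)) / spin_weight z \<beta> N (count_list xs j)))"
proof -
  let ?w = "spin_weight z \<beta> N"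
  have "partition_fun z \<beta> N r (Suc n) = (\<Sum>x\<in>{1..r}. \<Sum>xs\<in>configs n {1..r}. \<Prod>i\<in>{1..r}. ?w (count_list (x # xs) i))"
    unfolding partition_fun_def wsum_def by (rule sum_configs_Suc)
  also have "\<dots> = (\<Sum>xs\<in>configs n {1..r}. \<Sum>x\<in>{1..r}. \<Prod>i\<in>{1..r}. ?w (count_list (x # xs) i))"
    by (rule sum.swap)
  also have "\<dots> = (\<Sum>xs\<in>configs n {1..r}. \<Sum>x\<in>{1..r}. (\<Prod>i\<in>{1..r}. ?w (count_list xs i)) *
      (?w (Suc (count_list xs x)) / ?w (count_list xs x)))"
    by (intro sum.cong refl prod_weight_Cons spin_weight_pos) auto
  finally show ?thesis by (simp only: sum_distrib_left)
qed

text \<open>Tangents to the convex exponent at the old and at the new count; \<open>c < N\<close>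
  keeps the slope at the new count at most \<open>\<beta>\<close>.\<close>

lemma spin_weight_ratio:
  assumes z: "1 < z" and \<beta>: "0 \<le> \<beta>" and N: "0 < N"
  shows "exp (\<beta> * (real c / real N) powr (z - 1)) \<le> spin_weight z \<beta> N (Suc c) / spin_weight z \<beta> N c"
    and "c < N \<Longrightarrow> spin_weight z \<beta> N (Suc c) / spin_weight z \<beta> N c \<le> exp \<beta>"
proof -
  let ?x = "real c / real N" and ?y = "real (Suc c) / real N"
  have d: "real N * ?y - real N * ?x = 1" using N by simp
  have e: "spin_weight z \<beta> N (Suc c) / spin_weight z \<beta> N c = exp (real N * \<beta> / z * ?y powr z - real N * \<beta> / z * ?x powr z)"
    by (simp add: spin_weight_def exp_diff)
  show "exp (\<beta> * ?x powr (z - 1)) \<le> spin_weight z \<beta> N (Suc c) / spin_weight z \<beta> N c"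
    unfolding e using scaled_tangent[OF z \<beta>, of ?x ?y N] d by simp
  assume "c < N"
  then have "?y powr (z - 1) \<le> 1" using z powr_mono2[of "z - 1" ?y 1] by simp
  then have "\<beta> * ?y powr (z - 1) \<le> \<beta>" using \<beta> by (simp add: mult_left_le)
  moreover have "real N * \<beta> / z * ?y powr z + \<beta> * ?y powr (z - 1) * (real N * ?x - real N * ?y) \<le> real N * \<beta> / z * ?x powr z"
    by (rule scaled_tangent[OF z \<beta>]) auto
  moreover have "real N * ?x - real N * ?y = - 1" using d by linarith
  ultimately show "spin_weight z \<beta> N (Suc c) / spin_weight z \<beta> N c \<le> exp \<beta>"
    unfolding e exp_le_cancel_iff by simp
qed

lemma partition_ratio_le:
  assumes z: "1 < z" and \<beta>: "0 \<le> \<beta>" and r: "1 \<le> r" and n: "n < N"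
  shows "partition_ratio z \<beta> N r n \<le> real r * exp \<beta>"
proof -
  let ?w = "spin_weight z \<beta> N"
  have "partition_fun z \<beta> N r (Suc n) \<le> (\<Sum>xs\<in>configs n {1..r}. (\<Prod>i\<in>{1..r}. ?w (count_list xs i)) * (real r * exp \<beta>))"
    unfolding partition_fun_Suc_eq
  proof (intro sum_mono mult_left_mono prod_nonneg less_imp_le[OF spin_weight_pos])
    fix xs assume "xs \<in> configs n {1..r}"
    then have "count_list xs j < N" for j using count_le_length[of xs j] n by (simp add: configs_def)
    then have "(\<Sum>j\<in>{1..r}. ?w (Suc (count_list xs j)) / ?w (count_list xs j)) \<le> (\<Sum>j\<in>{1..r}. exp \<beta>)"
      using n by (intro sum_mono spin_weight_ratio z \<beta>) auto
    then show "(\<Sum>j\<in>{1..r}. ?w (Suc (count_list xs j)) / ?w (count_list xs j)) \<le> real r * exp \<beta>" by simp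
  qed
  also have "\<dots> = partition_fun z \<beta> N r n * (real r * exp \<beta>)"
    unfolding partition_fun_def wsum_def by (rule sum_distrib_right[symmetric])
  finally show ?thesis
    using partition_fun_pos[OF r, of z \<beta> N n] by (simp add: partition_ratio_def pos_divide_le_eq mult.commute)
qed

section \<open>The disordered phase without polynomial loss\<close>

lemma emp_count: "xs \<in> configs n I \<Longrightarrow> real n / real N * emp xs i = real (count_list xs i) / real N"
  by (cases "n = 0") (auto simp: emp_def configs_def)

lemma prod_spin_weight_energy:
  assumes "xs \<in> configs n {1..r}" "0 < n"
  shows "(\<Prod>i\<in>{1..r}. spin_weight z \<beta> N (count_list xs i))
       = exp (real n * (\<beta> * (real n / real N) powr (z - 1) * energy z r (emp xs)))"
  unfolding energy_rescale[OF emp_in_simplex[OF assms], symmetric] emp_count[OF assms(1)]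
  by (simp add: spin_weight_def exp_sum)

lemma energy_le_quadratic:
  assumes z: "2 \<le> z" and r: "1 \<le> r" and x: "x \<in> prob_simplex r" and \<delta>: "\<delta> < 1 / real r"
    and near: "\<And>i. i \<in> {1..r} \<Longrightarrow> \<bar>x i - 1 / real r\<bar> \<le> \<delta>"
  shows "energy z r x \<le> energy z r (unif r) +
    (z - 1) * (1 / real r + \<delta>) powr (z - 2) / 2 * (\<Sum>i\<in>{1..r}. (x i - 1 / real r)\<^sup>2)"
proof -
  let ?a = "1 / real r"
  let ?B = "(z - 1) * (?a + \<delta>) powr (z - 2) / 2"
  have \<delta>0: "0 \<le> \<delta>" using near[of 1] r by simp
  have "energy z r x = (\<Sum>i\<in>{1..r}. x i powr z / z)" by (simp add: energy_def sum_divide_distrib)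
  also have "\<dots> \<le> (\<Sum>i\<in>{1..r}. ?a powr z / z + ?a powr (z - 1) * (x i - ?a) + ?B * (x i - ?a)\<^sup>2)"
  proof (intro sum_mono powr_quadratic_bound z)
    show "0 < ?a - \<delta>" using \<delta> by simp
    show "?a - \<delta> \<le> ?a" "?a \<le> ?a + \<delta>" using \<delta>0 by auto
    fix i assume "i \<in> {1..r}"
    then show "?a - \<delta> \<le> x i" "x i \<le> ?a + \<delta>" using near[of i] by (auto simp: abs_le_iff)
  qed
  also have "\<dots> = energy z r (unif r) + ?B * (\<Sum>i\<in>{1..r}. (x i - ?a)\<^sup>2)"
  proof -
    have "(\<Sum>i\<in>{1..r}. x i - ?a) = 0" using prob_simplexD(4)[OF x] r by (simp add: sum_subtractf)
    moreover have "energy z r (unif r) = (\<Sum>i\<in>{1..r}. ?a powr z / z)"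
      by (simp add: energy_def unif_def)
    ultimately show ?thesis unfolding sum.distrib sum_distrib_left[symmetric] by simp
  qed
  finally show ?thesis .
qed

text \<open>Near the uniform point the energy contribution has curvature at most
  \<open>A = crit z r * (z - 1) * (1 / r + d) powr (z - 2)\<close>, against the curvature
  \<open>r\<close> of the entropy there; the spinodal condition says that \<open>A < r\<close> for
  small \<open>d\<close>. For \<open>N \<ge> n\<close> the effective inverse temperature is at most
  critical, so one \<open>A\<close> serves all \<open>N\<close>.\<close>

lemma disordered_part_upper:
  assumes z: "2 \<le> z" and r: "2 \<le> r" and s: "crit z r * (z - 1) * (1 / real r) powr (z - 1) < 1"
  shows "\<exists>\<delta>0>0. \<exists>C>0. \<forall>\<delta>\<le>\<delta>0. \<forall>\<^sub>F n in sequentially. \<forall>N\<ge>n.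
    (\<Sum>xs\<in>{xs\<in>configs n {1..r}. \<forall>i\<in>{1..r}. \<bar>emp xs i - 1 / real r\<bar> \<le> \<delta>}.
       \<Prod>i\<in>{1..r}. spin_weight z (crit z r) N (count_list xs i))
    \<le> C * exp (real n * free_energy z r (crit z r * (real n / real N) powr (z - 1)) (unif r))"
proof -
  let ?a = "1 / real r" and ?c = "crit z r"
  have z1: "1 < z" and r1: "1 \<le> r" and a0: "0 < ?a" using z r by auto
  have c0: "0 < ?c" by (rule crit_pos[OF z1 r])
  have lim: "?c * (z - 1) * ?a powr (z - 2) < real r"
  proof -
    have "?a powr (z - 1) = ?a powr (z - 2) * ?a" using a0 powr_add[of ?a "z - 2" 1] by simp
    then show ?thesis using s a0 by (simp add: field_simps)
  qed
  have "((\<lambda>d. ?c * (z - 1) * (?a + d) powr (z - 2)) \<longlongrightarrow> ?c * (z - 1) * (?a + 0) powr (z - 2)) (at_right 0)"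
    using a0 by (intro tendsto_mult tendsto_const tendsto_powr tendsto_add tendsto_ident_at) auto
  then have "\<forall>\<^sub>F d in at_right 0. ?c * (z - 1) * (?a + d) powr (z - 2) < real r"
    using lim by (intro order_tendstoD(2)) auto
  moreover have "\<forall>\<^sub>F d in at_right 0. 0 < d \<and> d < ?a"
    using a0 by (intro eventually_conj eventually_at_right_less eventually_at_right_real[THEN eventually_mono]) auto
  ultimately have "\<forall>\<^sub>F d in at_right 0. ?c * (z - 1) * (?a + d) powr (z - 2) < real r \<and> (0 < d \<and> d < ?a)"
    by (rule eventually_conj)
  then obtain d where d: "?c * (z - 1) * (?a + d) powr (z - 2) < real r" "0 < d" "d < ?a"
    using eventually_happens'[OF trivial_limit_at_right_real] by blast
  define A where "A = ?c * (z - 1) * (?a + d) powr (z - 2)"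
  have A: "0 < A" "A < real r" using d c0 z a0 by (auto simp: A_def)
  obtain \<delta>1 C where C: "0 < \<delta>1" "0 < C" "\<forall>\<^sub>F n in sequentially.
    (\<Sum>xs\<in>{xs\<in>configs n {1..r}. \<forall>i\<in>{1..r}. \<bar>emp xs i - ?a\<bar> \<le> \<delta>1}.
       exp (real n * (A / 2 * (\<Sum>i\<in>{1..r}. (emp xs i - ?a)\<^sup>2)))) \<le> C * real r ^ n"
    using quadratic_tilt_sum_bound[OF r1 A] by blast
  have "\<forall>\<^sub>F n in sequentially. \<forall>N\<ge>n.
    (\<Sum>xs\<in>{xs\<in>configs n {1..r}. \<forall>i\<in>{1..r}. \<bar>emp xs i - ?a\<bar> \<le> \<delta>}. \<Prod>i\<in>{1..r}. spin_weight z ?c N (count_list xs i))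
    \<le> C * exp (real n * free_energy z r (?c * (real n / real N) powr (z - 1)) (unif r))"
    if \<delta>: "\<delta> \<le> min \<delta>1 d" for \<delta>
    using C(3) eventually_gt_at_top[of 0]
  proof eventually_elim
    case (elim n)
    show ?case
    proof (intro allI impI)
      fix N assume N: "n \<le> N"
      let ?B = "{xs\<in>configs n {1..r}. \<forall>i\<in>{1..r}. \<bar>emp xs i - ?a\<bar> \<le> \<delta>}"
      let ?B1 = "{xs\<in>configs n {1..r}. \<forall>i\<in>{1..r}. \<bar>emp xs i - ?a\<bar> \<le> \<delta>1}"
      let ?Q = "\<lambda>xs. \<Sum>i\<in>{1..r}. (emp xs i - ?a)\<^sup>2"
      define b where "b = ?c * (real n / real N) powr (z - 1)"
      have "real n / real N \<le> 1" using N elim by simp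
      then have "(real n / real N) powr (z - 1) \<le> 1" using z powr_mono2[of "z - 1" "real n / real N" 1] by simp
      then have b: "0 \<le> b" "b \<le> ?c" using c0 by (auto simp: b_def mult_left_le)
      have "(\<Sum>xs\<in>?B. \<Prod>i\<in>{1..r}. spin_weight z ?c N (count_list xs i))
          \<le> (\<Sum>xs\<in>?B. exp (real n * (b * energy z r (unif r))) * exp (real n * (A / 2 * ?Q xs)))"
      proof (intro sum_mono)
        fix xs assume xs: "xs \<in> ?B"
        have es: "emp xs \<in> prob_simplex r" using xs elim by (intro emp_in_simplex[of _ n]) auto
        have Q0: "0 \<le> ?Q xs" by (intro sum_nonneg) auto
        have "energy z r (emp xs) \<le> energy z r (unif r) + (z - 1) * (?a + d) powr (z - 2) / 2 * ?Q xs"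
          using xs \<delta> by (intro energy_le_quadratic[OF z r1 es d(3)]) force
        then have "b * energy z r (emp xs) \<le> b * energy z r (unif r) + b * ((z - 1) * (?a + d) powr (z - 2) / 2 * ?Q xs)"
          using b unfolding distrib_left[symmetric] by (intro mult_left_mono) auto
        also have "b * ((z - 1) * (?a + d) powr (z - 2) / 2 * ?Q xs) \<le> ?c * ((z - 1) * (?a + d) powr (z - 2) / 2 * ?Q xs)"
          using b z Q0 by (intro mult_right_mono mult_nonneg_nonneg) auto
        also have "\<dots> = A / 2 * ?Q xs" by (simp add: A_def)
        finally have "real n * (b * energy z r (emp xs)) \<le> real n * (b * energy z r (unif r)) + real n * (A / 2 * ?Q xs)"
          unfolding distrib_left[symmetric] by (intro mult_left_mono) auto
        moreover have "(\<Prod>i\<in>{1..r}. spin_weight z ?c N (count_list xs i)) = exp (real n * (b * energy z r (emp xs)))"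
          unfolding b_def using xs elim by (intro prod_spin_weight_energy) auto
        ultimately show "(\<Prod>i\<in>{1..r}. spin_weight z ?c N (count_list xs i))
            \<le> exp (real n * (b * energy z r (unif r))) * exp (real n * (A / 2 * ?Q xs))"
          unfolding exp_add[symmetric] by simp
      qed
      also have "\<dots> = exp (real n * (b * energy z r (unif r))) * (\<Sum>xs\<in>?B. exp (real n * (A / 2 * ?Q xs)))"
        by (rule sum_distrib_left[symmetric])
      also have "(\<Sum>xs\<in>?B. exp (real n * (A / 2 * ?Q xs))) \<le> (\<Sum>xs\<in>?B1. exp (real n * (A / 2 * ?Q xs)))"
        using \<delta> by (intro sum_mono2) (auto intro: order_trans)
      also have "\<dots> \<le> C * real r ^ n" by (rule elim(1))
      also have "exp (real n * (b * energy z r (unif r))) * (C * real r ^ n) = C * exp (real n * free_energy z r b (unif r))"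
        using r by (simp add: free_energy_unif[OF r1] distrib_left exp_add exp_of_nat_mult)
      finally show "(\<Sum>xs\<in>?B. \<Prod>i\<in>{1..r}. spin_weight z ?c N (count_list xs i))
          \<le> C * exp (real n * free_energy z r (?c * (real n / real N) powr (z - 1)) (unif r))"
        by (simp add: b_def)
    qed
  qed
  then show ?thesis using C(1,2) d(2) by (intro exI[of _ "min \<delta>1 d"] conjI exI[of _ C]) auto
qed

text \<open>The coordinate \<open>i0\<close> contributes the strict tangent gap, all others at least
  the tangent inequality. Applied to an ordered \<open>x\<close>, it shows that weights tilted
  towards \<open>x\<close> put little mass near the uniform point.\<close>

lemma tilt_weight_gap:
  assumes z: "1 < z" and b: "0 \<le> \<beta>" and N: "0 < N" and n: "0 < n"
    and x: "x \<in> prob_simplex r" and i0: "i0 \<in> {1..r}"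
    and gap: "\<And>y. y \<in> {0..1} \<Longrightarrow> \<delta> \<le> \<bar>y - x i0\<bar> \<Longrightarrow> x i0 powr z + z * x i0 powr (z - 1) * (y - x i0) + \<kappa> \<le> y powr z"
    and xs: "xs \<in> configs n {1..r}" "\<delta> \<le> \<bar>emp xs i0 - x i0\<bar>"
  shows "(\<Prod>i\<in>{1..r}. tilt_weight z \<beta> N (real n / real N * x i) (count_list xs i))
    \<le> exp (- (real n * (\<beta> * (real n / real N) powr (z - 1)) * (\<kappa> / z))) * (\<Prod>i\<in>{1..r}. spin_weight z \<beta> N (count_list xs i))"
proof -
  define b where "b = \<beta> * (real n / real N) powr (z - 1)"
  let ?t = "\<lambda>i. tilt_weight z \<beta> N (real n / real N * x i) (count_list xs i)"
  let ?w = "\<lambda>i. spin_weight z \<beta> N (count_list xs i)"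
  let ?E = "exp (- (real n * b * (\<kappa> / z)))"
  have b0: "0 \<le> b" using b by (simp add: b_def)
  have x0: "0 \<le> x i" for i by (rule prob_simplexD(1)[OF x])
  have es: "emp xs \<in> prob_simplex r" by (rule emp_in_simplex[OF xs(1) n])
  have y: "emp xs i0 \<in> {0..1}" using prob_simplexD(1,2)[OF es, of i0] by simp
  have cnt: "real (count_list xs i0) = real n * emp xs i0" using xs(1) n by (simp add: emp_def configs_def)
  have pz: "real N * \<beta> / z * (real n / real N * t) powr z = real n * b / z * t powr z" if "0 \<le> t" for t
  proof -
    have "real N * \<beta> / z * (real n / real N * t) powr z = \<beta> / z * (real N * (real n / real N) powr z) * t powr z"
      by (simp only: powr_mult) simp
    then show ?thesis unfolding powr_rescale by (simp add: b_def)
  qed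
  have pp: "\<beta> * (real n / real N * t) powr (z - 1) = b * t powr (z - 1)" for t
    by (simp only: powr_mult b_def mult.assoc)
  have "?t i0 \<le> ?E * ?w i0"
  proof -
    have NN: "real N * (real n / real N * t) = real n * t" for t using N by simp
    have "real n * b / z * (x i0 powr z + z * x i0 powr (z - 1) * (emp xs i0 - x i0) + \<kappa>) \<le> real n * b / z * (emp xs i0) powr z"
      using z b0 by (intro mult_left_mono gap y xs(2)) auto
    moreover have "k / z * (p + z * u * d + \<kappa>) = k / z * p + k * u * d + k * (\<kappa> / z)" for k p u d
      using z by (simp add: field_simps)
    ultimately have "real n * b / z * x i0 powr z + real n * b * x i0 powr (z - 1) * (emp xs i0 - x i0)
        \<le> - (real n * b * (\<kappa> / z)) + real n * b / z * (emp xs i0) powr z" by (simp only:)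
    moreover have "real N * \<beta> / z * (real n / real N * x i0) powr z
        + \<beta> * (real n / real N * x i0) powr (z - 1) * (real (count_list xs i0) - real N * (real n / real N * x i0))
        = real n * b / z * x i0 powr z + real n * b * x i0 powr (z - 1) * (emp xs i0 - x i0)"
      unfolding pz[OF x0] pp NN cnt by (simp add: algebra_simps)
    moreover have "real N * \<beta> / z * (real (count_list xs i0) / real N) powr z = real n * b / z * (emp xs i0) powr z"
      unfolding emp_count[OF xs(1), symmetric] using y by (intro pz) simp
    ultimately show ?thesis
      unfolding tilt_weight_def spin_weight_def exp_add[symmetric] exp_le_cancel_iff by linarith
  qed
  moreover have "(\<Prod>i\<in>{1..r} - {i0}. ?t i) \<le> (\<Prod>i\<in>{1..r} - {i0}. ?w i)"
    using x0 by (intro prod_mono conjI tilt_weight_le less_imp_le[OF tilt_weight_pos] z b N) auto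
  ultimately have "?t i0 * (\<Prod>i\<in>{1..r} - {i0}. ?t i) \<le> (?E * ?w i0) * (\<Prod>i\<in>{1..r} - {i0}. ?w i)"
    by (intro mult_mono prod_nonneg mult_nonneg_nonneg less_imp_le[OF tilt_weight_pos] less_imp_le[OF spin_weight_pos]) auto
  also have "\<dots> = ?E * (\<Prod>i\<in>{1..r}. ?w i)"
    using prod.remove[of "{1..r}" i0 ?w] i0 by simp
  also have "?t i0 * (\<Prod>i\<in>{1..r} - {i0}. ?t i) = (\<Prod>i\<in>{1..r}. ?t i)"
    using prod.remove[of "{1..r}" i0 ?t] i0 by simp
  finally show ?thesis by (simp add: b_def)
qed

text \<open>Bernoulli's inequality at \<open>1 - 1 / N\<close>. The defect \<open>c - b\<close>
  times the number of sites stays bounded, so being slightly off the critical value costs only a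
  constant factor.\<close>

lemma effective_temperature_bounds:
  assumes z: "2 < z" and c: "0 < c" and N: "2 \<le> N"
  defines "b \<equiv> c * (real (N - 1) / real N) powr (z - 1)"
  shows "b \<le> c" "c * (1 / 2) powr (z - 1) \<le> b" "real (N - 1) * (c - b) \<le> c * (z - 1)"
proof -
  let ?t = "real (N - 1) / real N"
  have t: "1 / 2 \<le> ?t" "?t \<le> 1" using N by (auto simp: field_simps of_nat_diff)
  have "?t powr (z - 1) \<le> 1"
  proof (rule powr_le1)
    show "\<bar>?t\<bar> \<le> 1" using t by linarith
  qed (use z in simp)
  then show "b \<le> c" using c by (simp add: b_def mult_left_le)
  have "(1 / 2) powr (z - 1) \<le> ?t powr (z - 1)" using t z N by (intro powr_mono2) auto
  then show "c * (1 / 2) powr (z - 1) \<le> b" using c by (simp add: b_def)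
  have "1 powr (z - 1) + (z - 1) * 1 powr (z - 1 - 1) * (?t - 1) \<le> ?t powr (z - 1)"
    using z by (intro powr_tangent) auto
  moreover have "?t - 1 = - (1 / real N)" using N by (simp add: field_simps of_nat_diff)
  ultimately have "1 - ?t powr (z - 1) \<le> (z - 1) / real N" by simp
  then have "c * (1 - ?t powr (z - 1)) \<le> c * ((z - 1) / real N)" using c by (intro mult_left_mono) auto
  moreover have "0 \<le> c * ((z - 1) / real N)" using c z by simp
  moreover have "real (N - 1) \<le> real N" "0 \<le> real (N - 1)" by auto
  ultimately have "real (N - 1) * (c * (1 - ?t powr (z - 1))) \<le> real N * (c * ((z - 1) / real N))"
    by (meson mult_left_mono mult_right_mono order_trans)
  also have "\<dots> = c * (z - 1)" using N by simp
  finally show "real (N - 1) * (c - b) \<le> c * (z - 1)" by (simp add: b_def right_diff_distrib)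
qed

text \<open>At \<open>n = N - 1\<close> the effective temperature is within \<open>O(1/N)\<close> of the critical one, so that the
  ordered and the disordered part of the partition function are of the same order.\<close>
lemma ordered_part_not_negligible:
  assumes z: "2 < z" and r: "2 \<le> r" and s: "crit z r * (z - 1) * (1 / real r) powr (z - 1) < 1"
  shows "\<exists>\<delta>>0. \<exists>\<theta>>0. \<forall>\<^sub>F N in sequentially.
    \<theta> * partition_fun z (crit z r) N r (N - 1) \<le>
    (\<Sum>xs\<in>{xs\<in>configs (N - 1) {1..r}. \<exists>i\<in>{1..r}. \<delta> \<le> \<bar>emp xs i - 1 / real r\<bar>}.
       \<Prod>i\<in>{1..r}. spin_weight z (crit z r) N (count_list xs i))"
proof -
  let ?a = "1 / real r" and ?c = "crit z r"
  have z1: "1 < z" and z2: "2 \<le> z" and r1: "1 \<le> r" using z r by auto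
  have c0: "0 < ?c" by (rule crit_pos[OF z1 r])
  obtain \<delta>0 C where \<delta>0: "0 < \<delta>0" and C: "0 < C" and up: "\<And>\<delta>. \<delta> \<le> \<delta>0 \<Longrightarrow> \<forall>\<^sub>F n in sequentially. \<forall>N\<ge>n.
    (\<Sum>xs\<in>{xs\<in>configs n {1..r}. \<forall>i\<in>{1..r}. \<bar>emp xs i - ?a\<bar> \<le> \<delta>}. \<Prod>i\<in>{1..r}. spin_weight z ?c N (count_list xs i))
    \<le> C * exp (real n * free_energy z r (?c * (real n / real N) powr (z - 1)) (unif r))"
    using disordered_part_upper[OF z2 r s] by blast
  obtain x where x: "x \<in> prob_simplex r" "x \<noteq> unif r" "free_energy z r ?c x = free_energy z r ?c (unif r)"
    using nonuniform_maximizer[OF z1 r s] by blast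
  obtain i0 where i0: "i0 \<in> {1..r}" "x i0 \<noteq> ?a"
  proof -
    obtain i where i: "x i \<noteq> unif r i" using x(2) by auto
    then have "i \<in> {1..r}" using prob_simplexD(3)[OF x(1), of i] by (auto simp: unif_def split: if_splits)
    then show thesis using that[of i] i by (simp add: unif_def)
  qed
  \<comment> \<open>At most half the distance from \<open>x i0\<close> to \<open>1 / r\<close>, so
    that the box of radius \<open>\<delta>\<close> around the uniform point stays at distance
    \<open>\<delta>\<close> from \<open>x\<close> in coordinate \<open>i0\<close>; at most
    \<open>\<delta>0\<close> for the Gaussian bound.\<close>
  define \<delta> where "\<delta> = min \<delta>0 (\<bar>x i0 - ?a\<bar> / 2)"
  have "\<delta> \<le> \<bar>x i0 - ?a\<bar> / 2" unfolding \<delta>_def by (rule min.cobounded2)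
  then have \<delta>: "0 < \<delta>" "\<delta> \<le> \<delta>0" "2 * \<delta> \<le> \<bar>x i0 - ?a\<bar>" using \<delta>0 i0(2) by (auto simp: \<delta>_def)
  obtain \<kappa> where \<kappa>: "0 < \<kappa>" "\<And>y. y \<in> {0..1} \<Longrightarrow> \<delta> \<le> \<bar>y - x i0\<bar> \<Longrightarrow>
      x i0 powr z + z * x i0 powr (z - 1) * (y - x i0) + \<kappa> \<le> y powr z"
    using powr_tangent_gap[OF z1 prob_simplexD(1)[OF x(1)] \<delta>(1), of i0] by blast
  \<comment> \<open>The factor the ordered phase may lose because the effective inverse temperature
    on \<open>N - 1\<close> sites falls short of the critical one.\<close>
  define D where "D = exp (- (?c * (z - 1)))"
  have D: "0 < D" by (simp add: D_def)
  define g where "g = ?c * (1 / 2) powr (z - 1) * (\<kappa> / z)"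
  have g: "0 < g" using c0 \<kappa> z by (simp add: g_def)
  have "(\<lambda>n. C * exp (- g) ^ n) \<longlonglongrightarrow> C * 0"
    using g by (intro tendsto_mult tendsto_const LIMSEQ_power_zero) simp
  then have "\<forall>\<^sub>F n in sequentially. C * exp (- g) ^ n < D / 2" using D by (intro order_tendstoD(2)) auto
  then have evn: "\<forall>\<^sub>F n in sequentially. C * exp (- g) ^ n < D / 2 \<and> (\<forall>N\<ge>n.
    (\<Sum>xs\<in>{xs\<in>configs n {1..r}. \<forall>i\<in>{1..r}. \<bar>emp xs i - ?a\<bar> \<le> \<delta>}. \<Prod>i\<in>{1..r}. spin_weight z ?c N (count_list xs i))
    \<le> C * exp (real n * free_energy z r (?c * (real n / real N) powr (z - 1)) (unif r)))"
    using up[OF \<delta>(2)] by (rule eventually_conj)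
  then obtain n0 where n0: "\<And>n. n0 \<le> n \<Longrightarrow> C * exp (- g) ^ n < D / 2 \<and> (\<forall>N\<ge>n.
    (\<Sum>xs\<in>{xs\<in>configs n {1..r}. \<forall>i\<in>{1..r}. \<bar>emp xs i - ?a\<bar> \<le> \<delta>}. \<Prod>i\<in>{1..r}. spin_weight z ?c N (count_list xs i))
    \<le> C * exp (real n * free_energy z r (?c * (real n / real N) powr (z - 1)) (unif r)))"
    unfolding eventually_sequentially by blast
  \<comment> \<open>The share of the outside part when the inside part is at most
    \<open>C * X\<close> and the outside part at least \<open>D / 2 * X\<close>.\<close>
  define \<theta> where "\<theta> = (D / 2) / (C + D / 2)"
  have \<theta>: "0 < \<theta>" using C D by (simp add: \<theta>_def)
  have "\<theta> * partition_fun z ?c N r (N - 1) \<le>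
    (\<Sum>xs\<in>{xs\<in>configs (N - 1) {1..r}. \<exists>i\<in>{1..r}. \<delta> \<le> \<bar>emp xs i - ?a\<bar>}. \<Prod>i\<in>{1..r}. spin_weight z ?c N (count_list xs i))"
    if N: "n0 + 2 \<le> N" for N
  proof -
    define n where "n = N - 1"
    have n: "n0 \<le> n" "0 < n" "n \<le> N" "0 < N" "2 \<le> N" using N by (auto simp: n_def)
    define b where "b = ?c * (real n / real N) powr (z - 1)"
    note bb = effective_temperature_bounds[OF z c0 n(5), folded n_def, folded b_def]
    let ?S = "configs n {1..r}"
    let ?W = "\<lambda>xs. \<Prod>i\<in>{1..r}. spin_weight z ?c N (count_list xs i)"
    let ?T = "\<lambda>xs. \<Prod>i\<in>{1..r}. tilt_weight z ?c N (real n / real N * x i) (count_list xs i)"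
    let ?out = "{xs\<in>?S. \<exists>i\<in>{1..r}. \<delta> \<le> \<bar>emp xs i - ?a\<bar>}"
    let ?in = "?S - ?out"
    let ?box = "{xs\<in>?S. \<forall>i\<in>{1..r}. \<bar>emp xs i - ?a\<bar> \<le> \<delta>}"
    have W0: "0 \<le> ?W xs" for xs by (intro prod_nonneg less_imp_le[OF spin_weight_pos])
    have T0: "0 \<le> ?T xs" for xs by (intro prod_nonneg less_imp_le[OF tilt_weight_pos])
    define X where "X = exp (real n * free_energy z r b (unif r))"
    have X: "0 < X" by (simp add: X_def)
    have "sum ?W ?in \<le> sum ?W ?box" by (intro sum_mono2 W0) (auto simp: not_le less_imp_le)
    also have "\<dots> \<le> C * X" unfolding X_def b_def using n0[OF n(1)] n(3) by blast
    finally have inU: "sum ?W ?in \<le> C * X" .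
    \<comment> \<open>Near the uniform point the tilted weights are exponentially smaller than the
      true ones, so most of the tilted mass lies outside, where it bounds the true weights from
      below.\<close>
    have "sum ?T ?in \<le> exp (- (real n * b * (\<kappa> / z))) * sum ?W ?in"
      unfolding sum_distrib_left
    proof (intro sum_mono)
      fix xs assume xs: "xs \<in> ?in"
      then have "\<bar>emp xs i0 - ?a\<bar> < \<delta>" using i0(1) by (auto simp: not_le)
      then have "\<delta> \<le> \<bar>emp xs i0 - x i0\<bar>" using \<delta>(3) by linarith
      then show "?T xs \<le> exp (- (real n * b * (\<kappa> / z))) * ?W xs"
        unfolding b_def using xs c0 n \<kappa>(2)
        by (intro tilt_weight_gap[OF z1 _ n(4) n(2) x(1) i0(1), where \<delta> = \<delta>]) auto
    qed
    also have "\<dots> \<le> exp (- g) ^ n * (C * X)"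
    proof (intro mult_mono inU sum_nonneg W0)
      have "g \<le> b * (\<kappa> / z)" unfolding g_def using bb(2) \<kappa>(1) z by (intro mult_right_mono) auto
      then have "real n * g \<le> real n * (b * (\<kappa> / z))" by (intro mult_left_mono) auto
      then have "exp (- (real n * b * (\<kappa> / z))) \<le> exp (real n * (- g))" by (simp add: mult.assoc)
      then show "exp (- (real n * b * (\<kappa> / z))) \<le> exp (- g) ^ n" by (simp only: exp_of_nat_mult)
    qed auto
    also have "\<dots> = C * exp (- g) ^ n * X" by simp
    also have "\<dots> \<le> D / 2 * X" using n0[OF n(1)] X by (intro mult_right_mono) auto
    finally have inT: "sum ?T ?in \<le> D / 2 * X" .
    have "D * X \<le> sum ?T ?S"
    proof -
      have "real n * ((?c - b) * (energy z r x - energy z r (unif r))) \<le> real n * ((?c - b) * 1)"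
      proof (intro mult_left_mono)
        have "energy z r x \<le> 1 / z" by (rule energy_le[OF z1 x(1)])
        also have "\<dots> \<le> 1" using z by simp
        finally show "energy z r x - energy z r (unif r) \<le> 1" using energy_nonneg[of z r "unif r"] z by simp
      qed (use bb in auto)
      also have "\<dots> \<le> ?c * (z - 1)" using bb(3) by simp
      finally have *: "real n * ((?c - b) * (energy z r x - energy z r (unif r))) \<le> ?c * (z - 1)" .
      have "free_energy z r b x = free_energy z r b (unif r) - (?c - b) * (energy z r x - energy z r (unif r))"
        using x(3) by (simp add: free_energy_def algebra_simps)
      then have "real n * free_energy z r b x
          = real n * free_energy z r b (unif r) - real n * ((?c - b) * (energy z r x - energy z r (unif r)))"
        by (simp only: right_diff_distrib)
      then have "- (?c * (z - 1)) + real n * free_energy z r b (unif r) \<le> real n * free_energy z r b x"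
        using * by linarith
      then have "D * X \<le> exp (real n * free_energy z r b x)"
        unfolding D_def X_def exp_add[symmetric] exp_le_cancel_iff .
      also have "\<dots> \<le> sum ?T ?S"
        using tilt_lower[OF x(1) r1 n(4), of n z ?c] unfolding wsum_def b_def .
      finally show ?thesis .
    qed
    also have "sum ?T ?S = sum ?T ?out + sum ?T ?in"
      by (subst add.commute, rule sum.subset_diff) auto
    finally have "D / 2 * X \<le> sum ?T ?out" using inT by linarith
    also have "\<dots> \<le> sum ?W ?out"
      using prob_simplexD(1)[OF x(1)] c0 n(4) z1
      by (intro sum_mono prod_mono conjI tilt_weight_le less_imp_le[OF tilt_weight_pos]) auto
    finally have outL: "D / 2 * X \<le> sum ?W ?out" .
    have "partition_fun z ?c N r n = sum ?W ?out + sum ?W ?in"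
      unfolding partition_fun_def wsum_def by (subst add.commute, rule sum.subset_diff) auto
    moreover have "D / 2 * sum ?W ?in \<le> C * sum ?W ?out"
    proof -
      have "D / 2 * sum ?W ?in \<le> D / 2 * (C * X)" using inU D by (intro mult_left_mono) auto
      also have "\<dots> = C * (D / 2 * X)" by simp
      also have "\<dots> \<le> C * sum ?W ?out" using outL C by (intro mult_left_mono) auto
      finally show ?thesis .
    qed
    ultimately have "(D / 2) * partition_fun z ?c N r n \<le> (C + D / 2) * sum ?W ?out"
      by (simp only: distrib_left distrib_right)
    moreover have E: "0 < C + D / 2" using C D by simp
    ultimately have "(D / 2) * partition_fun z ?c N r n / (C + D / 2) \<le> sum ?W ?out"
      by (subst pos_divide_le_eq[OF E]) (simp only: mult.commute)
    then show ?thesis unfolding \<theta>_def n_def[symmetric] by (simp only: times_divide_eq_left)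
  qed
  then show ?thesis using \<delta>(1) \<theta> unfolding eventually_sequentially by blast
qed

text \<open>The ratio is a mean of the factor gained by one more spin. By
  \<open>1 + u \<le> exp u\<close> that factor is at least its disordered value plus a multiple of
  the excess energy with exponent \<open>z - 1\<close>. Since \<open>z - 1 > 1\<close>, this excess
  has a positive lower bound on configurations away from the uniform one, and these carry a fixed
  share of the weight.\<close>

lemma partition_ratio_endpoint_gap:
  assumes z: "2 < z" and r: "2 \<le> r" and s: "crit z r * (z - 1) * (1 / real r) powr (z - 1) < 1"
  shows "\<exists>\<kappa>>0. \<forall>\<^sub>F N in sequentially.
    exp (ln (real r) + z * (crit z r * energy z r (unif r))) + \<kappa> \<le> partition_ratio z (crit z r) N r (N - 1)"
proof -
  let ?a = "1 / real r" and ?c = "crit z r"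
  have z1: "1 < z" and p1: "1 < z - 1" and r1: "1 \<le> r" using z r by auto
  have c0: "0 < ?c" by (rule crit_pos[OF z1 r])
  obtain \<delta> \<theta> where \<delta>: "0 < \<delta>" and \<theta>: "0 < \<theta>" and ev: "\<forall>\<^sub>F N in sequentially.
    \<theta> * partition_fun z ?c N r (N - 1) \<le>
    (\<Sum>xs\<in>{xs\<in>configs (N - 1) {1..r}. \<exists>i\<in>{1..r}. \<delta> \<le> \<bar>emp xs i - ?a\<bar>}.
       \<Prod>i\<in>{1..r}. spin_weight z ?c N (count_list xs i))"
    using ordered_part_not_negligible[OF z r s] by blast
  obtain \<kappa> where \<kappa>: "0 < \<kappa>" "\<And>x. x \<in> prob_simplex r \<Longrightarrow> (\<exists>i\<in>{1..r}. \<delta> \<le> \<bar>x i - ?a\<bar>) \<Longrightarrow>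
      energy (z - 1) r (unif r) + \<kappa> \<le> energy (z - 1) r x"
    using energy_gap[OF p1 r1 \<delta>] by blast
  define B where "B N = ?c * (real (N - 1) / real N) powr (z - 1)" for N
  \<comment> \<open>The gain on ordered configurations, made uniform in \<open>N\<close> by bounding
    the effective inverse temperature below by its value for \<open>N = 2\<close>.\<close>
  define G where "G = ?c * (1 / 2) powr (z - 1) * ((z - 1) * \<kappa>)"
  have G: "0 < G" using c0 \<kappa>(1) z by (simp add: G_def)
  have lb: "real r * exp (B N * ?a powr (z - 1)) + \<theta> * G \<le> partition_ratio z ?c N r (N - 1)"
    if N: "2 \<le> N" and out: "\<theta> * partition_fun z ?c N r (N - 1) \<le>
      (\<Sum>xs\<in>{xs\<in>configs (N - 1) {1..r}. \<exists>i\<in>{1..r}. \<delta> \<le> \<bar>emp xs i - ?a\<bar>}. \<Prod>i\<in>{1..r}. spin_weight z ?c N (count_list xs i))" for N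
  proof -
    define n where "n = N - 1"
    have n: "0 < n" "0 < N" "N = Suc n" using N by (auto simp: n_def)
    let ?b = "B N"
    note bb = effective_temperature_bounds[OF z c0 N, folded B_def]
    have b0: "0 \<le> ?b" using c0 by (simp add: B_def)
    let ?S = "configs n {1..r}"
    let ?W = "\<lambda>xs. \<Prod>i\<in>{1..r}. spin_weight z ?c N (count_list xs i)"
    let ?H = "\<lambda>xs. \<Sum>j\<in>{1..r}. spin_weight z ?c N (Suc (count_list xs j)) / spin_weight z ?c N (count_list xs j)"
    let ?O = "{xs\<in>?S. \<exists>i\<in>{1..r}. \<delta> \<le> \<bar>emp xs i - ?a\<bar>}"
    let ?\<rho> = "real r * exp (?b * ?a powr (z - 1))"
    have W0: "0 \<le> ?W xs" for xs by (intro prod_nonneg less_imp_le[OF spin_weight_pos])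
    have H: "?\<rho> + (if xs \<in> ?O then G else 0) \<le> ?H xs" if xs: "xs \<in> ?S" for xs
    proof -
      have es: "emp xs \<in> prob_simplex r" by (rule emp_in_simplex[OF xs n(1)])
      let ?e = "exp (?b * ?a powr (z - 1))"
      let ?D = "energy (z - 1) r (emp xs) - energy (z - 1) r (unif r)"
      have D0: "0 \<le> ?D" using energy_unif_le[OF p1 es r1] by simp
      have en: "(\<Sum>j\<in>{1..r}. emp xs j powr (z - 1) - ?a powr (z - 1)) = (z - 1) * ?D"
      proof -
        have "(\<Sum>j\<in>{1..r}. unif r j powr (z - 1)) = (\<Sum>j\<in>{1..r}. ?a powr (z - 1))"
          by (intro sum.cong) (auto simp: unif_def)
        then show ?thesis using z by (simp add: energy_def sum_subtractf right_diff_distrib)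
      qed
      have "?e * (\<Sum>j\<in>{1..r}. 1 + ?b * (emp xs j powr (z - 1) - ?a powr (z - 1))) \<le> ?H xs"
        unfolding sum_distrib_left
      proof (intro sum_mono)
        fix j assume "j \<in> {1..r}"
        have "1 + ?b * (emp xs j powr (z - 1) - ?a powr (z - 1)) \<le> exp (?b * (emp xs j powr (z - 1) - ?a powr (z - 1)))"
          by (rule exp_ge_add_one_self)
        then have "?e * (1 + ?b * (emp xs j powr (z - 1) - ?a powr (z - 1)))
            \<le> ?e * exp (?b * (emp xs j powr (z - 1) - ?a powr (z - 1)))" by (intro mult_left_mono) auto
        also have "\<dots> = exp (?b * emp xs j powr (z - 1))"
          unfolding exp_add[symmetric] by (simp add: right_diff_distrib)
        also have "?b * emp xs j powr (z - 1) = ?c * (real (count_list xs j) / real N) powr (z - 1)"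
          unfolding emp_count[OF xs, symmetric] B_def n_def[symmetric] by (simp only: powr_mult mult.assoc)
        also have "exp \<dots> \<le> spin_weight z ?c N (Suc (count_list xs j)) / spin_weight z ?c N (count_list xs j)"
          using c0 by (intro spin_weight_ratio(1)[OF z1 _ n(2)]) simp
        finally show "?e * (1 + ?b * (emp xs j powr (z - 1) - ?a powr (z - 1)))
            \<le> spin_weight z ?c N (Suc (count_list xs j)) / spin_weight z ?c N (count_list xs j)" .
      qed
      also have "(\<Sum>j\<in>{1..r}. 1 + ?b * (emp xs j powr (z - 1) - ?a powr (z - 1))) = real r + ?b * ((z - 1) * ?D)"
        unfolding sum.distrib sum_distrib_left[symmetric] en by simp
      finally have h: "?\<rho> + ?e * (?b * ((z - 1) * ?D)) \<le> ?H xs" by (simp add: algebra_simps)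
      show ?thesis
      proof (cases "xs \<in> ?O")
        case True
        then have "\<kappa> \<le> ?D" using \<kappa>(2)[OF es] by auto
        then have "G \<le> ?b * ((z - 1) * ?D)"
          unfolding G_def using bb(2) b0 z \<kappa>(1) by (intro mult_mono mult_left_mono mult_nonneg_nonneg) auto
        also have "\<dots> \<le> ?e * (?b * ((z - 1) * ?D))"
          using b0 D0 z mult_right_mono[of 1 ?e "?b * ((z - 1) * ?D)"] by simp
        finally show ?thesis using h True by (simp only: if_True)
      next
        case False
        have "0 \<le> ?e * (?b * ((z - 1) * ?D))" using b0 D0 z by simp
        then show ?thesis using h False by (simp only: if_False)
      qed
    qed
    have A0: "0 < partition_fun z ?c N r n" by (rule partition_fun_pos[OF r1])
    have "?\<rho> * partition_fun z ?c N r n + G * sum ?W ?O = (\<Sum>xs\<in>?S. ?W xs * (?\<rho> + (if xs \<in> ?O then G else 0)))"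
    proof -
      have "(\<Sum>xs\<in>?S. ?W xs * (if xs \<in> ?O then G else 0)) = (\<Sum>xs\<in>?O. ?W xs * G)"
        by (intro sum.mono_neutral_cong_right) auto
      then show ?thesis
        unfolding distrib_left sum.distrib partition_fun_def wsum_def sum_distrib_right[symmetric] by simp
    qed
    also have "\<dots> \<le> (\<Sum>xs\<in>?S. ?W xs * ?H xs)" by (intro sum_mono mult_left_mono H W0)
    also have "\<dots> = partition_fun z ?c N r (Suc n)" by (rule partition_fun_Suc_eq[symmetric])
    finally have "?\<rho> * partition_fun z ?c N r n + G * sum ?W ?O \<le> partition_fun z ?c N r (Suc n)" .
    moreover have "G * (\<theta> * partition_fun z ?c N r n) \<le> G * sum ?W ?O"
      using out G unfolding n_def by (intro mult_left_mono) auto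
    ultimately have "(?\<rho> + \<theta> * G) * partition_fun z ?c N r n \<le> partition_fun z ?c N r (Suc n)"
      by (simp add: algebra_simps)
    then show ?thesis using A0 unfolding partition_ratio_def n_def[symmetric] by (simp add: pos_le_divide_eq)
  qed
  have "(\<lambda>N. real (N - 1) / real N) \<longlonglongrightarrow> 1"
  proof (rule Lim_transform_eventually)
    show "(\<lambda>N. 1 - 1 / real N) \<longlonglongrightarrow> 1" using tendsto_diff[OF tendsto_const lim_1_over_n] by force
    show "\<forall>\<^sub>F N in sequentially. 1 - 1 / real N = real (N - 1) / real N"
      by (rule eventually_mono[OF eventually_gt_at_top[of 0]]) (simp add: of_nat_diff diff_divide_distrib)
  qed
  then have "B \<longlonglongrightarrow> ?c * 1 powr (z - 1)" unfolding B_def by (rule tendsto_effective_temperature[OF z1])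
  then have "(\<lambda>N. real r * exp (B N * ?a powr (z - 1))) \<longlonglongrightarrow> real r * exp (?c * 1 powr (z - 1) * ?a powr (z - 1))"
    by (intro tendsto_mult tendsto_const tendsto_exp)
  moreover have "real r * exp (?c * 1 powr (z - 1) * ?a powr (z - 1)) = exp (ln (real r) + z * (?c * energy z r (unif r)))"
  proof -
    have "z * energy z r (unif r) = ?a powr (z - 1)"
      using z r1 energy_unif[OF r1, of z] by (simp add: powr_divide powr_minus_divide[symmetric])
    then have "z * (?c * energy z r (unif r)) = ?c * ?a powr (z - 1)"
      unfolding mult.left_commute[of z ?c] by (rule arg_cong)
    then show ?thesis unfolding exp_add using r1 by (simp only: exp_ln of_nat_0_less_iff powr_one_eq_one mult_1_right)
  qed
  ultimately have "(\<lambda>N. real r * exp (B N * ?a powr (z - 1))) \<longlonglongrightarrow> exp (ln (real r) + z * (?c * energy z r (unif r)))" by simp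
  then have "\<forall>\<^sub>F N in sequentially. exp (ln (real r) + z * (?c * energy z r (unif r))) - \<theta> * G / 2 < real r * exp (B N * ?a powr (z - 1))"
    using \<theta> G by (intro order_tendstoD(1)) auto
  then have "\<forall>\<^sub>F N in sequentially. exp (ln (real r) + z * (?c * energy z r (unif r))) + \<theta> * G / 2 \<le> partition_ratio z ?c N r (N - 1)"
    using ev eventually_ge_at_top[of 2]
  proof eventually_elim
    case (elim N)
    show ?case using lb[OF elim(3,2)] elim(1) by linarith
  qed
  then show ?thesis using \<theta> G by (intro exI[of _ "\<theta> * G / 2"]) auto
qed

section \<open>The jump of the ratio and the fuzzy model\<close>

lemma critical_mass:
  fixes z c \<beta> :: real
  assumes z: "1 < z" and c: "0 < c" "c \<le> \<beta>"
  defines "v \<equiv> (c / \<beta>) powr (1 / (z - 1))"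
  shows "0 < v" "v \<le> 1" "\<beta> * v powr (z - 1) = c" "v = 1 \<Longrightarrow> \<beta> = c"
proof -
  have b: "0 < \<beta>" using c by simp
  show "0 < v" using c b by (simp add: v_def)
  have "\<bar>c / \<beta>\<bar> \<le> 1" using c b by simp
  then show "v \<le> 1" unfolding v_def using z by (intro powr_le1) auto
  have "v powr (z - 1) = c / \<beta>" using z c b by (simp add: v_def powr_powr)
  then show e: "\<beta> * v powr (z - 1) = c" using b by simp
  show "\<beta> = c" if "v = 1" using e that by simp
qed

text \<open>Below the critical fraction \<open>v\<close> the ratio stays near or under
  \<open>exp L\<close>, its disordered value; an ordered maximiser forces it above that value beyond
  \<open>v\<close>. The condition \<open>n2 < N\<close> is what makes \<open>n2\<close> the count of
  a class among \<open>N - 1\<close> conditioning sites.\<close>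

lemma partition_ratio_jump:
  assumes z: "2 < z" and r: "2 \<le> r" and s: "crit z r * (z - 1) * (1 / real r) powr (z - 1) < 1"
    and \<beta>: "crit z r \<le> \<beta>"
  shows "\<exists>v. 0 \<le> v \<and> v \<le> 1 \<and> (\<exists>\<kappa>>0. \<forall>\<epsilon>>0. \<forall>\<^sub>F N in sequentially. \<exists>n1 n2. n1 < n2 \<and> n2 < N \<and>
     \<bar>real n1 / real N - v\<bar> < \<epsilon> \<and> \<bar>real n2 / real N - v\<bar> < \<epsilon> \<and>
     partition_ratio z \<beta> N r n1 + \<kappa> \<le> partition_ratio z \<beta> N r n2)"
proof -
  let ?c = "crit z r" and ?E = "energy z r (unif r)"
  have z1: "1 < z" and r1: "1 \<le> r" using z r by auto
  have c0: "0 < ?c" by (rule crit_pos[OF z1 r])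
  have b0: "0 \<le> \<beta>" using c0 \<beta> by simp
  define v where "v = (?c / \<beta>) powr (1 / (z - 1))"
  note v = critical_mass[OF z1 c0 \<beta>, folded v_def]
  define L where "L = ln (real r) + z * (?c * ?E)"
  have lower: "\<forall>\<^sub>F N in sequentially. \<bar>real (nat \<lfloor>w * real N\<rfloor>) / real N - v\<bar> < \<epsilon> \<and>
      partition_ratio z \<beta> N r (nat \<lfloor>w * real N\<rfloor>) < exp L + \<kappa>"
    if w: "0 < w" "w < v" "v - w < \<epsilon>" and \<kappa>: "0 < \<kappa>" for w \<epsilon> \<kappa>
  proof (rule eventually_conj)
    have "0 \<le> w" using w by simp
    note n = tendsto_nat_floor_div[OF this]
    have "((\<lambda>N. \<bar>real (nat \<lfloor>w * real N\<rfloor>) / real N - v\<bar>) \<longlonglongrightarrow> \<bar>w - v\<bar>)"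
      by (intro tendsto_rabs tendsto_diff n tendsto_const)
    then show "\<forall>\<^sub>F N in sequentially. \<bar>real (nat \<lfloor>w * real N\<rfloor>) / real N - v\<bar> < \<epsilon>"
      using w by (intro order_tendstoD(2)) auto
    have "w powr (z - 1) < v powr (z - 1)" using w z by (intro powr_less_mono2) auto
    moreover have "0 < \<beta>" using c0 \<beta> by simp
    ultimately have "\<beta> * w powr (z - 1) < \<beta> * v powr (z - 1)" by simp
    then have bw: "\<beta> * w powr (z - 1) < ?c" using v(3) by simp
    note lim = partition_ratio_tendsto[OF z1 b0 r1 w(1) n pressure_deriv_disordered[OF z1 r1 w(1) disordered_crit[OF z1 r] bw]]
    have "z * (\<beta> * w powr (z - 1) * ?E) \<le> z * (?c * ?E)"
      using bw z energy_nonneg[of z r "unif r"] by (intro mult_left_mono mult_right_mono) auto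
    then have "exp (ln (real r) + z * (\<beta> * w powr (z - 1) * ?E)) \<le> exp L" by (simp add: L_def)
    then have "exp (ln (real r) + z * (\<beta> * w powr (z - 1) * ?E)) < exp L + \<kappa>" using \<kappa> by linarith
    then show "\<forall>\<^sub>F N in sequentially. partition_ratio z \<beta> N r (nat \<lfloor>w * real N\<rfloor>) < exp L + \<kappa>"
      by (rule order_tendstoD(2)[OF lim])
  qed
  have "\<exists>\<kappa>>0. \<forall>\<epsilon>>0. \<exists>m. \<forall>\<^sub>F N in sequentially. m N < N \<and> \<bar>real (m N) / real N - v\<bar> < \<epsilon> \<and>
      exp L + 2 * \<kappa> \<le> partition_ratio z \<beta> N r (m N)"
  \<comment> \<open>For \<open>v = 1\<close>, hence \<open>\<beta>\<close> critical, slopes to the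
    right of \<open>v\<close> concern only \<open>n > N\<close>, so the jump must already show at
    \<open>n = N - 1\<close>.\<close>
  proof (cases "v = 1")
    case True
    then have bc: "\<beta> = ?c" by (rule v(4))
    obtain \<kappa> where \<kappa>: "0 < \<kappa>" "\<forall>\<^sub>F N in sequentially. exp L + \<kappa> \<le> partition_ratio z ?c N r (N - 1)"
      using partition_ratio_endpoint_gap[OF z r s] unfolding L_def by blast
    show ?thesis
    proof (intro exI[of _ "\<kappa> / 2"] conjI allI impI exI[of _ "\<lambda>N. N - 1"])
      show "0 < \<kappa> / 2" using \<kappa> by simp
      fix \<epsilon> :: real assume e: "0 < \<epsilon>"
      have "\<forall>\<^sub>F N in sequentially. 1 / real N < \<epsilon>" using lim_1_over_n e by (rule order_tendstoD(2))
      then show "\<forall>\<^sub>F N in sequentially. N - 1 < N \<and> \<bar>real (N - 1) / real N - v\<bar> < \<epsilon> \<and>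
          exp L + 2 * (\<kappa> / 2) \<le> partition_ratio z \<beta> N r (N - 1)"
        using \<kappa>(2) eventually_gt_at_top[of 0]
      proof eventually_elim
        case (elim N)
        have "real (N - 1) / real N - v = - (1 / real N)" using elim True by (simp add: of_nat_diff field_simps)
        then show ?case using elim bc by simp
      qed
    qed
  next
    case False
    then have v1: "v < 1" using v(2) by simp
    obtain x where x: "x \<in> prob_simplex r" "x \<noteq> unif r" "free_energy z r ?c x = free_energy z r ?c (unif r)"
      using nonuniform_maximizer[OF z1 r s] by blast
    \<comment> \<open>The slope at \<open>v\<close> of
      \<open>w * (\<beta> * w powr (z - 1) * energy z r x + entropy r x)\<close>, a minorant of the
      pressure touching it at \<open>v\<close>. Equality of the free energies of \<open>x\<close>
      and the uniform point leaves \<open>L' - L\<close> as a multiple of their energy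
      difference.\<close>
    define L' where "L' = z * (?c * energy z r x) + entropy r x"
    have "?E < energy z r x" by (rule energy_unif_less[OF z1 x(1) r1 x(2)])
    then have "0 < (z - 1) * (?c * (energy z r x - ?E))" using z c0 by simp
    moreover have "L' - L = (z - 1) * (?c * (energy z r x - ?E))"
      using x(3) unfolding L'_def L_def free_energy_unif[OF r1] by (simp add: free_energy_def algebra_simps)
    ultimately have LL: "L < L'" by simp
    \<comment> \<open>The midpoint of \<open>L\<close> and \<open>L'\<close> gives a strict slope
      inequality; halving leaves one \<open>\<kappa>\<close> for the error of the lower sequence and
      one for the jump.\<close>
    define \<kappa> where "\<kappa> = (exp ((L + L') / 2) - exp L) / 2"
    have \<kappa>: "0 < \<kappa>" using LL by (simp add: \<kappa>_def field_simps)
    show ?thesis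
    proof (intro exI[of _ \<kappa>] conjI allI impI \<kappa>)
      fix \<epsilon> :: real assume e: "0 < \<epsilon>"
      obtain w where w: "v < w" "w < min 1 (v + \<epsilon>)" using dense[of v "min 1 (v + \<epsilon>)"] v1 e by auto
      have w0: "0 \<le> w" using v(1) w(1) by simp
      note n = tendsto_nat_floor_div[OF w0]
      have "L' \<le> (pressure z \<beta> r w - pressure z \<beta> r v) / (w - v)"
      proof -
        have pv: "pressure z \<beta> r v = v * (?c * energy z r x + entropy r x)"
          using disordered_crit[OF z1 r] disordered_iff[OF z1 r1, of ?c] x(3) free_energy_unif[OF r1, of z ?c]
          by (simp add: pressure_def v(3) free_energy_def)
        have pw: "w * (\<beta> * w powr (z - 1) * energy z r x + entropy r x) \<le> pressure z \<beta> r w"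
          unfolding pressure_def using max_free_energy_attained(2)[OF z1 r1 x(1), of "\<beta> * w powr (z - 1)"] w0
          by (intro mult_left_mono) (auto simp: free_energy_def)
        have e1: "t powr z = t * t powr (z - 1)" if "0 < t" for t using that powr_add[of t 1 "z - 1"] by simp
        have "v powr z + z * v powr (z - 1) * (w - v) \<le> w powr z"
          using v(1) w0 by (intro powr_tangent z1) auto
        then have "\<beta> * energy z r x * (v powr z + z * v powr (z - 1) * (w - v)) \<le> \<beta> * energy z r x * w powr z"
          using b0 energy_nonneg[of z r x] z by (intro mult_left_mono) auto
        moreover have "\<beta> * energy z r x * (v powr z + z * v powr (z - 1) * (w - v))
            = v * (?c * energy z r x) + z * (?c * energy z r x) * (w - v)"
          unfolding e1[OF v(1)] v(3)[symmetric] by (simp add: algebra_simps)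
        moreover have "\<beta> * energy z r x * w powr z = w * (\<beta> * w powr (z - 1) * energy z r x)"
          using e1[of w] v(1) w(1) by simp
        ultimately have "v * (?c * energy z r x) + z * (?c * energy z r x) * (w - v) \<le> w * (\<beta> * w powr (z - 1) * energy z r x)"
          by simp
        then have "L' * (w - v) \<le> pressure z \<beta> r w - pressure z \<beta> r v"
          using pw unfolding pv L'_def by (simp add: algebra_simps)
        then show ?thesis using w(1) by (simp add: pos_le_divide_eq)
      qed
      moreover have "(L + L') / 2 < L'" using LL by (simp add: field_simps)
      ultimately have "(L + L') / 2 < (pressure z \<beta> r w - pressure z \<beta> r v) / (w - v)" by linarith
      then have "\<forall>\<^sub>F N in sequentially. (L + L') / 2 < ln (partition_ratio z \<beta> N r (nat \<lfloor>w * real N\<rfloor>))"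
        using v(1) w(1) by (intro partition_ratio_eventually_greater[OF z1 b0 r1 _ _ n]) auto
      moreover have "\<forall>\<^sub>F N in sequentially. real (nat \<lfloor>w * real N\<rfloor>) / real N < 1"
        using w by (intro order_tendstoD(2)[OF n]) auto
      moreover have "\<forall>\<^sub>F N in sequentially. \<bar>real (nat \<lfloor>w * real N\<rfloor>) / real N - v\<bar> < \<epsilon>"
      proof -
        have "((\<lambda>N. \<bar>real (nat \<lfloor>w * real N\<rfloor>) / real N - v\<bar>) \<longlonglongrightarrow> \<bar>w - v\<bar>)"
          by (intro tendsto_rabs tendsto_diff n tendsto_const)
        then show ?thesis using w by (intro order_tendstoD(2)) auto
      qed
      ultimately have "\<forall>\<^sub>F N in sequentially. nat \<lfloor>w * real N\<rfloor> < N \<and> \<bar>real (nat \<lfloor>w * real N\<rfloor>) / real N - v\<bar> < \<epsilon> \<and>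
          exp L + 2 * \<kappa> \<le> partition_ratio z \<beta> N r (nat \<lfloor>w * real N\<rfloor>)"
        using eventually_gt_at_top[of 0]
      proof eventually_elim
        case (elim N)
        have "exp ((L + L') / 2) \<le> exp (ln (partition_ratio z \<beta> N r (nat \<lfloor>w * real N\<rfloor>)))"
          using elim(1) by simp
        then have "exp ((L + L') / 2) \<le> partition_ratio z \<beta> N r (nat \<lfloor>w * real N\<rfloor>)"
          by (simp add: partition_ratio_pos[OF r1])
        moreover have "a + 2 * ((b - a) / 2) = b" for a b :: real by (simp add: field_simps)
        then have "exp L + 2 * \<kappa> = exp ((L + L') / 2)" unfolding \<kappa>_def .
        moreover have "nat \<lfloor>w * real N\<rfloor> < N" using elim(2,4) by (simp add: pos_divide_less_eq)
        ultimately show ?case using elim(3) by (simp only:)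
      qed
      then show "\<exists>m. \<forall>\<^sub>F N in sequentially. m N < N \<and> \<bar>real (m N) / real N - v\<bar> < \<epsilon> \<and>
          exp L + 2 * \<kappa> \<le> partition_ratio z \<beta> N r (m N)"
        by (intro exI[of _ "\<lambda>N. nat \<lfloor>w * real N\<rfloor>"])
    qed
  qed
  then obtain \<kappa> where \<kappa>: "0 < \<kappa>" and upper: "\<And>\<epsilon>. 0 < \<epsilon> \<Longrightarrow> \<exists>m. \<forall>\<^sub>F N in sequentially. m N < N \<and> \<bar>real (m N) / real N - v\<bar> < \<epsilon> \<and>
      exp L + 2 * \<kappa> \<le> partition_ratio z \<beta> N r (m N)" by blast
  have "\<forall>\<^sub>F N in sequentially. \<exists>n1 n2. n1 < n2 \<and> n2 < N \<and> \<bar>real n1 / real N - v\<bar> < \<epsilon> \<and> \<bar>real n2 / real N - v\<bar> < \<epsilon> \<and>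
     partition_ratio z \<beta> N r n1 + \<kappa> \<le> partition_ratio z \<beta> N r n2" if e: "0 < \<epsilon>" for \<epsilon>
  proof -
    obtain m where m: "\<forall>\<^sub>F N in sequentially. m N < N \<and> \<bar>real (m N) / real N - v\<bar> < \<epsilon> \<and>
      exp L + 2 * \<kappa> \<le> partition_ratio z \<beta> N r (m N)" using upper[OF e] by blast
    obtain w where w: "max 0 (v - \<epsilon>) < w" "w < v" using dense[of "max 0 (v - \<epsilon>)" v] v(1) e by auto
    have w': "0 < w" "v - w < \<epsilon>" using w(1) by auto
    show ?thesis using lower[OF w'(1) w(2) w'(2) \<kappa>] m
    proof eventually_elim
      case (elim N)
      let ?n1 = "nat \<lfloor>w * real N\<rfloor>"
      \<comment> \<open>The two site numbers come from separate constructions; monotonicity of the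
        ratio puts them in order.\<close>
      have "partition_ratio z \<beta> N r ?n1 < partition_ratio z \<beta> N r (m N)" using elim \<kappa> by linarith
      then have "?n1 < m N"
        using partition_ratio_mono[OF z1 b0 r1, of "m N" ?n1 N] by (metis not_le)
      then show ?case using elim by (intro exI[of _ ?n1] exI[of _ "m N"]) auto
    qed
  qed
  then show ?thesis using v(1,2) \<kappa> by (intro exI[of _ v]) auto
qed

section \<open>Factorisation of the fuzzy measure over the classes\<close>

lemma fuzzy_map_fiber:
  assumes "l \<in> {1..s}" and q: "sum r {1..s} = q"
  shows "{k\<in>{1..q}. fuzzy_map s r k = l} = {sum r {1..<l}<..sum r {1..l}}"
    and "k \<in> {1..q} \<Longrightarrow> fuzzy_map s r k \<in> {1..s}"
proof -
  have mono: "sum r {1..i} \<le> sum r {1..j}" if "i \<le> j" for i j :: nat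
    using that by (intro sum_mono2) auto
  have lt: "sum r {1..<j} = sum r {1..j - 1}" if "1 \<le> j" for j :: nat
    using that by (intro sum.cong) auto
  have ex1: "\<exists>!l. l \<in> {1..s} \<and> sum r {1..<l} < k \<and> k \<le> sum r {1..l}" if k: "k \<in> {1..q}" for k
  proof
    define l where "l = (LEAST l. k \<le> sum r {1..l})"
    have ks: "k \<le> sum r {1..s}" using k q by simp
    have le: "k \<le> sum r {1..l}" unfolding l_def by (rule LeastI[of "\<lambda>l. k \<le> sum r {1..l}" s, OF ks])
    have "l \<le> s" unfolding l_def by (rule Least_le[of "\<lambda>l. k \<le> sum r {1..l}" s, OF ks])
    moreover have l1: "1 \<le> l" using le k by (cases l) auto
    moreover have "\<not> k \<le> sum r {1..l - 1}"
      by (rule not_less_Least[of "l - 1" "\<lambda>l. k \<le> sum r {1..l}", folded l_def]) (use l1 in simp)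
    ultimately show "l \<in> {1..s} \<and> sum r {1..<l} < k \<and> k \<le> sum r {1..l}" using le lt[OF l1] by auto
    fix l' assume l': "l' \<in> {1..s} \<and> sum r {1..<l'} < k \<and> k \<le> sum r {1..l'}"
    show "l' = l"
    proof (rule linorder_cases[of l' l])
      assume "l' < l"
      then have "sum r {1..l'} \<le> sum r {1..l - 1}" by (intro mono) simp
      then show ?thesis using l' \<open>\<not> k \<le> sum r {1..l - 1}\<close> by simp
    next
      assume "l < l'"
      then have "sum r {1..l} \<le> sum r {1..l' - 1}" by (intro mono) simp
      then show ?thesis using l' le lt[of l'] by simp
    qed simp
  qed
  have iff: "fuzzy_map s r k = l' \<longleftrightarrow> l' \<in> {1..s} \<and> sum r {1..<l'} < k \<and> k \<le> sum r {1..l'}" if "k \<in> {1..q}" for k l'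
    unfolding fuzzy_map_def using theI'[OF ex1[OF that]] ex1[OF that] by blast
  have "sum r {1..l} \<le> q" unfolding q[symmetric] using assms(1) by (intro mono) simp
  then have "k \<in> {1..q}" if "sum r {1..<l} < k" "k \<le> sum r {1..l}" for k using that by simp
  then show "{k\<in>{1..q}. fuzzy_map s r k = l} = {sum r {1..<l}<..sum r {1..l}}"
    unfolding set_eq_iff mem_Collect_eq greaterThanAtMost_iff using iff assms(1) by blast
  show "fuzzy_map s r k \<in> {1..s}" if "k \<in> {1..q}" using iff[OF that] by blast
qed

lemma fuzzy_prob_eq:
  assumes q: "sum r {1..s} = q" and ys: "set ys \<subseteq> {1..s}"
  shows "fuzzy_prob q s r z \<beta> ys =
    (\<Prod>l\<in>{1..s}. partition_fun z \<beta> (length ys) (r l) (count_list ys l)) / potts_Z q z \<beta> (length ys)"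
proof -
  let ?T = "fuzzy_map s r" and ?N = "length ys"
  let ?X = "{xs\<in>configs ?N {1..q}. map ?T xs = ys}"
  have "fuzzy_prob q s r z \<beta> ys = (\<Sum>xs\<in>?X. (\<Prod>i\<in>{1..q}. spin_weight z \<beta> ?N (count_list xs i)) / potts_Z q z \<beta> ?N)"
    unfolding fuzzy_prob_def
    by (intro sum.cong refl) (auto simp: potts_prob_def potts_weight_prod configs_def)
  also have "\<dots> = (\<Sum>xs\<in>?X. \<Prod>i\<in>{1..q}. spin_weight z \<beta> ?N (count_list xs i)) / potts_Z q z \<beta> ?N"
    by (rule sum_divide_distrib[symmetric])
  also have "(\<Sum>xs\<in>?X. \<Prod>i\<in>{1..q}. spin_weight z \<beta> ?N (count_list xs i))
      = (\<Prod>l\<in>{1..s}. wsum {i\<in>{1..q}. ?T i = l} (\<lambda>_. spin_weight z \<beta> ?N) (count_list ys l))"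
  proof (rule fiber_sum)
    show "?T ` {1..q} \<subseteq> {1..s}"
    proof
      fix l assume "l \<in> ?T ` {1..q}"
      then obtain k where k: "k \<in> {1..q}" "l = ?T k" by blast
      then have "1 \<le> s" using q by (cases s) auto
      then show "l \<in> {1..s}" using fuzzy_map_fiber(2)[of 1 s r q k] q k by simp
    qed
  qed (use ys in auto)
  also have "\<dots> = (\<Prod>l\<in>{1..s}. partition_fun z \<beta> ?N (r l) (count_list ys l))"
  proof (intro prod.cong refl)
    fix l assume l: "l \<in> {1..s}"
    let ?F = "{i\<in>{1..q}. ?T i = l}"
    have l1: "{1..l} = insert l {1..<l}" using l by auto
    have "sum r {1..l} = r l + sum r {1..<l}" unfolding l1 by simp
    then have "card ?F = r l" unfolding fuzzy_map_fiber(1)[OF l q] card_greaterThanAtMost by simp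
    then obtain f where "bij_betw f {1..r l} ?F"
      using ex_bij_betw_nat_finite_1[of ?F] by auto
    then show "wsum ?F (\<lambda>_. spin_weight z \<beta> ?N) (count_list ys l) = partition_fun z \<beta> ?N (r l) (count_list ys l)"
      unfolding partition_fun_def by (rule wsum_transport[symmetric])
  qed
  finally show ?thesis .
qed

text \<open>Appending a site of class \<open>l\<close> changes only the factor of that class, and
  everything common to all \<open>l\<close> cancels. The scale of the interaction is
  \<open>Suc n\<close>, although only \<open>n\<close> sites are conditioned on.\<close>

lemma fuzzy_cond_eq:
  assumes q: "sum r {1..s} = q" and r: "\<forall>i\<in>{1..s}. 0 < r i" and k: "k \<in> {1..s}" and \<eta>: "\<eta> \<in> configs n {1..s}"
  shows "fuzzy_cond q s r z \<beta> k \<eta> = partition_ratio z \<beta> (Suc n) (r k) (count_list \<eta> k) /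
    (\<Sum>l\<in>{1..s}. partition_ratio z \<beta> (Suc n) (r l) (count_list \<eta> l))"
proof -
  let ?N = "Suc n" and ?Z = "potts_Z q z \<beta> (Suc n)"
  define P where "P = (\<Prod>l\<in>{1..s}. partition_fun z \<beta> ?N (r l) (count_list \<eta> l))"
  have r1: "1 \<le> r l" if "l \<in> {1..s}" for l using r that by (simp add: Suc_leI)
  have P: "0 < P" unfolding P_def using r1 by (intro prod_pos partition_fun_pos) auto
  have "r k \<le> q" unfolding q[symmetric] using k by (intro member_le_sum) auto
  then have q1: "1 \<le> q" using r1[OF k] by simp
  have Z: "0 < ?Z" unfolding potts_Z_eq by (rule partition_fun_pos[OF q1])
  have \<eta>': "length \<eta> = n" "set \<eta> \<subseteq> {1..s}" using \<eta> by (auto simp: configs_def)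
  have step: "fuzzy_prob q s r z \<beta> (\<eta> @ [l]) = P / ?Z * partition_ratio z \<beta> ?N (r l) (count_list \<eta> l)"
    if l: "l \<in> {1..s}" for l
  proof -
    let ?A = "\<lambda>i m. partition_fun z \<beta> ?N (r i) m"
    have "fuzzy_prob q s r z \<beta> (\<eta> @ [l]) = (\<Prod>i\<in>{1..s}. ?A i (count_list (\<eta> @ [l]) i)) / ?Z"
      using fuzzy_prob_eq[OF q, of "\<eta> @ [l]"] \<eta>' l by simp
    also have "(\<Prod>i\<in>{1..s}. ?A i (count_list (\<eta> @ [l]) i)) = ?A l (Suc (count_list \<eta> l)) * (\<Prod>i\<in>{1..s} - {l}. ?A i (count_list \<eta> i))"
    proof -
      have "(\<Prod>i\<in>{1..s}. ?A i (count_list (\<eta> @ [l]) i)) = ?A l (count_list (\<eta> @ [l]) l) * (\<Prod>i\<in>{1..s} - {l}. ?A i (count_list (\<eta> @ [l]) i))"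
        using l by (intro prod.remove) auto
      moreover have "(\<Prod>i\<in>{1..s} - {l}. ?A i (count_list (\<eta> @ [l]) i)) = (\<Prod>i\<in>{1..s} - {l}. ?A i (count_list \<eta> i))"
        by (intro prod.cong) auto
      ultimately show ?thesis by simp
    qed
    also have "\<dots> = P * partition_ratio z \<beta> ?N (r l) (count_list \<eta> l)"
    proof -
      have "P = ?A l (count_list \<eta> l) * (\<Prod>i\<in>{1..s} - {l}. ?A i (count_list \<eta> i))"
        unfolding P_def using l by (intro prod.remove) auto
      then show ?thesis
        using partition_fun_pos[OF r1[OF l], of z \<beta> ?N "count_list \<eta> l"] by (simp add: partition_ratio_def)
    qed
    finally show ?thesis by simp
  qed
  have "(\<Sum>l\<in>{1..s}. fuzzy_prob q s r z \<beta> (\<eta> @ [l])) = P / ?Z * (\<Sum>l\<in>{1..s}. partition_ratio z \<beta> ?N (r l) (count_list \<eta> l))"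
    unfolding sum_distrib_left by (intro sum.cong refl step)
  then show ?thesis unfolding fuzzy_cond_def step[OF k] using P Z by simp
qed

text \<open>The representative picked by \<open>SOME\<close> does not matter: on the positive number
  \<open>N - 1\<close> of sites the empirical distribution determines all counts.\<close>

lemma QN_eq:
  assumes q: "sum r {1..s} = q" and r: "\<forall>i\<in>{1..s}. 0 < r i" and k: "k \<in> {1..s}"
    and N: "2 \<le> N" and \<eta>: "\<eta> \<in> configs (N - 1) {1..s}"
  shows "QN q s r z \<beta> N k (emp \<eta>) = partition_ratio z \<beta> N (r k) (count_list \<eta> k) /
    (\<Sum>l\<in>{1..s}. partition_ratio z \<beta> N (r l) (count_list \<eta> l))"
proof -
  define \<eta>' where "\<eta>' = (SOME \<eta>'. \<eta>' \<in> configs (N - 1) {1..s} \<and> emp \<eta>' = emp \<eta>)"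
  have "\<exists>\<eta>'. \<eta>' \<in> configs (N - 1) {1..s} \<and> emp \<eta>' = emp \<eta>" using \<eta> by blast
  then have \<eta>': "\<eta>' \<in> configs (N - 1) {1..s}" "emp \<eta>' = emp \<eta>"
    unfolding \<eta>'_def using someI_ex[of "\<lambda>\<eta>'. \<eta>' \<in> configs (N - 1) {1..s} \<and> emp \<eta>' = emp \<eta>"] by auto
  have "count_list \<eta>' i = count_list \<eta> i" for i
    using fun_cong[OF \<eta>'(2), of i] \<eta>'(1) \<eta> N by (simp add: emp_def configs_def)
  moreover have "Suc (N - 1) = N" using N by simp
  ultimately show ?thesis
    unfolding QN_def \<eta>'_def[symmetric] using fuzzy_cond_eq[OF q r k \<eta>'(1), of z \<beta>] by simp
qed

section \<open>Limiting conditional probabilities\<close>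

lemma tendsto_fun_iff:
  fixes f :: "'c \<Rightarrow> 'a \<Rightarrow> 'b::topological_space"
  shows "(f \<longlongrightarrow> l) F \<longleftrightarrow> (\<forall>i. ((\<lambda>c. f c i) \<longlongrightarrow> l i) F)"
  using limitin_componentwise[of "\<lambda>_. euclidean" UNIV f l F]
  by (simp add: euclidean_product_topology)

lemma exists_config_counts:
  "\<exists>\<eta>\<in>configs (\<Sum>l\<in>{1..s}. m l) {1..s}. \<forall>l\<in>{1..s}. count_list \<eta> l = m l"
proof (induction s)
  case (Suc s)
  then obtain \<eta> where \<eta>: "\<eta> \<in> configs (\<Sum>l\<in>{1..s}. m l) {1..s}" "\<forall>l\<in>{1..s}. count_list \<eta> l = m l" by blast
  define \<eta>' where "\<eta>' = replicate (m (Suc s)) (Suc s) @ \<eta>"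
  have cr: "count_list (replicate k a) b = (if a = b then k else 0)" for k and a b :: nat
    by (induction k) auto
  have "count_list \<eta> (Suc s) = 0" using \<eta>(1) by (auto simp: configs_def count_list_0_iff)
  then have "\<forall>l\<in>{1..Suc s}. count_list \<eta>' l = m l"
    using \<eta>(2) by (auto simp: \<eta>'_def cr le_Suc_eq)
  moreover have "\<eta>' \<in> configs (\<Sum>l\<in>{1..Suc s}. m l) {1..Suc s}"
    using \<eta>(1) by (auto simp: configs_def \<eta>'_def)
  ultimately show ?case by blast
qed simp

lemma emp_config_tendsto:
  assumes \<nu>: "\<nu> \<in> prob_simplex s" and \<eta>: "\<And>N. \<eta> N \<in> configs (N - 1) {1..s}"
    and lim: "\<And>l. l \<in> {1..s} \<Longrightarrow> (\<lambda>N. real (count_list (\<eta> N) l) / real (N - 1)) \<longlonglongrightarrow> \<nu> l"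
  shows "(\<lambda>N. emp (\<eta> N)) \<longlonglongrightarrow> \<nu>"
  unfolding tendsto_fun_iff
proof
  fix i
  have len: "length (\<eta> N) = N - 1" "set (\<eta> N) \<subseteq> {1..s}" for N using \<eta>[of N] by (auto simp: configs_def)
  show "(\<lambda>N. emp (\<eta> N) i) \<longlonglongrightarrow> \<nu> i"
  proof (cases "i \<in> {1..s}")
    case True
    then show ?thesis using lim[OF True] by (simp add: emp_def len)
  next
    case False
    then have "count_list (\<eta> N) i = 0" for N using len(2)[of N] by (auto simp: count_list_0_iff)
    then show ?thesis using prob_simplexD(3)[OF \<nu> False] by (simp add: emp_def)
  qed
qed

text \<open>All coordinates but the first are rounded down, and the first receives what is left, so
  that the counts add up to the number of sites.\<close>

lemma admissible_sequence_exists: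
  assumes \<nu>: "\<nu> \<in> prob_simplex s"
  shows "\<exists>\<mu>. (\<forall>N. admissible s N (\<mu> N)) \<and> \<mu> \<longlonglongrightarrow> \<nu>"
proof -
  have s1: "1 \<le> s" using prob_simplexD(4)[OF \<nu>] by (cases s) auto
  have split: "sum f {1..s} = f 1 + sum f {2..s}" for f :: "nat \<Rightarrow> 'b::comm_monoid_add"
    using s1 by (simp add: sum.atLeast_Suc_atMost numeral_2_eq_2)
  define h where "h n l = nat \<lfloor>\<nu> l * real n\<rfloor>" for n l
  define m where "m n l = (if l = 1 then n - (\<Sum>l\<in>{2..s}. h n l) else h n l)" for n l
  have hl: "real (h n l) \<le> \<nu> l * real n" for n l
    using prob_simplexD(1)[OF \<nu>, of l] by (simp add: h_def)
  have hsum: "(\<Sum>l\<in>{2..s}. h n l) \<le> n" for n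
  proof -
    have "real (\<Sum>l\<in>{2..s}. h n l) \<le> (\<Sum>l\<in>{2..s}. \<nu> l) * real n"
      unfolding of_nat_sum sum_distrib_right by (intro sum_mono hl)
    also have "\<dots> \<le> 1 * real n"
      using split[of \<nu>] prob_simplexD(1)[OF \<nu>, of 1] prob_simplexD(4)[OF \<nu>] by (intro mult_right_mono) linarith+
    finally show ?thesis by (simp only: mult_1_left of_nat_le_iff)
  qed
  have msum: "(\<Sum>l\<in>{1..s}. m n l) = n" for n
  proof -
    have "(\<Sum>l\<in>{2..s}. m n l) = (\<Sum>l\<in>{2..s}. h n l)" by (intro sum.cong) (auto simp: m_def)
    then show ?thesis unfolding split using hsum[of n] by (simp add: m_def)
  qed
  have "\<exists>\<eta>\<in>configs (N - 1) {1..s}. \<forall>l\<in>{1..s}. count_list \<eta> l = m (N - 1) l" for N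
    using exists_config_counts[of "m (N - 1)" s] unfolding msum .
  then obtain \<eta> where \<eta>: "\<And>N. \<eta> N \<in> configs (N - 1) {1..s}" "\<And>N l. l \<in> {1..s} \<Longrightarrow> count_list (\<eta> N) l = m (N - 1) l"
    by metis
  have hlim: "(\<lambda>n. real (h n l) / real n) \<longlonglongrightarrow> \<nu> l" for l
    unfolding h_def by (rule tendsto_nat_floor_div[OF prob_simplexD(1)[OF \<nu>]])
  have mlim: "(\<lambda>n. real (m n l) / real n) \<longlonglongrightarrow> \<nu> l" if l: "l \<in> {1..s}" for l
  proof (cases "l = 1")
    case True
    have "(\<lambda>n. 1 - (\<Sum>l\<in>{2..s}. real (h n l) / real n)) \<longlonglongrightarrow> 1 - (\<Sum>l\<in>{2..s}. \<nu> l)"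
      by (intro tendsto_diff tendsto_const tendsto_sum hlim)
    moreover have "1 - (\<Sum>l\<in>{2..s}. \<nu> l) = \<nu> l"
      using split[of \<nu>] prob_simplexD(4)[OF \<nu>] True by simp
    ultimately have "(\<lambda>n. 1 - (\<Sum>l\<in>{2..s}. real (h n l) / real n)) \<longlonglongrightarrow> \<nu> l" by simp
    then show ?thesis
    proof (rule Lim_transform_eventually)
      show "\<forall>\<^sub>F n in sequentially. 1 - (\<Sum>l\<in>{2..s}. real (h n l) / real n) = real (m n l) / real n"
        using eventually_gt_at_top[of 0]
      proof eventually_elim
        case (elim n)
        have "real (m n l) = real n - real (\<Sum>l\<in>{2..s}. h n l)"
          using of_nat_diff[OF hsum[of n], where 'a = real] True by (simp only: m_def if_True simp_thms)
        then have "real (m n l) = real n - (\<Sum>l\<in>{2..s}. real (h n l))" by (simp only: of_nat_sum)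
        then show ?case unfolding sum_divide_distrib[symmetric] using elim
          by (simp only: diff_divide_distrib) simp
      qed
    qed
  qed (use hlim in \<open>simp add: m_def\<close>)
  have "(\<lambda>N. emp (\<eta> N)) \<longlonglongrightarrow> \<nu>"
  proof (rule emp_config_tendsto[OF \<nu> \<eta>(1)])
    fix l assume l: "l \<in> {1..s}"
    have "filterlim (\<lambda>N. N - 1) sequentially sequentially"
      by (rule filterlim_minus_const_nat_at_top)
    from filterlim_compose[OF mlim[OF l] this]
    show "(\<lambda>N. real (count_list (\<eta> N) l) / real (N - 1)) \<longlonglongrightarrow> \<nu> l" by (simp add: \<eta>(2)[OF l])
  qed
  moreover have "admissible s N (emp (\<eta> N))" for N unfolding admissible_def using \<eta>(1)[of N] by blast
  ultimately show ?thesis by (intro exI[of _ "\<lambda>N. emp (\<eta> N)"] conjI allI)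
qed

text \<open>Otherwise there are bad empirical distributions for arbitrarily large \<open>N\<close>,
  arbitrarily near \<open>\<nu>\<close>. Placed along a subsequence, with any admissible sequence
  tending to \<open>\<nu>\<close> in the remaining places, they form an admissible sequence that
  contradicts the limit.\<close>

lemma lcp_limit_uniform:
  assumes lcp: "lcp_limit_at q s r z \<beta> \<nu> Q" and \<nu>: "\<nu> \<in> prob_simplex s" and k: "k \<in> {1..s}" and e: "0 < e"
  shows "\<exists>\<delta>>0. \<exists>N0. \<forall>N\<ge>N0. \<forall>\<mu>. admissible s N \<mu> \<and> (\<forall>i\<in>{1..s}. \<bar>\<mu> i - \<nu> i\<bar> < \<delta>) \<longrightarrow> \<bar>QN q s r z \<beta> N k \<mu> - Q k\<bar> < e"
proof (rule ccontr)
  assume neg: "\<not> ?thesis"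
  define bad where "bad N \<mu> \<delta> \<longleftrightarrow> admissible s N \<mu> \<and> (\<forall>i\<in>{1..s}. \<bar>\<mu> i - \<nu> i\<bar> < \<delta>) \<and> e \<le> \<bar>QN q s r z \<beta> N k \<mu> - Q k\<bar>" for N \<mu> \<delta>
  have ex: "\<exists>N>N0. \<exists>\<mu>. bad N \<mu> \<delta>" if "0 < \<delta>" for \<delta> N0
  proof -
    have "\<not> (\<forall>N\<ge>Suc N0. \<forall>\<mu>. admissible s N \<mu> \<and> (\<forall>i\<in>{1..s}. \<bar>\<mu> i - \<nu> i\<bar> < \<delta>) \<longrightarrow> \<bar>QN q s r z \<beta> N k \<mu> - Q k\<bar> < e)"
      using neg that by blast
    then show ?thesis unfolding bad_def by (auto simp: not_less Suc_le_eq)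
  qed
  have "\<exists>f. \<forall>j. (\<exists>\<mu>. bad (f j) \<mu> (1 / real (Suc j))) \<and> f j < f (Suc j)"
  proof (rule dependent_nat_choice)
    show "\<exists>N. \<exists>\<mu>. bad N \<mu> (1 / real (Suc 0))" using ex[of 1 0] by auto
    show "\<exists>N'. (\<exists>\<mu>. bad N' \<mu> (1 / real (Suc (Suc j)))) \<and> N < N'" for N j
      using ex[of "1 / real (Suc (Suc j))" N] by auto
  qed
  then obtain f where f: "\<And>j. \<exists>\<mu>. bad (f j) \<mu> (1 / real (Suc j))" "\<And>j. f j < f (Suc j)" by blast
  have sm: "strict_mono f" using f(2) by (simp add: strict_mono_Suc_iff)
  from f(1) obtain g where g: "\<And>j. bad (f j) (g j) (1 / real (Suc j))" by metis
  obtain \<mu>0 where \<mu>0: "\<And>N. admissible s N (\<mu>0 N)" "\<mu>0 \<longlonglongrightarrow> \<nu>" using admissible_sequence_exists[OF \<nu>] by blast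
  define \<mu> where "\<mu> N = (if N \<in> range f then g (inv f N) else \<mu>0 N)" for N
  have inv: "inv f (f j) = j" for j using strict_mono_imp_inj_on[OF sm] by (simp add: inv_f_f)
  have \<mu>f: "\<mu> (f j) = g j" for j by (simp add: \<mu>_def inv)
  have adm: "admissible s N (\<mu> N)" for N
  proof (cases "N \<in> range f")
    case True
    then obtain j where "N = f j" by blast
    then show ?thesis using g[of j] by (simp add: \<mu>f bad_def)
  qed (simp add: \<mu>_def \<mu>0)
  have "\<mu> \<longlonglongrightarrow> \<nu>"
    unfolding tendsto_fun_iff
  proof
    fix i
    show "(\<lambda>N. \<mu> N i) \<longlonglongrightarrow> \<nu> i"
    proof (rule LIMSEQ_I)
      fix d :: real assume d: "0 < d"
      have "(\<lambda>N. \<mu>0 N i) \<longlonglongrightarrow> \<nu> i" using \<mu>0(2) unfolding tendsto_fun_iff by blast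
      from LIMSEQ_D[OF this d] obtain N1 where N1: "\<And>N. N1 \<le> N \<Longrightarrow> norm (\<mu>0 N i - \<nu> i) < d" by blast
      obtain j0 where j0: "1 / real (Suc j0) < d" using nat_approx_posE[OF d] by blast
      have "norm (\<mu> N i - \<nu> i) < d" if N: "max N1 (f j0) \<le> N" for N
      proof (cases "N \<in> range f")
        case True
        then obtain j where j: "N = f j" by blast
        have "j0 \<le> j" using N j strict_mono_less_eq[OF sm] by simp
        then have jd: "1 / real (Suc j) < d" using j0 by (intro le_less_trans[OF _ j0]) (simp add: frac_le)
        show ?thesis
        proof (cases "i \<in> {1..s}")
          case True
          then show ?thesis using g[of j] jd by (force simp: j \<mu>f bad_def)
        next
          case False
          \<comment> \<open>Coordinates outside \<open>{1..s}\<close> are not controlled by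
            \<open>bad\<close>; they vanish by admissibility.\<close>
          obtain \<eta> where \<eta>: "\<eta> \<in> configs (f j - 1) {1..s}" "emp \<eta> = g j"
            using g[of j] by (auto simp: bad_def admissible_def)
          have "i \<notin> set \<eta>" using \<eta>(1) False by (auto simp: configs_def)
          then have "emp \<eta> i = 0" by (simp add: emp_def count_list_0_iff)
          then have "g j i = 0" unfolding \<eta>(2) .
          then show ?thesis using prob_simplexD(3)[OF \<nu> False] d by (simp add: j \<mu>f)
        qed
      next
        case False
        then show ?thesis using N1[of N] N by (simp add: \<mu>_def)
      qed
      then show "\<exists>no. \<forall>N\<ge>no. norm (\<mu> N i - \<nu> i) < d" by blast
    qed
  qed
  then have "(\<lambda>N. QN q s r z \<beta> N k (\<mu> N)) \<longlonglongrightarrow> Q k" using lcp k adm unfolding lcp_limit_at_def by blast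
  from LIMSEQ_D[OF this e] obtain N1 where N1: "\<And>N. N1 \<le> N \<Longrightarrow> norm (QN q s r z \<beta> N k (\<mu> N) - Q k) < e" by blast
  have "N1 \<le> f N1" by (rule strict_mono_imp_increasing[OF sm])
  from N1[OF this] g[of N1] show False by (simp add: \<mu>f bad_def)
qed

text \<open>A limit shared by all admissible sequences controls \<open>QN\<close> on a whole
  neighbourhood of \<open>\<nu>\<close>. Approximating a nearby point by admissible distributions
  carries this estimate over to the limit there, which is continuity.\<close>

lemma fuzzy_gibbs_if_lcp_exists:
  assumes ex: "\<And>\<nu>. \<nu> \<in> prob_simplex s \<Longrightarrow> lcp_exists q s r z \<beta> \<nu>"
  shows "fuzzy_gibbs q s r z \<beta>"
  unfolding fuzzy_gibbs_def
proof (intro conjI ballI ex)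
  fix k assume k: "k \<in> {1..s}"
  have lcp: "lcp_limit_at q s r z \<beta> \<nu> (\<lambda>k. Qinf q s r z \<beta> \<nu> k)" if "\<nu> \<in> prob_simplex s" for \<nu>
    using someI_ex[of "lcp_limit_at q s r z \<beta> \<nu>"] ex[OF that] by (simp add: lcp_exists_def Qinf_def)
  show "continuous_on (prob_simplex s) (\<lambda>\<nu>. Qinf q s r z \<beta> \<nu> k)"
  proof (rule continuous_on_sequentiallyI)
    fix u :: "nat \<Rightarrow> nat \<Rightarrow> real" and \<nu> assume u: "\<forall>n. u n \<in> prob_simplex s" and \<nu>: "\<nu> \<in> prob_simplex s" and lim: "u \<longlonglongrightarrow> \<nu>"
    show "(\<lambda>n. Qinf q s r z \<beta> (u n) k) \<longlonglongrightarrow> Qinf q s r z \<beta> \<nu> k"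
    proof (rule LIMSEQ_I)
      fix e :: real assume e: "0 < e"
      then have e2: "0 < e / 2" by simp
      obtain \<delta> N0 where \<delta>: "0 < \<delta>" and N0: "\<And>N \<mu>. N0 \<le> N \<Longrightarrow> admissible s N \<mu> \<Longrightarrow> (\<And>i. i \<in> {1..s} \<Longrightarrow> \<bar>\<mu> i - \<nu> i\<bar> < \<delta>) \<Longrightarrow>
          \<bar>QN q s r z \<beta> N k \<mu> - Qinf q s r z \<beta> \<nu> k\<bar> < e / 2"
        using lcp_limit_uniform[OF lcp[OF \<nu>] \<nu> k e2] by blast
      have close: "\<forall>\<^sub>F c in F. \<forall>i\<in>{1..s}. \<bar>w c i - x i\<bar> < d"
        if "(w \<longlongrightarrow> x) F" "0 < d" for F and w :: "nat \<Rightarrow> nat \<Rightarrow> real" and x d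
      proof (rule eventually_ball_finite, simp, rule ballI)
        fix i
        have "((\<lambda>c. w c i) \<longlongrightarrow> x i) F" using that(1) unfolding tendsto_fun_iff by blast
        from tendstoD[OF this that(2)] show "\<forall>\<^sub>F c in F. \<bar>w c i - x i\<bar> < d" by (simp add: dist_real_def)
      qed
      have "\<forall>\<^sub>F n in sequentially. \<forall>i\<in>{1..s}. \<bar>u n i - \<nu> i\<bar> < \<delta> / 2"
        by (rule close[OF lim]) (use \<delta> in simp)
      then have "\<forall>\<^sub>F n in sequentially. norm (Qinf q s r z \<beta> (u n) k - Qinf q s r z \<beta> \<nu> k) < e"
      proof eventually_elim
        case (elim n)
        have un: "u n \<in> prob_simplex s" using u by blast
        obtain \<mu> where \<mu>: "\<And>N. admissible s N (\<mu> N)" "\<mu> \<longlonglongrightarrow> u n" using admissible_sequence_exists[OF un] by blast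
        have "(\<lambda>N. QN q s r z \<beta> N k (\<mu> N)) \<longlonglongrightarrow> Qinf q s r z \<beta> (u n) k"
          using lcp[OF un] k \<mu> unfolding lcp_limit_at_def by blast
        then have lim': "(\<lambda>N. \<bar>QN q s r z \<beta> N k (\<mu> N) - Qinf q s r z \<beta> \<nu> k\<bar>) \<longlonglongrightarrow> \<bar>Qinf q s r z \<beta> (u n) k - Qinf q s r z \<beta> \<nu> k\<bar>"
          by (intro tendsto_rabs tendsto_diff tendsto_const)
        have "\<forall>\<^sub>F N in sequentially. \<forall>i\<in>{1..s}. \<bar>\<mu> N i - u n i\<bar> < \<delta> / 2"
          by (rule close[OF \<mu>(2)]) (use \<delta> in simp)
        then have "\<forall>\<^sub>F N in sequentially. \<bar>QN q s r z \<beta> N k (\<mu> N) - Qinf q s r z \<beta> \<nu> k\<bar> \<le> e / 2"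
          using eventually_ge_at_top[of N0]
        proof eventually_elim
          case (elim N)
          have "\<bar>\<mu> N i - \<nu> i\<bar> < \<delta>" if i: "i \<in> {1..s}" for i
          proof -
            have "\<bar>\<mu> N i - u n i\<bar> < \<delta> / 2" using elim(1) i by blast
            moreover have "\<bar>u n i - \<nu> i\<bar> < \<delta> / 2" using \<open>\<forall>i\<in>{1..s}. \<bar>u n i - \<nu> i\<bar> < \<delta> / 2\<close> i by blast
            ultimately have "\<bar>\<mu> N i - \<nu> i\<bar> < \<delta> / 2 + \<delta> / 2" by linarith
            then show ?thesis by simp
          qed
          then show ?case using N0[OF elim(2) \<mu>(1)] by (simp add: less_imp_le)
        qed
        then have "\<bar>Qinf q s r z \<beta> (u n) k - Qinf q s r z \<beta> \<nu> k\<bar> \<le> e / 2"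
          by (rule tendsto_upperbound[OF lim' _ sequentially_bot])
        then show ?case using e by (simp add: field_simps)
      qed
      then show "\<exists>no. \<forall>n\<ge>no. norm (Qinf q s r z \<beta> (u n) k - Qinf q s r z \<beta> \<nu> k) < e"
        unfolding eventually_sequentially .
    qed
  qed
qed

lemma fuzzy_gibbs_if_differentiable:
  assumes q: "sum r {1..s} = q" and r: "\<forall>i\<in>{1..s}. 0 < r i" and z: "1 < z" and \<beta>: "0 \<le> \<beta>"
    and D: "\<And>l v. l \<in> {1..s} \<Longrightarrow> 0 < v \<Longrightarrow> v \<le> 1 \<Longrightarrow> \<exists>d. (pressure z \<beta> (r l) has_real_derivative d) (at v)"
  shows "fuzzy_gibbs q s r z \<beta>"
proof (rule fuzzy_gibbs_if_lcp_exists)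
  fix \<nu> assume \<nu>: "\<nu> \<in> prob_simplex s"
  have r1: "1 \<le> r l" if "l \<in> {1..s}" for l using r that by (simp add: Suc_leI)
  have "\<exists>y>0. \<forall>n. (\<lambda>N. real (n N) / real N) \<longlonglongrightarrow> \<nu> l \<longrightarrow> (\<lambda>N. partition_ratio z \<beta> N (r l) (n N)) \<longlonglongrightarrow> y"
    if l: "l \<in> {1..s}" for l
  proof (cases "\<nu> l = 0")
    case True
    then show ?thesis
      using partition_ratio_tendsto_0[OF z \<beta> r1[OF l]] r1[OF l] by (intro exI[of _ "real (r l)"]) auto
  next
    case False
    then have v: "0 < \<nu> l" "\<nu> l \<le> 1" using prob_simplexD(1,2)[OF \<nu>, of l] by auto
    obtain d where "(pressure z \<beta> (r l) has_real_derivative d) (at (\<nu> l))" using D[OF l v] by blast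
    then show ?thesis using partition_ratio_tendsto[OF z \<beta> r1[OF l] v(1)] by (intro exI[of _ "exp d"]) auto
  qed
  then obtain \<Lambda> where \<Lambda>: "\<And>l. l \<in> {1..s} \<Longrightarrow> 0 < \<Lambda> l"
    "\<And>l n. l \<in> {1..s} \<Longrightarrow> (\<lambda>N. real (n N) / real N) \<longlonglongrightarrow> \<nu> l \<Longrightarrow> (\<lambda>N. partition_ratio z \<beta> N (r l) (n N)) \<longlonglongrightarrow> \<Lambda> l"
    by metis
  have s1: "1 \<le> s" using prob_simplexD(4)[OF \<nu>] by (cases s) auto
  have "lcp_limit_at q s r z \<beta> \<nu> (\<lambda>k. \<Lambda> k / (\<Sum>l\<in>{1..s}. \<Lambda> l))"
    unfolding lcp_limit_at_def
  proof (intro ballI allI impI)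
    fix k and \<mu> :: "nat \<Rightarrow> nat \<Rightarrow> real" assume k: "k \<in> {1..s}" and "(\<forall>N. admissible s N (\<mu> N)) \<and> \<mu> \<longlonglongrightarrow> \<nu>"
    then have adm: "\<forall>N. \<exists>\<eta>. \<eta> \<in> configs (N - 1) {1..s} \<and> emp \<eta> = \<mu> N" and lim: "\<mu> \<longlonglongrightarrow> \<nu>"
      by (auto simp: admissible_def)
    from choice[OF adm] obtain \<eta> where \<eta>: "\<And>N. \<eta> N \<in> configs (N - 1) {1..s}" "\<And>N. emp (\<eta> N) = \<mu> N" by blast
    have n: "(\<lambda>N. real (count_list (\<eta> N) l) / real N) \<longlonglongrightarrow> \<nu> l" for l
    proof (rule Lim_transform_eventually)
      have "(\<lambda>N. \<mu> N l) \<longlonglongrightarrow> \<nu> l" using lim unfolding tendsto_fun_iff by blast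
      \<comment> \<open>Empirical frequencies refer to \<open>N - 1\<close> sites, the ratios to the
        system size \<open>N\<close>.\<close>
      then have "(\<lambda>N. \<mu> N l * (1 - 1 / real N)) \<longlonglongrightarrow> \<nu> l * (1 - 0)"
        by (intro tendsto_mult tendsto_diff tendsto_const lim_1_over_n)
      then show "(\<lambda>N. \<mu> N l * (1 - 1 / real N)) \<longlonglongrightarrow> \<nu> l" by simp
      show "\<forall>\<^sub>F N in sequentially. \<mu> N l * (1 - 1 / real N) = real (count_list (\<eta> N) l) / real N"
        using eventually_ge_at_top[of 2]
      proof eventually_elim
        case (elim N)
        have "1 - 1 / real N = real (N - 1) / real N" using elim by (simp add: of_nat_diff diff_divide_distrib)
        then show ?case using \<eta>(1)[of N] elim unfolding \<eta>(2)[symmetric] by (simp add: emp_def configs_def)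
      qed
    qed
    have "(\<Sum>l\<in>{1..s}. \<Lambda> l) > 0" using s1 \<Lambda>(1) by (intro sum_pos) auto
    then have "(\<lambda>N. partition_ratio z \<beta> N (r k) (count_list (\<eta> N) k) / (\<Sum>l\<in>{1..s}. partition_ratio z \<beta> N (r l) (count_list (\<eta> N) l)))
        \<longlonglongrightarrow> \<Lambda> k / (\<Sum>l\<in>{1..s}. \<Lambda> l)"
      by (intro tendsto_divide tendsto_sum \<Lambda>(2) n k) auto
    then show "(\<lambda>N. QN q s r z \<beta> N k (\<mu> N)) \<longlonglongrightarrow> \<Lambda> k / (\<Sum>l\<in>{1..s}. \<Lambda> l)"
    proof (rule Lim_transform_eventually)
      show "\<forall>\<^sub>F N in sequentially. partition_ratio z \<beta> N (r k) (count_list (\<eta> N) k) / (\<Sum>l\<in>{1..s}. partition_ratio z \<beta> N (r l) (count_list (\<eta> N) l))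
          = QN q s r z \<beta> N k (\<mu> N)"
        using eventually_ge_at_top[of 2]
      proof eventually_elim
        case (elim N)
        show ?case using QN_eq[OF q r k elim \<eta>(1), of z \<beta>] \<eta>(2)[of N] by simp
      qed
    qed
  qed
  then show "lcp_exists q s r z \<beta> \<nu>" unfolding lcp_exists_def by blast
qed

text \<open>The point \<open>\<nu>\<close> gives class \<open>l\<close> its critical fraction and
  the rest to one other class \<open>l'\<close>. Between two nearby configurations with counts
  \<open>n1 < n2\<close> the ratio of \<open>l\<close> jumps by \<open>\<kappa>\<close>, that of
  \<open>l'\<close> does not increase because its count drops, and the empty classes keep theirs.
  With total ratio at most \<open>M\<close>, the conditional probability of \<open>l\<close> moves
  by at least \<open>\<kappa> / M\<^sup>2\<close>.\<close>

lemma fuzzy_not_lcp_exists: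
  assumes q: "sum r {1..s} = q" and r: "\<forall>i\<in>{1..s}. 0 < r i" and s2: "1 < s" and z: "2 < z"
    and l: "l \<in> {1..s}" and rl: "2 \<le> r l"
    and sp: "crit z (r l) * (z - 1) * (1 / real (r l)) powr (z - 1) < 1" and \<beta>: "crit z (r l) \<le> \<beta>"
  shows "\<exists>\<nu>\<in>prob_simplex s. \<not> lcp_exists q s r z \<beta> \<nu>"
proof -
  have z1: "1 < z" using z by simp
  have \<beta>0: "0 \<le> \<beta>" using crit_pos[OF z1 rl] \<beta> by simp
  have r1: "1 \<le> r i" if "i \<in> {1..s}" for i using r that by (simp add: Suc_leI)
  obtain v \<kappa> where v: "0 \<le> v" "v \<le> 1" and \<kappa>: "0 < \<kappa>" and jump: "\<And>\<epsilon>. 0 < \<epsilon> \<Longrightarrow> \<forall>\<^sub>F N in sequentially. \<exists>n1 n2. n1 < n2 \<and> n2 < N \<and>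
     \<bar>real n1 / real N - v\<bar> < \<epsilon> \<and> \<bar>real n2 / real N - v\<bar> < \<epsilon> \<and>
     partition_ratio z \<beta> N (r l) n1 + \<kappa> \<le> partition_ratio z \<beta> N (r l) n2"
    using partition_ratio_jump[OF z rl sp \<beta>] by blast
  define l' where "l' = (if l = 1 then 2 else 1::nat)"
  have l': "l' \<in> {1..s}" "l' \<noteq> l" using s2 by (auto simp: l'_def)
  define \<nu> where "\<nu> i = (if i = l then v else if i = l' then 1 - v else 0)" for i
  have two: "(\<Sum>i\<in>{1..s}. f i) = f l + f l'" if "\<And>i. i \<noteq> l \<Longrightarrow> i \<noteq> l' \<Longrightarrow> f i = 0" for f :: "nat \<Rightarrow> 'b::comm_monoid_add"
  proof -
    have "(\<Sum>i\<in>{1..s}. f i) = (\<Sum>i\<in>{l, l'}. f i)" using that l l' by (intro sum.mono_neutral_right) auto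
    then show ?thesis using l' by simp
  qed
  have "sum \<nu> {1..s} = 1" using l'(2) by (subst two) (auto simp: \<nu>_def)
  then have \<nu>: "\<nu> \<in> prob_simplex s" using v l l' by (auto simp: prob_simplex_def \<nu>_def)
  have "\<not> lcp_exists q s r z \<beta> \<nu>"
  proof
    assume "lcp_exists q s r z \<beta> \<nu>"
    then obtain Q where Q: "lcp_limit_at q s r z \<beta> \<nu> Q" unfolding lcp_exists_def by blast
    define M where "M = real q * exp \<beta>"
    have "r l \<le> q" unfolding q[symmetric] using l by (intro member_le_sum) auto
    then have M: "0 < M" using r1[OF l] by (simp add: M_def)
    \<comment> \<open>Two values within \<open>e\<close> of \<open>Q l\<close> differ by less than
      \<open>2 * e\<close>, exactly the jump that has to occur.\<close>
    define e where "e = \<kappa> / (2 * M\<^sup>2)"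
    have e: "0 < e" using \<kappa> M by (simp add: e_def)
    obtain \<delta> N0 where \<delta>: "0 < \<delta>" and N0: "\<And>N \<mu>. N0 \<le> N \<Longrightarrow> admissible s N \<mu> \<Longrightarrow> (\<And>i. i \<in> {1..s} \<Longrightarrow> \<bar>\<mu> i - \<nu> i\<bar> < \<delta>) \<Longrightarrow>
          \<bar>QN q s r z \<beta> N l \<mu> - Q l\<bar> < e"
      using lcp_limit_uniform[OF Q \<nu> l e] by blast
    have d2: "0 < \<delta> / 2" using \<delta> by simp
    have "\<forall>\<^sub>F N in sequentially. 1 / real N < \<delta> / 2" using lim_1_over_n d2 by (rule order_tendstoD(2))
    from eventually_conj[OF eventually_conj[OF jump[OF d2] this] eventually_ge_at_top[of "max N0 2"]]
    obtain N where N: "max N0 2 \<le> N" "1 / real N < \<delta> / 2" and "\<exists>n1 n2. n1 < n2 \<and> n2 < N \<and>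
     \<bar>real n1 / real N - v\<bar> < \<delta> / 2 \<and> \<bar>real n2 / real N - v\<bar> < \<delta> / 2 \<and>
     partition_ratio z \<beta> N (r l) n1 + \<kappa> \<le> partition_ratio z \<beta> N (r l) n2"
      using eventually_happens'[OF sequentially_bot] by blast
    then obtain n1 n2 where n: "n1 < n2" "n2 < N" "\<bar>real n1 / real N - v\<bar> < \<delta> / 2" "\<bar>real n2 / real N - v\<bar> < \<delta> / 2"
      "partition_ratio z \<beta> N (r l) n1 + \<kappa> \<le> partition_ratio z \<beta> N (r l) n2" by blast
    define m where "m n i = (if i = l then n else if i = l' then N - 1 - n else 0)" for n i :: nat
    define T where "T n = (\<Sum>i\<in>{1..s} - {l}. partition_ratio z \<beta> N (r i) (m n i))" for n
    define a where "a n = partition_ratio z \<beta> N (r l) n" for n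
    have near: "\<bar>a n / (a n + T n) - Q l\<bar> < e" if n: "n < N" "\<bar>real n / real N - v\<bar> < \<delta> / 2" for n
    proof -
      have ms: "(\<Sum>i\<in>{1..s}. m n i) = N - 1" using n(1) l'(2) by (subst two) (auto simp: m_def)
      obtain \<eta> where \<eta>: "\<eta> \<in> configs (N - 1) {1..s}" "\<And>i. i \<in> {1..s} \<Longrightarrow> count_list \<eta> i = m n i"
        using exists_config_counts[of "m n" s] unfolding ms by blast
      have adm: "admissible s N (emp \<eta>)" using \<eta>(1) unfolding admissible_def by blast
      \<comment> \<open>The jump is located in terms of \<open>n / N\<close>; passing to the
        frequency \<open>n / (N - 1)\<close> costs at most \<open>1 / N\<close>.\<close>
      have c: "\<bar>real n / real (N - 1) - v\<bar> < \<delta>"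
      proof -
        have "\<bar>x / y - x / (y + 1)\<bar> \<le> 1 / (y + 1)" if "0 < y" "0 \<le> x" "x \<le> y" for x y :: real
        proof -
          have eq: "x / y - x / (y + 1) = x / y * (1 / (y + 1))" using that by (simp add: field_simps)
          have "x / y * (1 / (y + 1)) \<le> 1 * (1 / (y + 1))" using that by (intro mult_right_mono) auto
          moreover have "0 \<le> x / y * (1 / (y + 1))" using that by simp
          ultimately show ?thesis unfolding eq by linarith
        qed
        moreover have "0 < real (N - 1)" "0 \<le> real n" "real n \<le> real (N - 1)" using N(1) n(1) by auto
        moreover have "real (N - 1) + 1 = real N" using N(1) by (simp add: of_nat_diff)
        ultimately have "\<bar>real n / real (N - 1) - real n / real N\<bar> \<le> 1 / real N" by metis
        from this N(2) have "\<bar>real n / real (N - 1) - real n / real N\<bar> < \<delta> / 2" by (rule le_less_trans)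
        moreover have "\<bar>x - w\<bar> < d + d" if "\<bar>x - y\<bar> < d" "\<bar>y - w\<bar> < d" for x y w d :: real
          using that by linarith
        ultimately have "\<bar>real n / real (N - 1) - v\<bar> < \<delta> / 2 + \<delta> / 2" using n(2) by blast
        then show ?thesis by simp
      qed
      have ei: "emp \<eta> i = real (m n i) / real (N - 1)" if "i \<in> {1..s}" for i
        using \<eta>(1) \<eta>(2)[OF that] by (simp add: emp_def configs_def)
      have "\<bar>emp \<eta> i - \<nu> i\<bar> < \<delta>" if i: "i \<in> {1..s}" for i
      proof -
        have "real (N - 1 - n) / real (N - 1) - (1 - v) = - (real n / real (N - 1) - v)"
        proof -
          have "real (N - 1 - n) = real (N - 1) - real n" using n(1) by (intro of_nat_diff) simp
          moreover have "0 < real (N - 1)" using N(1) by simp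
          ultimately show ?thesis by (simp only: diff_divide_distrib) simp
        qed
        then have "\<bar>real (N - 1 - n) / real (N - 1) - (1 - v)\<bar> < \<delta>" using c by (simp only: abs_minus_cancel)
        then show ?thesis unfolding ei[OF i] using c \<delta> by (auto simp: m_def \<nu>_def)
      qed
      from N0[OF _ adm this] N(1) have "\<bar>QN q s r z \<beta> N l (emp \<eta>) - Q l\<bar> < e" by simp
      moreover have "QN q s r z \<beta> N l (emp \<eta>) = a n / (a n + T n)"
      proof -
        have "(\<Sum>i\<in>{1..s}. partition_ratio z \<beta> N (r i) (count_list \<eta> i)) = (\<Sum>i\<in>{1..s}. partition_ratio z \<beta> N (r i) (m n i))"
          using \<eta>(2) by (intro sum.cong) auto
        also have "\<dots> = partition_ratio z \<beta> N (r l) (m n l) + T n" unfolding T_def using l by (intro sum.remove) auto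
        finally show ?thesis using QN_eq[OF q r l _ \<eta>(1), of z \<beta>] N(1) \<eta>(2)[OF l] by (simp add: a_def m_def)
      qed
      ultimately show ?thesis by simp
    qed
    have T12: "T n2 \<le> T n1"
      unfolding T_def using n(1,2) r1 by (intro sum_mono partition_ratio_mono z1 \<beta>0) (auto simp: m_def)
    have T1: "1 \<le> T n2"
    proof -
      have "1 \<le> real (r l')" using r1[OF l'(1)] by simp
      also have "\<dots> \<le> partition_ratio z \<beta> N (r l') (m n2 l')" by (rule partition_ratio_ge[OF z1 \<beta>0 r1[OF l'(1)]])
      also have "\<dots> \<le> T n2" unfolding T_def
        using l' partition_ratio_pos r1 by (intro member_le_sum) (auto intro: less_imp_le)
      finally show ?thesis .
    qed
    have tot: "a n + T n \<le> M" if nN: "n < N" for n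
    proof -
      have "a n + T n = (\<Sum>i\<in>{1..s}. partition_ratio z \<beta> N (r i) (m n i))"
        unfolding T_def a_def using sum.remove[of "{1..s}" l "\<lambda>i. partition_ratio z \<beta> N (r i) (m n i)"] l by (simp add: m_def)
      also have "\<dots> \<le> (\<Sum>i\<in>{1..s}. real (r i) * exp \<beta>)"
        using r1 nN by (intro sum_mono partition_ratio_le z1 \<beta>0) (auto simp: m_def)
      also have "\<dots> = M" unfolding M_def q[symmetric] by (simp add: sum_distrib_right)
      finally show ?thesis .
    qed
    have a0: "0 < a n" for n unfolding a_def by (rule partition_ratio_pos[OF r1[OF l]])
    have n1N: "n1 < N" using n by simp
    have "\<kappa> / M\<^sup>2 \<le> T n2 * (a n2 - a n1) / ((a n2 + T n2) * (a n1 + T n2))"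
    proof (rule frac_le)
      show "\<kappa> \<le> T n2 * (a n2 - a n1)"
        using n(5) T1 \<kappa> mult_mono[of 1 "T n2" \<kappa> "a n2 - a n1"] by (simp add: a_def)
      show "(a n2 + T n2) * (a n1 + T n2) \<le> M\<^sup>2"
        unfolding power2_eq_square using tot[OF n(2)] tot[OF n1N] T12 T1 a0[of n1] M by (intro mult_mono; linarith)
      show "0 < (a n2 + T n2) * (a n1 + T n2)" using a0 T1 by (intro mult_pos_pos add_pos_pos) auto
      show "0 \<le> T n2 * (a n2 - a n1)" using n(5) T1 \<kappa> by (simp add: a_def)
    qed
    also have "\<dots> = a n2 / (a n2 + T n2) - a n1 / (a n1 + T n2)"
    proof -
      have "a n2 + T n2 \<noteq> 0" "a n1 + T n2 \<noteq> 0" using a0[of n1] a0[of n2] T1 by linarith+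
      then show ?thesis by (simp add: diff_frac_eq algebra_simps)
    qed
    also have "\<dots> \<le> a n2 / (a n2 + T n2) - a n1 / (a n1 + T n1)"
    proof -
      have "a n1 / (a n1 + T n1) \<le> a n1 / (a n1 + T n2)"
        using T12 a0[of n1] T1 by (intro divide_left_mono mult_pos_pos) auto
      then show ?thesis by simp
    qed
    also have "\<dots> < 2 * e" using near[OF n(2,4)] near[OF n1N n(3)] by linarith
    also have "\<dots> = \<kappa> / M\<^sup>2" using M by (simp add: e_def)
    finally show False by simp
  qed
  then show ?thesis using \<nu> by blast
qed

text \<open>Fractions are at most 1, so the effective inverse temperature never exceeds
  \<open>\<beta>\<close>. The strict inequality \<open>b > \<beta>\<close> is what gives
  differentiability at the fraction 1 as well.\<close>

lemma fuzzy_gibbs_criterion: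
  assumes q: "sum r {1..s} = q" and r: "\<forall>i\<in>{1..s}. 0 < r i" and z: "2 < z" and \<beta>: "0 \<le> \<beta>"
    and D: "\<And>l. l \<in> {1..s} \<Longrightarrow> (\<exists>b>\<beta>. disordered z (r l) b) \<or> (r l = 2 \<and> z \<le> 4)"
  shows "fuzzy_gibbs q s r z \<beta>"
proof (rule fuzzy_gibbs_if_differentiable[OF q r _ \<beta>])
  show z1: "1 < z" using z by simp
  fix l v assume l: "l \<in> {1..s}" and v: "0 < v" "v \<le> (1::real)"
  have r1: "1 \<le> r l" using r l by (simp add: Suc_leI)
  have "\<bar>v\<bar> \<le> 1" using v by simp
  then have "v powr (z - 1) \<le> 1" using z by (intro powr_le1) auto
  then have bv: "\<beta> * v powr (z - 1) \<le> \<beta>" using \<beta> by (simp add: mult_left_le)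
  from D[OF l] show "\<exists>d. (pressure z \<beta> (r l) has_real_derivative d) (at v)"
  proof
    assume "\<exists>b>\<beta>. disordered z (r l) b"
    then obtain b where b: "\<beta> < b" "disordered z (r l) b" by blast
    from bv b(1) have "\<beta> * v powr (z - 1) < b" by (rule le_less_trans)
    from pressure_deriv_disordered[OF z1 r1 v(1) b(2) this] show ?thesis by blast
  next
    assume "r l = 2 \<and> z \<le> 4"
    then show ?thesis using pressure_deriv_two_states[OF z _ \<beta> v(1)] by simp
  qed
qed

text \<open>\<open>k\<close> is the least number of states with a first-order transition, 2 for
  \<open>z > 4\<close> and 3 for \<open>z \<le> 4\<close>; classes with fewer states never produce a
  kink. As the critical value does not decrease with the number of states, below that of
  \<open>m\<close> every class with at least \<open>k\<close> states is still disordered.\<close>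

lemma fuzzy_phase_transition:
  assumes q: "sum r {1..s} = q" and r: "\<forall>i\<in>{1..s}. 0 < r i" and s: "1 < s" and z: "2 < z"
    and k: "2 \<le> k" "3 \<le> k \<or> 4 < z" and ex: "\<exists>i\<in>{1..s}. k \<le> r i"
    and small: "\<And>i. i \<in> {1..s} \<Longrightarrow> r i < k \<Longrightarrow> r i = 1 \<or> r i = 2 \<and> z \<le> 4"
  defines "m \<equiv> Min {r i | i. i \<in> {1..s} \<and> k \<le> r i}"
  shows "0 \<le> \<beta> \<Longrightarrow> \<beta> < potts_crit m z \<Longrightarrow> fuzzy_gibbs q s r z \<beta>"
    and "potts_crit m z \<le> \<beta> \<Longrightarrow> \<exists>\<nu>\<in>prob_simplex s. \<not> lcp_exists q s r z \<beta> \<nu>"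
proof -
  let ?S = "{r i | i. i \<in> {1..s} \<and> k \<le> r i}"
  have z1: "1 < z" using z by simp
  have fin: "finite ?S" by simp
  have "?S \<noteq> {}" using ex by blast
  then have "m \<in> ?S" unfolding m_def by (rule Min_in[OF fin])
  then obtain l where l: "l \<in> {1..s}" "k \<le> r l" "m = r l" by blast
  have m2: "2 \<le> m" using l k by simp
  have le: "m \<le> r i" if "i \<in> {1..s}" "k \<le> r i" for i
    unfolding m_def using that by (intro Min_le[OF fin]) blast
  have pc: "potts_crit m z = crit z m" by (rule potts_crit_eq_crit[OF z1 m2])
  show "fuzzy_gibbs q s r z \<beta>" if b: "0 \<le> \<beta>" "\<beta> < potts_crit m z"
  proof (rule fuzzy_gibbs_criterion[OF q r z b(1)])
    fix i assume i: "i \<in> {1..s}"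
    show "(\<exists>b>\<beta>. disordered z (r i) b) \<or> (r i = 2 \<and> z \<le> 4)"
    proof (cases "k \<le> r i")
      case True
      have "disordered z (r i) (crit z m)"
        using disordered_more_states[OF z1 _ m2 le[OF i True] disordered_crit[OF z1 m2]] crit_pos[OF z1 m2] by simp
      then show ?thesis using b(2) unfolding pc by blast
    next
      case False
      then have "r i = 1 \<or> r i = 2 \<and> z \<le> 4" using small[OF i] by simp
      then show ?thesis
      proof
        assume "r i = 1"
        then have "disordered z (r i) (\<beta> + 1)" using disordered_one_state by simp
        then show ?thesis by (intro disjI1 exI[of _ "\<beta> + 1"]) simp
      qed simp
    qed
  qed
  show "\<exists>\<nu>\<in>prob_simplex s. \<not> lcp_exists q s r z \<beta> \<nu>" if b: "potts_crit m z \<le> \<beta>"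
  proof (rule fuzzy_not_lcp_exists[OF q r s z l(1)])
    show rl: "2 \<le> r l" using m2 l(3) by simp
    have "3 \<le> r l \<or> r l = 2 \<and> 4 < z" using rl l(2) k by linarith
    then show "crit z (r l) * (z - 1) * (1 / real (r l)) powr (z - 1) < 1" by (rule crit_below_spinodal_cases[OF z1])
    show "crit z (r l) \<le> \<beta>" using b unfolding pc unfolding l(3) .
  qed
qed

theorem theorem3p3:
  fixes q s :: nat and r :: "nat \<Rightarrow> nat" and z :: real
  assumes "q \<ge> 3" and "1 < s" and "s < q"
    and "\<forall>i\<in>{1..s}. 0 < r i" and "(\<Sum>i\<in>{1..s}. r i) = q"
    and "z > 2"
  shows "(z \<le> 4 \<and> (\<forall>i\<in>{1..s}. r i \<le> 2) \<longrightarrow>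
            (\<forall>\<beta>\<ge>0. fuzzy_gibbs q s r z \<beta>))
       \<and> (z > 4 \<longrightarrow>
            (let rh = Min {r i | i. i \<in> {1..s} \<and> 2 \<le> r i} in
              (\<forall>\<beta>. 0 \<le> \<beta> \<and> \<beta> < potts_crit rh z \<longrightarrow> fuzzy_gibbs q s r z \<beta>) \<and>
              (\<forall>\<beta>. potts_crit rh z \<le> \<beta> \<longrightarrow>
                  (\<exists>\<nu>\<in>prob_simplex s. \<not> lcp_exists q s r z \<beta> \<nu>))))
       \<and> (z \<le> 4 \<and> (\<exists>i\<in>{1..s}. 3 \<le> r i) \<longrightarrow>
            (let rs = Min {r i | i. i \<in> {1..s} \<and> 3 \<le> r i} in
              (\<forall>\<beta>. 0 \<le> \<beta> \<and> \<beta> < potts_crit rs z \<longrightarrow> fuzzy_gibbs q s r z \<beta>) \<and>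
              (\<forall>\<beta>. potts_crit rs z \<le> \<beta> \<longrightarrow>
                  (\<exists>\<nu>\<in>prob_simplex s. \<not> lcp_exists q s r z \<beta> \<nu>))))"
proof -
  note q = assms(5) and r = assms(4) and s = assms(2) and z = assms(6)
  have 1: "fuzzy_gibbs q s r z \<beta>" if "z \<le> 4" "\<forall>i\<in>{1..s}. r i \<le> 2" "0 \<le> \<beta>" for \<beta>
  proof (rule fuzzy_gibbs_criterion[OF q r z that(3)])
    fix i assume i: "i \<in> {1..s}"
    have "r i \<le> 2" "0 < r i" using that(2) r i by auto
    then consider "r i = 1" | "r i = 2" by linarith
    then show "(\<exists>b>\<beta>. disordered z (r i) b) \<or> (r i = 2 \<and> z \<le> 4)"
    proof cases
      case 1
      then have "disordered z (r i) (\<beta> + 1)" using disordered_one_state by simp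
      then show ?thesis by (intro disjI1 exI[of _ "\<beta> + 1"]) simp
    qed (use that(1) in simp)
  qed
  \<comment> \<open>If every class had a single state there would be as many classes as states,
    against \<open>s < q\<close>; so the minimum for \<open>z > 4\<close> is over a nonempty
    set.\<close>
  have ex2: "\<exists>i\<in>{1..s}. 2 \<le> r i"
  proof (rule ccontr)
    assume none: "\<not> ?thesis"
    have "r i \<le> 1" if "i \<in> {1..s}" for i
    proof -
      have "\<not> 2 \<le> r i" using none that by blast
      then show ?thesis by linarith
    qed
    then have "(\<Sum>i\<in>{1..s}. r i) \<le> (\<Sum>i\<in>{1..s}. 1)" by (rule sum_mono)
    then show False using q assms(3) by simp
  qed
  have small2: "r i = 1 \<or> r i = 2 \<and> z \<le> 4" if "i \<in> {1..s}" "r i < 2" for i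
    using that r by force
  have small3: "r i = 1 \<or> r i = 2 \<and> z \<le> 4" if "z \<le> 4" "i \<in> {1..s}" "r i < 3" for i
  proof -
    have "0 < r i" using r that(2) by blast
    then show ?thesis using that by linarith
  qed
  show ?thesis
    unfolding Let_def
  proof (intro conjI impI allI)
    fix \<beta> :: real assume "z \<le> 4 \<and> (\<forall>i\<in>{1..s}. r i \<le> 2)" "0 \<le> \<beta>"
    then show "fuzzy_gibbs q s r z \<beta>" using 1 by blast
  next
    fix \<beta> :: real assume z4: "z > 4" and "0 \<le> \<beta> \<and> \<beta> < potts_crit (Min {r i | i. i \<in> {1..s} \<and> 2 \<le> r i}) z"
    then show "fuzzy_gibbs q s r z \<beta>"
      using fuzzy_phase_transition(1)[OF q r s z order_refl disjI2[OF z4] ex2 small2] by blast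
  next
    fix \<beta> :: real assume z4: "z > 4" and "potts_crit (Min {r i | i. i \<in> {1..s} \<and> 2 \<le> r i}) z \<le> \<beta>"
    then show "\<exists>\<nu>\<in>prob_simplex s. \<not> lcp_exists q s r z \<beta> \<nu>"
      using fuzzy_phase_transition(2)[OF q r s z order_refl disjI2[OF z4] ex2 small2] by blast
  next
    fix \<beta> :: real assume a: "z \<le> 4 \<and> (\<exists>i\<in>{1..s}. 3 \<le> r i)"
      and b: "0 \<le> \<beta> \<and> \<beta> < potts_crit (Min {r i | i. i \<in> {1..s} \<and> 3 \<le> r i}) z"
    show "fuzzy_gibbs q s r z \<beta>"
      using fuzzy_phase_transition(1)[OF q r s z _ disjI1[OF order_refl] conjunct2[OF a] small3[OF conjunct1[OF a]]] b by simp
  next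
    fix \<beta> :: real assume a: "z \<le> 4 \<and> (\<exists>i\<in>{1..s}. 3 \<le> r i)"
      and b: "potts_crit (Min {r i | i. i \<in> {1..s} \<and> 3 \<le> r i}) z \<le> \<beta>"
    show "\<exists>\<nu>\<in>prob_simplex s. \<not> lcp_exists q s r z \<beta> \<nu>"
      using fuzzy_phase_transition(2)[OF q r s z _ disjI1[OF order_refl] conjunct2[OF a] small3[OF conjunct1[OF a]]] b by simp
  qed
qed

end
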